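(* Let $p,q\ge1$ with $p+q=n+1$, and let $\Delta'$ be a multi-fan obtained from a multi-fan $\Delta$ based on an oriented pseudomanifold by a $(p,q)$-flip. Then, writing $\mathrm{dm}(\Delta)=(\dim\mathcal A^0(\Delta),\dim\mathcal A^2(\Delta),\dots,\dim\mathcal A^{2n}(\Delta))$, $$\mathrm{dm}(\Delta')-\mathrm{dm}(\Delta)=(\underbrace{1,\dots,1}_{q},0,\dots,0)-(\underbrace{1,\dots,1}_{p},0,\dots,0)\in\mathbb Z^{n+1}.$$
   Context: Let $V$ be an oriented real $n$-dimensional vector space with inner product ($V^*=V$). An oriented pseudomanifold $K$ of dimension $n-1$ on a vertex set is a pure simplicial complex in which every $(n-2)$-simplex lies in exactly two $(n-1)$-simplices, with orientations of the $(n-1)$-simplices whose sum is a cycle. A multi-fan based on $K$: $\lambda$ from the vertex set to $V$ with $\{\lambda(i)\}_{i\in I}$ a basis for every maximal simplex $I$; $w(I)=+1$ if the orientation of $I$ from $K$ agrees with the one in which $(i_1,\dots,i_n)$ is positive iff $(\lambda(i_1),\dots,\lambda(i_n))$ is a positive basis, $-1$ otherwise, $w=0$ on other $n$-subsets. This is a complete simplicial multi-fan $\Delta=(w,\lambda)$. Algebra: with $\deg x_i=2$, for maximal $I$ let $\{u^I_i\}$ be the dual basis to $\{\lambda(i)\}_{i\in I}$, $\iota_I(x_i)=u^I_i$ for $i\in I$, $0$ otherwise, $|\det\lambda_I|$ the volume of the parallelepiped; for $x$ of degree $2n$, $\int_\Delta x=\sum_I\frac{w(I)\iota_I(x)}{|\det\lambda_I|\prod_{i\in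 I}\iota_I(x_i)}$ is a constant; $V_\Delta(c)=\frac1{n!}\int_\Delta(\sum_ic_ix_i)^n$; $\mathcal A^*(\Delta)=\mathbb R[\partial_i]/\{D:DV_\Delta=0\}$ with $\partial_i=\partial/\partial c_i$ of degree $2$. Flips (the result $K'$ is oriented so as to agree with $K$ on all common maximal simplices, and $\Delta'$ is the multi-fan based on $K'$ with the indicated $\lambda$). $(p,q)$-flip with $p,q\ge2$: $S$ is a set of $n+1$ vertices, $S=S_1\sqcup S_2$, $|S_1|=p$, $|S_2|=q$, such that the subcomplex of $K$ induced on $S$ is the join $\partial\Delta^{S_1}*\Delta^{S_2}$ (maximal simplices $S\setminus\{s\}$, $s\in S_1$), and every $n$ of the vectors $\{\lambda(s)\}_{s\in S}$ are linearly independent; $K'$ is obtained by replacing it with $\Delta^{S_1}*\partial\Delta^{S_2}$ (maximal simplices $S\setminus\{s\}$, $s\in S_2$), with the same $\lambda$. $(1,n)$-flip: for a maximal simplex $I$ of $K$, add a new vertex $i$ and replace $I$ by the cone over $\partial I$ with apex $i$, extending $\lambda$ by a vector $\lambda(i)$ such that $\{\lambda(j)\}_{j\in(I\setminus\{s\})\cup\{i\}}$ is a basis for every $s\in I$. $(n,1)$-flip: the inverse operation, applicable to a vertex $i$ whose link is the boundary of a simplex on $n$ vertices with linearly independent $\lambda$-values: remove $i$ and replace its star by that simplex. *)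

theory Defs
  imports "HOL-Analysis.Analysis" "HOL-Library.Poly_Mapping"
    "HOL-Combinatorics.Permutations" "HOL-Algebra.Embedded_Algebras" "HOL-Algebra.QuotRing"
begin

section \<open>Oriented pseudomanifolds\<close>

text \<open>
  A simplicial complex is given by its set of faces, the empty face included; its vertex set
  is \<open>\<Union>K\<close>.  The parameter \<open>n\<close> is the number of vertices of a maximal simplex, so
  complexes below have dimension \<open>n - 1\<close>.
\<close>

definition simplicial_complex :: "'v set set \<Rightarrow> bool" where
  "simplicial_complex K \<longleftrightarrow>
     finite K \<and> {} \<in> K \<and> (\<forall>\<sigma>\<in>K. finite \<sigma>) \<and> (\<forall>\<sigma>\<in>K. \<forall>\<tau>. \<tau> \<subseteq> \<sigma> \<longrightarrow> \<tau> \<in> K)"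

definition facets :: "nat \<Rightarrow> 'v set set \<Rightarrow> 'v set set" where
  "facets n K = {I \<in> K. card I = n}"

definition pure :: "nat \<Rightarrow> 'v set set \<Rightarrow> bool" where
  "pure n K \<longleftrightarrow> (\<forall>\<sigma>\<in>K. \<exists>I\<in>facets n K. \<sigma> \<subseteq> I)"

definition pseudomanifold :: "nat \<Rightarrow> 'v set set \<Rightarrow> bool" where
  "pseudomanifold n K \<longleftrightarrow> simplicial_complex K \<and> pure n K \<and>
     (\<forall>\<rho>\<in>K. card \<rho> = n - 1 \<longrightarrow> card {I \<in> facets n K. \<rho> \<subseteq> I} = 2)"

text \<open>
  An ordering of an \<open>n\<close>-element set \<open>I\<close> is a bijection \<open>f\<close> from a fixed index type \<open>'n\<close> with
  \<open>n\<close> elements onto \<open>I\<close>, and ordered bases of \<open>V\<close> are indexed by the same type; this way no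
  linear order on \<open>'n\<close> has to be chosen.  Orientations of the maximal simplices are encoded by
  a sign function \<open>\<epsilon>\<close> on their orderings, \<open>\<epsilon> f = 1\<close> meaning that \<open>f\<close> is a positive ordering of
  its range.
\<close>

definition ordering :: "('n::finite \<Rightarrow> 'v) \<Rightarrow> 'v set \<Rightarrow> bool" where
  "ordering f I \<longleftrightarrow> bij_betw f UNIV I"

definition orients_facets :: "'v set set \<Rightarrow> (('n::finite \<Rightarrow> 'v) \<Rightarrow> int) \<Rightarrow> bool" where
  "orients_facets K \<epsilon> \<longleftrightarrow>
     (\<forall>I\<in>facets CARD('n) K. \<forall>f. ordering f I \<longrightarrow>
        \<epsilon> f \<in> {1, -1} \<and> (\<forall>\<pi>. \<pi> permutes UNIV \<longrightarrow> \<epsilon> (f \<circ> \<pi>) = sign \<pi> * \<epsilon> f))"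

text \<open>
  The restriction of \<open>f\<close> to \<open>- {j}\<close> is an ordered \<open>(n - 2)\<close>-simplex.  Up to a sign depending
  only on \<open>j\<close>, its coefficient in the boundary of the sum of the oriented maximal simplices is
  the sum of \<open>\<epsilon> (f(j := v))\<close> over the vertices \<open>v\<close> that complete it to a maximal simplex.
\<close>

definition is_cycle :: "'v set set \<Rightarrow> (('n::finite \<Rightarrow> 'v) \<Rightarrow> int) \<Rightarrow> bool" where
  "is_cycle K \<epsilon> \<longleftrightarrow>
     (\<forall>f j. inj_on f (- {j}) \<and> f ` (- {j}) \<in> K \<longrightarrow>
        (\<Sum>v | \<exists>I\<in>facets CARD('n) K. ordering (f(j := v)) I. \<epsilon> (f(j := v))) = 0)"

definition oriented_pseudomanifold :: "'v set set \<Rightarrow> (('n::finite \<Rightarrow> 'v) \<Rightarrow> int) \<Rightarrow> bool" where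
  "oriented_pseudomanifold K \<epsilon> \<longleftrightarrow>
     pseudomanifold CARD('n) K \<and> orients_facets K \<epsilon> \<and> is_cycle K \<epsilon>"


section \<open>Multi-fans\<close>

text \<open>
  The orientation of \<open>V = 'a\<close> is given by an orthonormal basis \<open>e\<close>, indexed by \<open>'n\<close>, that is
  declared to be positive.
\<close>

definition orthonormal_frame :: "('n::finite \<Rightarrow> 'a::euclidean_space) \<Rightarrow> bool" where
  "orthonormal_frame e \<longleftrightarrow> (\<forall>i j. e i \<bullet> e j = (if i = j then 1 else 0)) \<and> span (range e) = UNIV"

definition frame_det :: "('n::finite \<Rightarrow> 'a::euclidean_space) \<Rightarrow> ('n \<Rightarrow> 'a) \<Rightarrow> real" where
  "frame_det e b = det (\<chi> i j. b i \<bullet> e j)"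

definition positive_basis :: "('n::finite \<Rightarrow> 'a::euclidean_space) \<Rightarrow> ('n \<Rightarrow> 'a) \<Rightarrow> bool" where
  "positive_basis e b \<longleftrightarrow> frame_det e b > 0"

definition lin_indep_family :: "('v \<Rightarrow> 'a::real_vector) \<Rightarrow> 'v set \<Rightarrow> bool" where
  "lin_indep_family lam I \<longleftrightarrow> inj_on lam I \<and> independent (lam ` I)"

definition basis_family :: "('v \<Rightarrow> 'a::real_vector) \<Rightarrow> 'v set \<Rightarrow> bool" where
  "basis_family lam I \<longleftrightarrow> lin_indep_family lam I \<and> span (lam ` I) = UNIV"

text \<open>Only the values of \<open>lam\<close> on the vertex set \<open>\<Union>K\<close> are meaningful.\<close>

definition multifan_data ::
  "'v set set \<Rightarrow> (('n::finite \<Rightarrow> 'v) \<Rightarrow> int) \<Rightarrow> ('v \<Rightarrow> 'a::euclidean_space) \<Rightarrow> bool" where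
  "multifan_data K \<epsilon> lam \<longleftrightarrow>
     oriented_pseudomanifold K \<epsilon> \<and> (\<forall>I\<in>facets CARD('n) K. basis_family lam I)"

definition weight :: "('n::finite \<Rightarrow> 'a::euclidean_space) \<Rightarrow> 'v set set \<Rightarrow>
    (('n \<Rightarrow> 'v) \<Rightarrow> int) \<Rightarrow> ('v \<Rightarrow> 'a) \<Rightarrow> 'v set \<Rightarrow> int" where
  "weight e K \<epsilon> lam I =
     (if I \<in> facets CARD('n) K
      then if \<forall>f. ordering f I \<longrightarrow> (\<epsilon> f = 1 \<longleftrightarrow> positive_basis e (lam \<circ> f)) then 1 else -1
      else 0)"


section \<open>Real polynomials\<close>

text \<open>
  Monomials are finitely supported exponent functions.  The same polynomials serve for
  \<open>\<real>[x\<^sub>i]\<close>, for \<open>\<real>[c\<^sub>i]\<close> and for \<open>\<real>[\<partial>\<^sub>i]\<close>.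
\<close>

type_synonym 'v rpoly = "('v \<Rightarrow>\<^sub>0 nat) \<Rightarrow>\<^sub>0 real"

definition rconst :: "real \<Rightarrow> 'v rpoly" where
  "rconst r = Poly_Mapping.single 0 r"

definition rvar :: "'v \<Rightarrow> 'v rpoly" where
  "rvar i = Poly_Mapping.single (Poly_Mapping.single i 1) 1"

definition rpolys :: "'v set \<Rightarrow> 'v rpoly set" where
  "rpolys X = {P. \<forall>m\<in>Poly_Mapping.keys P. Poly_Mapping.keys m \<subseteq> X}"

definition poly_eval :: "('v \<Rightarrow> real) \<Rightarrow> 'v rpoly \<Rightarrow> real" where
  "poly_eval c P = (\<Sum>m\<in>Poly_Mapping.keys P.
     Poly_Mapping.lookup P m * (\<Prod>i\<in>Poly_Mapping.keys m. c i ^ Poly_Mapping.lookup m i))"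

text \<open>Every variable has degree \<open>2\<close>.\<close>

definition homogeneous :: "nat \<Rightarrow> 'v rpoly \<Rightarrow> bool" where
  "homogeneous d P \<longleftrightarrow>
     (\<forall>m\<in>Poly_Mapping.keys P. (\<Sum>i\<in>Poly_Mapping.keys m. 2 * Poly_Mapping.lookup m i) = d)"

definition partial :: "'v \<Rightarrow> 'v rpoly \<Rightarrow> 'v rpoly" where
  "partial i P = (\<Sum>m\<in>Poly_Mapping.keys P.
     Poly_Mapping.single (m - Poly_Mapping.single i 1)
       (real (Poly_Mapping.lookup m i) * Poly_Mapping.lookup P m))"

text \<open>The partial derivatives commute, so the fold does not depend on an order of the variables.\<close>

definition partial_monomial :: "('v \<Rightarrow>\<^sub>0 nat) \<Rightarrow> 'v rpoly \<Rightarrow> 'v rpoly" where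
  "partial_monomial m P =
     Finite_Set.fold (\<lambda>i. partial i ^^ Poly_Mapping.lookup m i) P (Poly_Mapping.keys m)"

definition diff_op :: "'v rpoly \<Rightarrow> 'v rpoly \<Rightarrow> 'v rpoly" where
  "diff_op D P = (\<Sum>m\<in>Poly_Mapping.keys D.
     rconst (Poly_Mapping.lookup D m) * partial_monomial m P)"


section \<open>The volume polynomial and its algebra\<close>

text \<open>Dual space and \<open>V\<close> are identified by the inner product.\<close>

definition dual_vec :: "('v \<Rightarrow> 'a::euclidean_space) \<Rightarrow> 'v set \<Rightarrow> 'v \<Rightarrow> 'a" where
  "dual_vec lam I i = (THE u. \<forall>j\<in>I. u \<bullet> lam j = (if j = i then 1 else 0))"

text \<open>
  Elements of the symmetric algebra of the dual space are treated as polynomial functions of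
  \<open>y \<in> V\<close>.
\<close>

definition iota :: "('v \<Rightarrow> 'a::euclidean_space) \<Rightarrow> 'v set \<Rightarrow> 'v rpoly \<Rightarrow> 'a \<Rightarrow> real" where
  "iota lam I P y = poly_eval (\<lambda>i. if i \<in> I then dual_vec lam I i \<bullet> y else 0) P"

definition abs_det ::
  "('n::finite \<Rightarrow> 'a::euclidean_space) \<Rightarrow> ('v \<Rightarrow> 'a) \<Rightarrow> 'v set \<Rightarrow> real" where
  "abs_det e lam I = (THE d. \<forall>f. ordering f I \<longrightarrow> d = \<bar>frame_det e (lam \<circ> f)\<bar>)"

text \<open>
  The sum defining the integral is a rational function on \<open>V\<close>; the integral is its constant
  value at the points \<open>y\<close> where no denominator vanishes.
\<close>

definition mf_integral :: "('n::finite \<Rightarrow> 'a::euclidean_space) \<Rightarrow> ('v set \<Rightarrow> int) \<Rightarrow>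
    ('v \<Rightarrow> 'a) \<Rightarrow> 'v rpoly \<Rightarrow> real" where
  "mf_integral e w lam P = (THE r. \<forall>y.
     (\<forall>I. w I \<noteq> 0 \<longrightarrow> (\<forall>i\<in>I. iota lam I (rvar i) y \<noteq> 0)) \<longrightarrow>
     (\<Sum>I | w I \<noteq> 0. of_int (w I) * iota lam I P y /
        (abs_det e lam I * (\<Prod>i\<in>I. iota lam I (rvar i) y))) = r)"

definition volume_poly :: "('n::finite \<Rightarrow> 'a::euclidean_space) \<Rightarrow> 'v set \<Rightarrow> ('v set \<Rightarrow> int) \<Rightarrow>
    ('v \<Rightarrow> 'a) \<Rightarrow> 'v rpoly" where
  "volume_poly e X w lam = (THE P. P \<in> rpolys X \<and>
     (\<forall>c. poly_eval c P = 1 / fact CARD('n) *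
        mf_integral e w lam ((\<Sum>i\<in>X. rconst (c i) * rvar i) ^ CARD('n))))"

definition rpoly_ring :: "'v set \<Rightarrow> 'v rpoly ring" where
  "rpoly_ring X = \<lparr>carrier = rpolys X, mult = (*), one = 1, zero = 0, add = (+)\<rparr>"

definition annihilator :: "'v set \<Rightarrow> 'v rpoly \<Rightarrow> 'v rpoly set" where
  "annihilator X P = {D \<in> rpolys X. diff_op D P = 0}"

definition dual_algebra :: "'v set \<Rightarrow> 'v rpoly \<Rightarrow> 'v rpoly set ring" where
  "dual_algebra X P = rpoly_ring X Quot annihilator X P"

definition residue_class :: "'v set \<Rightarrow> 'v rpoly \<Rightarrow> 'v rpoly \<Rightarrow> 'v rpoly set" where
  "residue_class X P D = annihilator X P +>\<^bsub>rpoly_ring X\<^esub> D"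

definition graded_part :: "'v set \<Rightarrow> 'v rpoly \<Rightarrow> nat \<Rightarrow> 'v rpoly set set" where
  "graded_part X P d = residue_class X P ` {D \<in> rpolys X. homogeneous d D}"

text \<open>Dimension over the ground field, i.e. over the image of the constants in the algebra.\<close>

definition graded_dim :: "'v set \<Rightarrow> 'v rpoly \<Rightarrow> nat \<Rightarrow> nat" where
  "graded_dim X P d =
     ring.dim (dual_algebra X P) (residue_class X P ` range rconst) (graded_part X P d)"

definition dm :: "('n::finite \<Rightarrow> 'a::euclidean_space) \<Rightarrow> 'v set set \<Rightarrow>
    (('n \<Rightarrow> 'v) \<Rightarrow> int) \<Rightarrow> ('v \<Rightarrow> 'a) \<Rightarrow> int list" where
  "dm e K \<epsilon> lam =
     map (\<lambda>k. int (graded_dim (\<Union>K) (volume_poly e (\<Union>K) (weight e K \<epsilon> lam) lam) (2 * k)))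
       [0..<CARD('n) + 1]"


section \<open>Flips\<close>

definition join :: "'v set set \<Rightarrow> 'v set set \<Rightarrow> 'v set set" where
  "join A B = {\<sigma> \<union> \<tau> | \<sigma> \<tau>. \<sigma> \<in> A \<and> \<tau> \<in> B}"

definition simplex_boundary :: "'v set \<Rightarrow> 'v set set" where
  "simplex_boundary S = Pow S - {S}"

definition induced :: "'v set set \<Rightarrow> 'v set \<Rightarrow> 'v set set" where
  "induced K S = {\<sigma> \<in> K. \<sigma> \<subseteq> S}"

text \<open>
  The subcomplex is replaced as a set of faces.  In particular \<open>S2\<close> is no longer a face
  afterwards, hence the outcome is a simplicial complex iff \<open>S2\<close> lies in no face
  of \<open>K\<close> outside \<open>S1 \<union> S2\<close>.
\<close>

definition bistellar_flip ::
  "nat \<Rightarrow> nat \<Rightarrow> 'v set set \<Rightarrow> ('v \<Rightarrow> 'a::real_vector) \<Rightarrow> 'v set set \<Rightarrow> bool" where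
  "bistellar_flip p q K lam K' \<longleftrightarrow>
     (\<exists>S1 S2. finite S1 \<and> finite S2 \<and> S1 \<inter> S2 = {} \<and> card S1 = p \<and> card S2 = q \<and>
        induced K (S1 \<union> S2) = join (simplex_boundary S1) (Pow S2) \<and>
        (\<forall>s\<in>S1 \<union> S2. lin_indep_family lam (S1 \<union> S2 - {s})) \<and>
        K' = (K - join (simplex_boundary S1) (Pow S2)) \<union> join (Pow S1) (simplex_boundary S2))"

definition stellar_flip ::
  "nat \<Rightarrow> 'v set set \<Rightarrow> 'v set set \<Rightarrow> ('v \<Rightarrow> 'a::real_vector) \<Rightarrow> bool" where
  "stellar_flip n K K' lam' \<longleftrightarrow>
     (\<exists>I i. I \<in> facets n K \<and> i \<notin> \<Union>K \<and>
        K' = (K - {I}) \<union> join (Pow {i}) (simplex_boundary I) \<and>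
        (\<forall>s\<in>I. basis_family lam' (insert i (I - {s}))))"

text \<open>
  For \<open>n = 1\<close> a \<open>(1,n)\<close>-flip also removes a vertex, so \<open>lam\<close> and \<open>lam'\<close> are compared on the
  common vertices.
\<close>

definition is_flip :: "nat \<Rightarrow> nat \<Rightarrow>
    'v set set \<Rightarrow> (('n::finite \<Rightarrow> 'v) \<Rightarrow> int) \<Rightarrow> ('v \<Rightarrow> 'a::euclidean_space) \<Rightarrow>
    'v set set \<Rightarrow> (('n \<Rightarrow> 'v) \<Rightarrow> int) \<Rightarrow> ('v \<Rightarrow> 'a) \<Rightarrow> bool" where
  "is_flip p q K \<epsilon> lam K' \<epsilon>' lam' \<longleftrightarrow>
     (p \<ge> 2 \<and> q \<ge> 2 \<and> bistellar_flip p q K lam K' \<or>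
      p = 1 \<and> q = CARD('n) \<and> stellar_flip CARD('n) K K' lam' \<or>
      p = CARD('n) \<and> q = 1 \<and> stellar_flip CARD('n) K' K lam) \<and>
     (\<forall>v\<in>\<Union>K \<inter> \<Union>K'. lam' v = lam v) \<and>
     (\<forall>I\<in>facets CARD('n) K \<inter> facets CARD('n) K'. \<forall>f. ordering f I \<longrightarrow> \<epsilon>' f = \<epsilon> f)"

end

theory Submission
  imports Defs "HOL-Computational_Algebra.Polynomial"
begin

text \<open>
  Evaluating the integral at a generic point writes the volume polynomial as a linear combination
  of \<open>n\<close>-th powers of linear forms, one for each maximal simplex.  For the boundary of the simplex on a set
  \<open>S\<close> of \<open>n + 1\<close> vectors in general position, with linear relation \<open>\<Sum>\<alpha>\<^sub>s \<lambda>(s) = 0\<close>, Lagrange interpolation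
  shows that the sum is a nonzero multiple of \<open>\<ell>\<^sup>n\<close>, \<open>\<ell> = \<Sum>\<alpha>\<^sub>s c\<^sub>s\<close>; coning the cycle \<open>K\<close> over a generic vector
  then shows that the integral of any multi-fan is constant.  A flip changes the cycle by the boundary
  of the simplex on \<open>S = S\<^sub>1 \<union> S\<^sub>2\<close>, hence \<open>V' = V + r \<ell>\<^sup>n\<close> with \<open>r \<noteq> 0\<close>.

  The dimension of \<open>\<A>\<^sup>2\<^sup>k\<close> is that of the space \<open>W\<^sub>k\<close> of derivatives of order \<open>k\<close> of \<open>V\<close>, and
  \<open>W\<^sub>k + \<langle>\<ell>\<^sup>n\<^sup>-\<^sup>k\<rangle> = W\<^sub>k' + \<langle>\<ell>\<^sup>n\<^sup>-\<^sup>k\<rangle>\<close>.  The missing face \<open>S\<^sub>1\<close> of \<open>K\<close> gives operators of every degree \<open>\<ge> p\<close> which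
  annihilate \<open>V\<close> but not \<open>\<ell>\<^sup>n\<close>; so \<open>\<ell>\<^sup>n\<^sup>-\<^sup>k\<close> lies in \<open>W\<^sub>k'\<close> if \<open>k \<ge> p\<close>, and outside \<open>W\<^sub>k\<close> if \<open>n - k \<ge> p\<close>.
  Together with the same statement for \<open>S\<^sub>2\<close> and \<open>K'\<close>, and \<open>p + q = n + 1\<close>, this determines the change
  of the dimension.
\<close>

subsection \<open>Real polynomials\<close>

text \<open>Two obstacles shape the argument. The integral is a sum of rational functions of a point
  \<open>y\<close>, so evaluating it at one generic \<open>y\<close> is legitimate only after
  constancy is known; and the cycle condition concerns ordered simplices, whereas the integral is
  written with w(I) and |det|. Passing to all orderings f of the maximal simplices resolves the
  second: w(I)/|det| becomes \<open>\<epsilon> f\<close> divided by the signed determinant, and the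
  summand becomes a function of an ordered basis. The cone identity behind both uses of coning is
  interpolation at n + 1 nodes, namely 0 and the ratios of the coordinates of the evaluation point
  and of the apex; the genericity conditions express that these nodes are distinct. A differential
  operator sees a power of a linear form only through its value at the coefficient vector, so all
  statements about derivatives become statements about zeros of monomials. Since p + q = n + 1, the
  condition k < p is the same as n - k \<ge> q; hence for every k it is decided whether \<ell>^(n-k)
  lies in each of the two spaces. A flip may create or destroy vertices, so the two volume
  polynomials are compared in the variables of both complexes.\<close>

abbreviation lkp :: "('a \<Rightarrow>\<^sub>0 'b::zero) \<Rightarrow> 'a \<Rightarrow> 'b" where "lkp \<equiv> Poly_Mapping.lookup"
abbreviation sgl :: "'a \<Rightarrow> 'b \<Rightarrow> ('a \<Rightarrow>\<^sub>0 'b::zero)" where "sgl \<equiv> Poly_Mapping.single"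
abbreviation kys :: "('a \<Rightarrow>\<^sub>0 'b::zero) \<Rightarrow> 'a set" where "kys \<equiv> Poly_Mapping.keys"

text \<open>Scalar multiplication, singled out so that \<open>rp\<close> supplies spans,
  independence and dimensions for spaces of polynomials.\<close>

definition pscale :: "real \<Rightarrow> 'v rpoly \<Rightarrow> 'v rpoly" where
  "pscale r P = rconst r * P"

lemma rconst_0 [simp]: "rconst 0 = 0"
  and rconst_1 [simp]: "rconst 1 = 1"
  and rconst_add: "rconst (r + s) = rconst r + rconst s"
  and rconst_mult: "rconst (r * s) = rconst r * rconst s"
  by (simp_all add: rconst_def single_add mult_single)

lemma rconst_uminus: "rconst (- r) = - rconst r"
  by (simp add: rconst_def single_uminus)

interpretation rp: vector_space pscale
  by standard (simp_all add: pscale_def algebra_simps rconst_add rconst_mult)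

lemma pscale_single: "pscale r (sgl m s) = sgl m (r * s)"
  by (simp add: pscale_def rconst_def mult_single)

lemma lookup_pscale: "lkp (pscale r P) m = r * lkp P m"
proof -
  have "pscale r P = Poly_Mapping.map ((*) r) P"
    by (simp add: pscale_def rconst_def mult_map_scale_conv_mult)
  then show ?thesis by (simp add: Poly_Mapping.map.rep_eq when_def)
qed

lemma poly_sum_monomials: "(\<Sum>m\<in>kys P. sgl m (lkp P m)) = P"
  by (rule poly_mapping_eqI) (auto simp: lookup_sum lookup_single when_def in_keys_iff)

lemma rpoly_induct [case_names zero add]:
  assumes "Q 0" and step: "\<And>m r P. Q P \<Longrightarrow> Q (sgl m r + P)"
  shows "Q (P :: 'v rpoly)"
proof -
  have "Q (\<Sum>m\<in>A. sgl m (f m))" if "finite A" for A :: "('v \<Rightarrow>\<^sub>0 nat) set" and f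
    using that by induction (simp_all add: assms)
  from this[of "kys P" "lkp P"] show ?thesis by (simp add: poly_sum_monomials)
qed

lemma sum_over_keys:
  assumes "finite A" "kys P \<subseteq> A" and "\<And>m. h m 0 = 0"
  shows "(\<Sum>m\<in>kys P. h m (lkp P m)) = (\<Sum>m\<in>A. h m (lkp P m))"
  using assms by (intro sum.mono_neutral_left) (auto simp: in_keys_iff)

text \<open>Evaluation, differentiation and the action of operators are all sums over the support.
  Coefficients of P + Q may cancel, so the sums are compared over the union of the two
  supports.\<close>

lemma sum_over_keys_add:
  fixes h :: "'m \<Rightarrow> 'b::comm_monoid_add \<Rightarrow> 'c::comm_monoid_add"
  assumes "\<And>m. h m 0 = 0" "\<And>m r s. h m (r + s) = h m r + h m s"
  shows "(\<Sum>m\<in>kys (P + Q). h m (lkp (P + Q) m)) =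
    (\<Sum>m\<in>kys P. h m (lkp P m)) + (\<Sum>m\<in>kys Q. h m (lkp Q m))"
proof -
  let ?A = "kys P \<union> kys Q"
  have "(\<Sum>m\<in>kys (P + Q). h m (lkp (P + Q) m)) = (\<Sum>m\<in>?A. h m (lkp (P + Q) m))"
    by (rule sum_over_keys) (use assms(1) keys_add[of P Q] in auto)
  also have "\<dots> = (\<Sum>m\<in>?A. h m (lkp P m)) + (\<Sum>m\<in>?A. h m (lkp Q m))"
    by (simp add: lookup_add assms(2) sum.distrib)
  also have "(\<Sum>m\<in>?A. h m (lkp P m)) = (\<Sum>m\<in>kys P. h m (lkp P m))"
    by (rule sum_over_keys[symmetric]) (use assms(1) in auto)
  also have "(\<Sum>m\<in>?A. h m (lkp Q m)) = (\<Sum>m\<in>kys Q. h m (lkp Q m))"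
    by (rule sum_over_keys[symmetric]) (use assms(1) in auto)
  finally show ?thesis .
qed

lemma sum_over_keys_single:
  assumes "\<And>m. h m 0 = 0"
  shows "(\<Sum>k\<in>kys (sgl m r). h k (lkp (sgl m r) k)) = h m r"
  using assms by (cases "r = 0") auto

section \<open>Evaluation of polynomials at a point\<close>

definition mon_eval :: "('v \<Rightarrow> real) \<Rightarrow> ('v \<Rightarrow>\<^sub>0 nat) \<Rightarrow> real" where
  "mon_eval c m = (\<Prod>i\<in>kys m. c i ^ lkp m i)"

lemma mon_eval_superset: "finite A \<Longrightarrow> kys m \<subseteq> A \<Longrightarrow> mon_eval c m = (\<Prod>i\<in>A. c i ^ lkp m i)"
  unfolding mon_eval_def by (intro prod.mono_neutral_left) (auto simp: in_keys_iff)

lemma mon_eval_0 [simp]: "mon_eval c 0 = 1"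
  by (simp add: mon_eval_def)

lemma mon_eval_add: "mon_eval c (m + m') = mon_eval c m * mon_eval c m'"
proof -
  let ?A = "kys m \<union> kys m'"
  have "mon_eval c (m + m') = (\<Prod>i\<in>?A. c i ^ lkp (m + m') i)"
    by (rule mon_eval_superset) (use keys_add[of m m'] in auto)
  also have "\<dots> = mon_eval c m * mon_eval c m'"
    by (simp add: lookup_add power_add prod.distrib mon_eval_superset[of ?A])
  finally show ?thesis .
qed

lemma mon_eval_single: "mon_eval c (sgl i k) = c i ^ k"
  by (cases "k = 0") (auto simp: mon_eval_def)

lemma poly_eval_alt: "poly_eval c P = (\<Sum>m\<in>kys P. lkp P m * mon_eval c m)"
  by (simp add: poly_eval_def mon_eval_def)

lemma poly_eval_add: "poly_eval c (P + Q) = poly_eval c P + poly_eval c Q"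
  unfolding poly_eval_alt by (rule sum_over_keys_add) (auto simp: algebra_simps)

lemma poly_eval_single: "poly_eval c (sgl m r) = r * mon_eval c m"
  unfolding poly_eval_alt by (rule sum_over_keys_single) simp

lemma poly_eval_0 [simp]: "poly_eval c 0 = 0"
  by (simp add: poly_eval_alt)

lemma poly_eval_rconst [simp]: "poly_eval c (rconst r) = r"
  by (simp add: rconst_def poly_eval_single)

lemma poly_eval_1 [simp]: "poly_eval c 1 = 1"
  using poly_eval_rconst[of c 1] by simp

lemma poly_eval_rvar [simp]: "poly_eval c (rvar i) = c i"
  by (simp add: rvar_def poly_eval_single mon_eval_single)

lemma poly_eval_mult: "poly_eval c (P * Q) = poly_eval c P * poly_eval c Q"
proof (induction P rule: rpoly_induct)
  case (add m r P)
  have "poly_eval c (sgl m r * Q) = r * mon_eval c m * poly_eval c Q"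
    by (induction Q rule: rpoly_induct)
      (simp_all add: algebra_simps mult_single poly_eval_add poly_eval_single mon_eval_add)
  then show ?case using add
    by (simp add: algebra_simps poly_eval_add poly_eval_single)
qed simp

lemma poly_eval_power: "poly_eval c (P ^ k) = poly_eval c P ^ k"
  by (induction k) (simp_all add: poly_eval_mult)

lemma poly_eval_sum: "poly_eval c (sum f A) = (\<Sum>x\<in>A. poly_eval c (f x))"
  by (induction A rule: infinite_finite_induct) (simp_all add: poly_eval_add)

lemma poly_eval_prod: "poly_eval c (prod f A) = (\<Prod>x\<in>A. poly_eval c (f x))"
  by (induction A rule: infinite_finite_induct) (simp_all add: poly_eval_mult)

lemma poly_eval_pscale: "poly_eval c (pscale r P) = r * poly_eval c P"
  by (simp add: pscale_def poly_eval_mult)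

lemma poly_eval_uminus: "poly_eval c (- P) = - poly_eval c P"
  using poly_eval_add[of c P "- P"] by simp

lemma poly_eval_diff: "poly_eval c (P - Q) = poly_eval c P - poly_eval c Q"
  using poly_eval_add[of c P "- Q"] by (simp add: poly_eval_uminus)

subsection \<open>Partial derivatives\<close>

lemma partial_add: "partial i (P + Q) = partial i P + partial i Q"
  unfolding partial_def by (rule sum_over_keys_add) (auto simp: algebra_simps single_add)

lemma partial_single: "partial i (sgl m r) = sgl (m - sgl i 1) (real (lkp m i) * r)"
  unfolding partial_def by (rule sum_over_keys_single) simp

lemma partial_0 [simp]: "partial i 0 = 0"
  by (simp add: partial_def)

lemma partial_pscale: "partial i (pscale r P) = pscale r (partial i P)"
  by (induction P rule: rpoly_induct)
    (simp_all add: partial_add partial_single pscale_single rp.scale_right_distrib algebra_simps)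

lemma partial_commute: "partial i (partial j P) = partial j (partial i P)"
proof (induction P rule: rpoly_induct)
  case (add m r P)
  have "m - sgl i 1 - sgl j 1 = m - sgl j 1 - sgl i (1::nat)"
    by (rule poly_mapping_eqI) (simp add: lookup_minus)
  then show ?case using add
    by (cases "i = j")
      (simp_all add: partial_add partial_single lookup_minus lookup_single algebra_simps)
qed simp

lemma partial_rvar_mult: "partial i (rvar j * P) = (if i = j then P else 0) + rvar j * partial i P"
proof (induction P rule: rpoly_induct)
  case (add m r P)
  have "partial i (rvar j * sgl m r) =
      (if i = j then sgl m r else 0) + rvar j * partial i (sgl m r)"
  proof (cases "i = j")
    case True
    have "sgl i 1 + m - sgl i 1 = (m :: 'a \<Rightarrow>\<^sub>0 nat)"
      by (rule poly_mapping_eqI) (simp add: lookup_minus lookup_add)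
    \<comment> \<open>Subtraction of exponents is truncated. If the variable does not occur in m,
      the coefficient \<open>lkp m i\<close> vanishes instead.\<close>
    moreover have "sgl i 1 + (m - sgl i 1) = (m :: 'a \<Rightarrow>\<^sub>0 nat)" if "lkp m i \<noteq> 0"
      using that by (intro poly_mapping_eqI) (auto simp: lookup_minus lookup_add lookup_single when_def)
    ultimately show ?thesis using True
      by (cases "lkp m i = 0")
        (simp_all add: rvar_def mult_single partial_single lookup_add algebra_simps single_add)
  next
    case False
    have "sgl j 1 + m - sgl i 1 = sgl j 1 + (m - sgl i (1 :: nat))"
      using False
      by (intro poly_mapping_eqI) (auto simp: lookup_minus lookup_add lookup_single when_def)
    then show ?thesis using False
      by (simp add: rvar_def mult_single partial_single lookup_add lookup_single)
  qed
  then show ?case using add by (simp add: algebra_simps partial_add)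
qed simp

lemma partial_sum: "partial i (sum f A) = (\<Sum>x\<in>A. partial i (f x))"
  by (induction A rule: infinite_finite_induct) (simp_all add: partial_add)

text \<open>Below, \<open>a\<close> is required to vanish off Y. It is then the full coefficient
  vector of the form and can also serve as the point at which operators are evaluated.\<close>

definition lform :: "'v set \<Rightarrow> ('v \<Rightarrow> real) \<Rightarrow> 'v rpoly" where
  "lform Y a = (\<Sum>i\<in>Y. rconst (a i) * rvar i)"

lemma partial_lform_mult:
  assumes "finite Y" "\<forall>i. i \<notin> Y \<longrightarrow> a i = 0"
  shows "partial i (lform Y a * P) = pscale (a i) P + lform Y a * partial i P"
proof -
  have "partial i (lform Y a * P) = (\<Sum>j\<in>Y. partial i (pscale (a j) (rvar j * P)))"
    by (simp add: lform_def sum_distrib_right partial_sum pscale_def mult.assoc)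
  also have "\<dots> = (\<Sum>j\<in>Y. pscale (a j) (if i = j then P else 0)) +
      (\<Sum>j\<in>Y. pscale (a j) (rvar j * partial i P))"
    by (simp add: partial_pscale partial_rvar_mult rp.scale_right_distrib sum.distrib)
  also have "(\<Sum>j\<in>Y. pscale (a j) (if i = j then P else 0)) = pscale (a i) P"
    using assms by (simp add: if_distrib[of "pscale _"] cong: if_cong)
  also have "(\<Sum>j\<in>Y. pscale (a j) (rvar j * partial i P)) = lform Y a * partial i P"
    by (simp add: lform_def sum_distrib_right pscale_def mult.assoc)
  finally show ?thesis .
qed

lemma partial_lform_power:
  assumes "finite Y" "\<forall>i. i \<notin> Y \<longrightarrow> a i = 0"
  shows "partial i (lform Y a ^ t) = pscale (real t * a i) (lform Y a ^ (t - 1))"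
proof (induction t)
  case 0
  have "partial i (rconst 1) = 0" unfolding rconst_def by (simp only: partial_single) simp
  then show ?case by simp
next
  case (Suc t)
  show ?case
  proof (cases t)
    case 0
    then show ?thesis using Suc partial_lform_mult[OF assms, of i 1] by simp
  next
    case (Suc s)
    have "partial i (lform Y a ^ Suc t) =
        pscale (a i) (lform Y a ^ t) + lform Y a * pscale (real t * a i) (lform Y a ^ s)"
      using partial_lform_mult[OF assms, of i "lform Y a ^ t"] Suc.IH Suc by simp
    also have "lform Y a * pscale (real t * a i) (lform Y a ^ s) =
        pscale (real t * a i) (lform Y a ^ t)"
      using Suc by (simp add: pscale_def algebra_simps)
    finally show ?thesis
      by (simp add: algebra_simps flip: rp.scale_left_distrib)
  qed
qed

text \<open>The falling factorial t(t-1)...(t-k+1). The truncated difference makes it 0 for k > t,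
  as befits a derivative of order exceeding the degree.\<close>

definition ffall :: "nat \<Rightarrow> nat \<Rightarrow> real" where
  "ffall t k = (\<Prod>j<k. real (t - j))"

lemma ffall_0 [simp]: "ffall t 0 = 1" by (simp add: ffall_def)

lemma ffall_Suc: "ffall t (Suc k) = ffall t k * real (t - k)"
  by (simp add: ffall_def)

lemma ffall_pos: "k \<le> t \<Longrightarrow> ffall t k > 0"
  unfolding ffall_def by (rule prod_pos) auto

text \<open>The prefactor \<open>ffall t k\<close> is already present in the argument, so that the
  formula can be iterated over the variables of a monomial.\<close>

lemma partial_funpow_lform_power:
  assumes "finite Y" "\<forall>i. i \<notin> Y \<longrightarrow> a i = 0"
  shows "(partial i ^^ r) (pscale (s * ffall t k) (lform Y a ^ (t - k))) =
    pscale (s * a i ^ r * ffall t (k + r)) (lform Y a ^ (t - (k + r)))"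
proof (induction r)
  case (Suc r)
  have "(partial i ^^ Suc r) (pscale (s * ffall t k) (lform Y a ^ (t - k))) =
      partial i (pscale (s * a i ^ r * ffall t (k + r)) (lform Y a ^ (t - (k + r))))"
    using Suc by simp
  also have "\<dots> = pscale (s * a i ^ Suc r * ffall t (k + Suc r)) (lform Y a ^ (t - (k + Suc r)))"
    using assms by (simp add: partial_pscale partial_lform_power ffall_Suc algebra_simps)
  finally show ?case .
qed simp

section \<open>Commuting derivatives and the operators given by monomials\<close>

lemma partial_funpow_commute: "(partial i ^^ r) ((partial j ^^ s) P) = (partial j ^^ s) ((partial i ^^ r) P)"
proof -
  have "partial i ((partial j ^^ s) P) = (partial j ^^ s) (partial i P)" for P
    by (induction s) (simp_all add: partial_commute[of i j])
  then show ?thesis by (induction r) simp_all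
qed

lemma comp_fun_commute_partial: "comp_fun_commute (\<lambda>i. partial i ^^ f i)"
  by standard (simp add: fun_eq_iff partial_funpow_commute)

lemma partial_monomial_superset:
  assumes "finite A" "kys m \<subseteq> A"
  shows "partial_monomial m P = Finite_Set.fold (\<lambda>i. partial i ^^ lkp m i) P A"
proof -
  interpret comp_fun_commute "\<lambda>i. partial i ^^ lkp m i" by (rule comp_fun_commute_partial)
  have fin: "finite (A - kys m)" using assms by auto
  have "Finite_Set.fold (\<lambda>i. partial i ^^ lkp m i) P (kys m \<union> B) =
      Finite_Set.fold (\<lambda>i. partial i ^^ lkp m i) P (kys m)"
    if "finite B" "B \<inter> kys m = {}" for B
    using that by induction (auto simp: in_keys_iff)
  from this[OF fin] show ?thesis using assms(2)
    by (simp add: partial_monomial_def Un_absorb1 Int_commute)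
qed

lemma partial_monomial_0 [simp]: "partial_monomial 0 P = P"
  by (simp add: partial_monomial_def)

text \<open>Both folds are extended to the union of the two supports, where the derivatives can be
  rearranged variable by variable. This is what makes \<open>diff_op\<close> an action of the
  polynomial ring.\<close>

lemma partial_monomial_add_exponents:
  "partial_monomial (m + m') P = partial_monomial m (partial_monomial m' P)"
proof -
  let ?A = "kys m \<union> kys m'"
  interpret m: comp_fun_commute "\<lambda>i. partial i ^^ lkp m i" by (rule comp_fun_commute_partial)
  interpret m': comp_fun_commute "\<lambda>i. partial i ^^ lkp m' i" by (rule comp_fun_commute_partial)
  interpret mm: comp_fun_commute "\<lambda>i. partial i ^^ (lkp m i + lkp m' i)"
    by (rule comp_fun_commute_partial)
  have comm: "(partial i ^^ r) (Finite_Set.fold (\<lambda>i. partial i ^^ lkp m i) Q A) =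
      Finite_Set.fold (\<lambda>i. partial i ^^ lkp m i) ((partial i ^^ r) Q) A" if "finite A" for A i r Q
    using that
  proof induction
    case (insert x A)
    then show ?case by (simp add: partial_funpow_commute[where i = i])
  qed simp
  have "Finite_Set.fold (\<lambda>i. partial i ^^ (lkp m i + lkp m' i)) P A =
      Finite_Set.fold (\<lambda>i. partial i ^^ lkp m i)
        (Finite_Set.fold (\<lambda>i. partial i ^^ lkp m' i) P A) A" if "finite A" for A
    using that
  proof induction
    case (insert x A)
    have "Finite_Set.fold (\<lambda>i. partial i ^^ (lkp m i + lkp m' i)) P (insert x A) =
        (partial x ^^ lkp m x) ((partial x ^^ lkp m' x)
          (Finite_Set.fold (\<lambda>i. partial i ^^ (lkp m i + lkp m' i)) P A))"
      using insert by (subst mm.fold_insert) (auto simp: funpow_add)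
    also have "\<dots> = (partial x ^^ lkp m x) (Finite_Set.fold (\<lambda>i. partial i ^^ lkp m i)
        ((partial x ^^ lkp m' x) (Finite_Set.fold (\<lambda>i. partial i ^^ lkp m' i) P A)) A)"
      using insert by (simp add: comm)
    also have "\<dots> = Finite_Set.fold (\<lambda>i. partial i ^^ lkp m i)
        (Finite_Set.fold (\<lambda>i. partial i ^^ lkp m' i) P (insert x A)) (insert x A)"
      using insert by simp
    finally show ?case .
  qed simp
  from this[of ?A] show ?thesis
    using keys_add[of m m'] by (simp add: partial_monomial_superset[of ?A] lookup_add)
qed

lemma partial_monomial_linear:
  "partial_monomial m (P + Q) = partial_monomial m P + partial_monomial m Q"
  "partial_monomial m (pscale r P) = pscale r (partial_monomial m P)"
proof -
  interpret m: comp_fun_commute "\<lambda>i. partial i ^^ lkp m i" by (rule comp_fun_commute_partial)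
  have 1: "(partial i ^^ s) (P + Q) = (partial i ^^ s) P + (partial i ^^ s) Q" for i :: 'a and s P Q
    by (induction s) (simp_all add: partial_add)
  have 2: "(partial i ^^ s) (pscale r P) = pscale r ((partial i ^^ s) P)" for i :: 'a and s P
    by (induction s) (simp_all add: partial_pscale)
  let ?F = "\<lambda>P A. Finite_Set.fold (\<lambda>i. partial i ^^ lkp m i) P A"
  have "?F (P + Q) A = ?F P A + ?F Q A" "?F (pscale r P) A = pscale r (?F P A)" if "finite A" for A
    using that by (induction A, simp_all add: 1 2)
  then show "partial_monomial m (P + Q) = partial_monomial m P + partial_monomial m Q"
    "partial_monomial m (pscale r P) = pscale r (partial_monomial m P)"
    by (simp_all add: partial_monomial_def)
qed

text \<open>The degree with every variable of degree 1, that is, half of the grading used for the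
  algebra.\<close>

definition mdeg :: "('v \<Rightarrow>\<^sub>0 nat) \<Rightarrow> nat" where
  "mdeg m = (\<Sum>i\<in>kys m. lkp m i)"

lemma partial_monomial_lform_power:
  assumes "finite Y" "\<forall>i. i \<notin> Y \<longrightarrow> a i = 0"
  shows "partial_monomial m (lform Y a ^ t) =
    pscale (mon_eval a m * ffall t (mdeg m)) (lform Y a ^ (t - mdeg m))"
proof -
  interpret m: comp_fun_commute "\<lambda>i. partial i ^^ lkp m i" by (rule comp_fun_commute_partial)
  have "Finite_Set.fold (\<lambda>i. partial i ^^ lkp m i) (lform Y a ^ t) A =
      pscale ((\<Prod>i\<in>A. a i ^ lkp m i) * ffall t (\<Sum>i\<in>A. lkp m i)) (lform Y a ^ (t - (\<Sum>i\<in>A. lkp m i)))"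
    if "finite A" for A
    using that
  proof induction
    case (insert x A)
    then show ?case using partial_funpow_lform_power[OF assms, where i = x and r = "lkp m x" and t = t and s = "\<Prod>i\<in>A. a i ^ lkp m i" and k = "\<Sum>i\<in>A. lkp m i"]
      by (simp add: algebra_simps)
  qed simp
  then show ?thesis by (simp add: partial_monomial_def mon_eval_def mdeg_def)
qed

section \<open>The action of polynomials as differential operators\<close>

lemma diff_op_alt: "diff_op D P = (\<Sum>m\<in>kys D. pscale (lkp D m) (partial_monomial m P))"
  by (simp add: diff_op_def pscale_def)

lemma diff_op_add_left: "diff_op (D + E) P = diff_op D P + diff_op E P"
  unfolding diff_op_alt by (rule sum_over_keys_add) (auto simp: rp.scale_left_distrib)

lemma diff_op_single: "diff_op (sgl m r) P = pscale r (partial_monomial m P)"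
  unfolding diff_op_alt by (rule sum_over_keys_single) auto

lemma diff_op_0_left [simp]: "diff_op 0 P = 0"
  by (simp add: diff_op_def)

lemma diff_op_add_right: "diff_op D (P + Q) = diff_op D P + diff_op D Q"
  by (simp add: diff_op_alt partial_monomial_linear rp.scale_right_distrib sum.distrib)

lemma diff_op_pscale_right: "diff_op D (pscale r P) = pscale r (diff_op D P)"
  by (simp add: diff_op_alt partial_monomial_linear rp.scale_sum_right mult.commute)

lemma diff_op_pscale_left: "diff_op (pscale r D) P = pscale r (diff_op D P)"
  by (induction D rule: rpoly_induct)
    (simp_all add: rp.scale_right_distrib pscale_single diff_op_add_left diff_op_single)

lemma diff_op_uminus_left: "diff_op (- D) P = - diff_op D P"
  using diff_op_add_left[of D "- D" P] by (simp add: add_eq_0_iff)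

lemma diff_op_diff_left: "diff_op (D - E) P = diff_op D P - diff_op E P"
  using diff_op_add_left[of D "- E" P] by (simp add: diff_op_uminus_left)

lemma diff_op_0_right [simp]: "diff_op D 0 = 0"
  using diff_op_pscale_right[of D 0 0] by simp

lemma diff_op_sum_right: "diff_op D (sum f A) = (\<Sum>x\<in>A. diff_op D (f x))"
  by (induction A rule: infinite_finite_induct) (simp_all add: diff_op_add_right)

lemma diff_op_rconst: "diff_op (rconst r) P = pscale r P"
  by (simp add: rconst_def diff_op_single)

lemma diff_op_mult: "diff_op (D * E) P = diff_op D (diff_op E P)"
proof (induction D rule: rpoly_induct)
  case (add m r D)
  have "diff_op (sgl m r * E) P = diff_op (sgl m r) (diff_op E P)"
    by (induction E rule: rpoly_induct)
      (simp_all add: distrib_left mult_single diff_op_add_left diff_op_single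
        partial_monomial_linear partial_monomial_add_exponents rp.scale_right_distrib
        diff_op_add_right)
  then show ?case using add by (simp add: distrib_right diff_op_add_left)
qed simp

lemma homogeneous_iff: "homogeneous (2 * k) D \<longleftrightarrow> (\<forall>m\<in>kys D. mdeg m = k)"
  by (simp add: homogeneous_def mdeg_def flip: sum_distrib_left)

text \<open>Each monomial of D contributes its value at \<open>a\<close>, and homogeneity makes all
  of them lower the exponent by the same k. All later computations with derivatives of V use only
  the values of D at the coefficient vectors of its linear forms.\<close>

lemma diff_op_lform_power:
  assumes "finite Y" "\<forall>i. i \<notin> Y \<longrightarrow> a i = 0" "homogeneous (2 * k) D"
  shows "diff_op D (lform Y a ^ t) = pscale (ffall t k * poly_eval a D) (lform Y a ^ (t - k))"
proof -
  have "diff_op D (lform Y a ^ t) =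
      (\<Sum>m\<in>kys D. pscale (lkp D m) (pscale (mon_eval a m * ffall t k) (lform Y a ^ (t - k))))"
    unfolding diff_op_alt using assms(3)
    by (intro sum.cong refl)
      (simp add: partial_monomial_lform_power[OF assms(1,2)] homogeneous_iff)
  also have "\<dots> = pscale (\<Sum>m\<in>kys D. lkp D m * (mon_eval a m * ffall t k)) (lform Y a ^ (t - k))"
    by (simp add: rp.scale_sum_left)
  finally show ?thesis by (simp add: poly_eval_alt sum_distrib_left algebra_simps)
qed

subsection \<open>A polynomial is determined by its values\<close>

text \<open>Connects the formal derivative with the analytic one, so that a polynomial vanishing as
  a function has formal derivatives that vanish as functions.\<close>

lemma poly_eval_deriv:
  "((\<lambda>t. poly_eval (c(i := t)) P) has_real_derivative poly_eval (c(i := t)) (partial i P)) (at t)"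
proof (induction P rule: rpoly_induct)
  case (add m r P)
  have "((\<lambda>t. poly_eval (c(i := t)) (sgl m r)) has_real_derivative
      poly_eval (c(i := t)) (partial i (sgl m r))) (at t)"
  proof -
    let ?A = "kys m - {i}" and ?k = "lkp m i"
    have M: "mon_eval (c(i := t)) m' = t ^ lkp m' i * (\<Prod>j\<in>?A. c j ^ lkp m j)"
      if "\<And>j. j \<noteq> i \<Longrightarrow> lkp m' j = lkp m j" for m' t
    proof -
      have "kys m' \<subseteq> insert i ?A"
      proof
        fix j assume "j \<in> kys m'"
        then show "j \<in> insert i ?A" using that[of j] by (cases "j = i") (auto simp: in_keys_iff)
      qed
      then have "mon_eval (c(i := t)) m' = (\<Prod>j\<in>insert i ?A. (c(i := t)) j ^ lkp m' j)"
        by (intro mon_eval_superset) auto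
      also have "\<dots> = t ^ lkp m' i * (\<Prod>j\<in>?A. (c(i := t)) j ^ lkp m' j)"
        by (subst prod.insert) auto
      also have "(\<Prod>j\<in>?A. (c(i := t)) j ^ lkp m' j) = (\<Prod>j\<in>?A. c j ^ lkp m j)"
        using that by (intro prod.cong) auto
      finally show ?thesis .
    qed
    have e1: "poly_eval (c(i := t)) (sgl m r) = r * (t ^ ?k * (\<Prod>j\<in>?A. c j ^ lkp m j))" for t
      by (simp add: poly_eval_single M)
    have e2: "poly_eval (c(i := t)) (partial i (sgl m r)) =
        real ?k * r * (t ^ (?k - 1) * (\<Prod>j\<in>?A. c j ^ lkp m j))"
    proof -
      have "mon_eval (c(i := t)) (m - sgl i 1) =
          t ^ lkp (m - sgl i 1) i * (\<Prod>j\<in>?A. c j ^ lkp m j)"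
        by (rule M) (simp add: lookup_minus lookup_single)
      then show ?thesis
        by (simp add: partial_single poly_eval_single lookup_minus)
    qed
    show ?thesis unfolding e1 e2 by (auto intro!: derivative_eq_intros)
  qed
  from DERIV_add[OF this add] show ?case by (simp add: poly_eval_add partial_add del: fun_upd_apply)
qed simp

lemma lookup_partial: "lkp (partial i P) m = real (lkp m i + 1) * lkp P (m + sgl i 1)"
proof (induction P rule: rpoly_induct)
  case (add m' r P)
  have "m' - sgl i 1 = m \<longleftrightarrow> m' = m + sgl i 1" if "lkp m' i \<noteq> 0"
  proof
    assume e: "m' - sgl i 1 = m"
    show "m' = m + sgl i 1"
      unfolding e[symmetric] using that
      by (intro poly_mapping_eqI) (auto simp: lookup_add lookup_minus lookup_single when_def)
  next
    assume "m' = m + sgl i 1"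
    then show "m' - sgl i 1 = m"
      by (simp add: poly_mapping_eqI lookup_add lookup_minus)
  qed
  moreover have "m' \<noteq> m + sgl i 1" if "lkp m' i = 0" using that by (auto simp: lookup_add)
  ultimately show ?case using add
    by (cases "lkp m' i = 0")
      (auto simp: partial_add partial_single lookup_add lookup_single when_def algebra_simps)
qed simp

text \<open>A coefficient of positive degree is, up to a positive factor, a coefficient of lower
  degree of a partial derivative; the constant coefficient is the value at 0. The volume polynomial
  is specified by its values, so its description is unique by this fact.\<close>

lemma poly_eval_eq_0_imp:
  assumes "\<And>c. poly_eval c P = 0"
  shows "P = 0"
proof (rule poly_mapping_eqI)
  have "lkp P m = 0" if "\<And>c. poly_eval c P = 0" for P :: "'a rpoly" and m
    using that
  proof (induction "mdeg m" arbitrary: P m)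
    case 0
    then have "m = 0" by (auto simp: mdeg_def in_keys_iff intro!: poly_mapping_eqI)
    have "poly_eval (\<lambda>_. 0) P = (\<Sum>k\<in>kys P. if k = 0 then lkp P 0 else 0)"
      unfolding poly_eval_alt
    proof (rule sum.cong)
      fix k :: "'a \<Rightarrow>\<^sub>0 nat"
      have "\<exists>i. i \<in> kys k" if "k \<noteq> 0"
        using that by (metis all_not_in_conv keys_eq_empty)
      then have "mon_eval (\<lambda>_. 0) k = 0" if "k \<noteq> 0"
        using that by (auto simp: mon_eval_def in_keys_iff)
      then show "lkp P k * mon_eval (\<lambda>_. 0) k = (if k = 0 then lkp P 0 else 0)" by auto
    qed simp
    then have "lkp P 0 = 0" using 0(2) by (auto simp: in_keys_iff split: if_splits)
    then show ?case by (simp add: \<open>m = 0\<close>)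
  next
    case (Suc k)
    then obtain i where i: "lkp m i > 0" "i \<in> kys m"
      by (metis bot_nat_0.not_eq_extremum mdeg_def nat.distinct(1) sum.neutral in_keys_iff)
    let ?m = "m - sgl i 1"
    have m: "?m + sgl i 1 = m"
      using i by (intro poly_mapping_eqI) (auto simp: lookup_add lookup_minus lookup_single when_def)
    have "mdeg m = (\<Sum>j\<in>kys m. lkp ?m j + (if j = i then 1 else 0))"
      unfolding mdeg_def
    proof (rule sum.cong)
      fix j
      have "lkp m j = lkp (?m + sgl i 1) j" by (simp only: m)
      then show "lkp m j = lkp ?m j + (if j = i then 1 else 0)"
        by (simp add: lookup_add lookup_single when_def eq_commute)
    qed simp
    also have "\<dots> = mdeg ?m + 1"
    proof -
      have "kys ?m \<subseteq> kys m" by (auto simp: in_keys_iff lookup_minus)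
      then have "mdeg ?m = (\<Sum>j\<in>kys m. lkp ?m j)"
        unfolding mdeg_def by (intro sum.mono_neutral_left) (auto simp: in_keys_iff)
      then show ?thesis using i by (simp add: sum.distrib)
    qed
    finally have "k = mdeg ?m" using Suc by simp
    moreover have "poly_eval c (partial i P) = 0" for c
      using poly_eval_deriv[of c i P "c i"] DERIV_const[of 0] Suc(3)
      by (simp add: DERIV_unique)
    ultimately have "lkp (partial i P) ?m = 0" using Suc(1) by blast
    then show ?case unfolding lookup_partial m by auto
  qed
  then show "lkp P m = lkp 0 m" for m using assms by simp
qed

lemma poly_eval_eq_imp:
  assumes "\<And>c. poly_eval c P = poly_eval c Q"
  shows "P = Q"
  using poly_eval_eq_0_imp[of "P - Q"] assms by (simp add: poly_eval_diff)

subsection \<open>The graded dimensions as dimensions of spaces of derivatives\<close>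

lemma rpolys_alt: "P \<in> rpolys X \<longleftrightarrow> (\<forall>m\<in>kys P. kys m \<subseteq> X)"
  by (simp add: rpolys_def)

lemma rpolys_0 [simp]: "0 \<in> rpolys X"
  and rpolys_rconst [simp]: "rconst r \<in> rpolys X"
  and rpolys_rvar: "i \<in> X \<Longrightarrow> rvar i \<in> rpolys X"
  by (auto simp: rpolys_alt rconst_def rvar_def split: if_splits)

lemma rpolys_1 [simp]: "1 \<in> rpolys X"
  using rpolys_rconst[of 1] by simp

lemma rpolys_add: "P \<in> rpolys X \<Longrightarrow> Q \<in> rpolys X \<Longrightarrow> P + Q \<in> rpolys X"
  unfolding rpolys_alt using keys_add[of P Q] by blast

lemma rpolys_mult: "P \<in> rpolys X \<Longrightarrow> Q \<in> rpolys X \<Longrightarrow> P * Q \<in> rpolys X"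
  unfolding rpolys_alt
proof
  fix m assume *: "\<forall>m\<in>kys P. kys m \<subseteq> X" "\<forall>m\<in>kys Q. kys m \<subseteq> X" and "m \<in> kys (P * Q)"
  then obtain a b where "m = a + b" "a \<in> kys P" "b \<in> kys Q"
    using keys_mult[of P Q] by blast
  then show "kys m \<subseteq> X" using * keys_add[of a b] by blast
qed

lemma rpolys_pscale: "P \<in> rpolys X \<Longrightarrow> pscale r P \<in> rpolys X"
  by (simp add: pscale_def rpolys_mult)

lemma rpolys_uminus: "P \<in> rpolys X \<Longrightarrow> - P \<in> rpolys X"
  using rpolys_pscale[of P X "- 1"] by (simp add: pscale_def rconst_uminus)

lemma rpolys_diff: "P \<in> rpolys X \<Longrightarrow> Q \<in> rpolys X \<Longrightarrow> P - Q \<in> rpolys X"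
  using rpolys_add[of P X "- Q"] by (simp add: rpolys_uminus)

lemma rpolys_sum: "(\<And>x. x \<in> A \<Longrightarrow> f x \<in> rpolys X) \<Longrightarrow> sum f A \<in> rpolys X"
  by (induction A rule: infinite_finite_induct) (simp_all add: rpolys_add)

lemma rpolys_prod: "(\<And>x. x \<in> A \<Longrightarrow> f x \<in> rpolys X) \<Longrightarrow> prod f A \<in> rpolys X"
  by (induction A rule: infinite_finite_induct) (simp_all add: rpolys_mult)

lemma rpolys_power: "P \<in> rpolys X \<Longrightarrow> P ^ k \<in> rpolys X"
  by (induction k) (simp_all add: rpolys_mult)

lemma rpolys_lform: "Y \<subseteq> X \<Longrightarrow> lform Y a \<in> rpolys X"
  unfolding lform_def by (intro rpolys_sum rpolys_mult rpolys_rvar) auto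

section \<open>The polynomial ring and its quotient by the annihilator\<close>

lemma rpoly_ring_simps [simp]:
  "carrier (rpoly_ring X) = rpolys X"
  "mult (rpoly_ring X) = (*)" "one (rpoly_ring X) = 1"
  "zero (rpoly_ring X) = 0" "add (rpoly_ring X) = (+)"
  by (simp_all add: rpoly_ring_def)

lemma cring_rpoly_ring: "cring (rpoly_ring X)"
proof (rule cringI)
  show "abelian_group (rpoly_ring X)"
  proof (rule abelian_groupI)
    fix x assume "x \<in> carrier (rpoly_ring X)"
    then show "\<exists>y\<in>carrier (rpoly_ring X). y \<oplus>\<^bsub>rpoly_ring X\<^esub> x = \<zero>\<^bsub>rpoly_ring X\<^esub>"
      by (intro bexI[of _ "- x"]) (auto simp: rpolys_uminus)
  qed (auto simp: rpolys_add algebra_simps)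
  show "Group.comm_monoid (rpoly_ring X)"
    by (rule Group.comm_monoidI) (auto simp: rpolys_mult algebra_simps)
qed (auto simp: algebra_simps)

lemma rpoly_ring_a_inv:
  assumes "P \<in> rpolys X"
  shows "\<ominus>\<^bsub>rpoly_ring X\<^esub> P = - P"
proof -
  interpret cring "rpoly_ring X" by (rule cring_rpoly_ring)
  show ?thesis using minus_equality[of "- P" P] assms by (simp add: rpolys_uminus)
qed

lemma rpoly_ring_a_minus:
  "P \<in> rpolys X \<Longrightarrow> Q \<in> rpolys X \<Longrightarrow> P \<ominus>\<^bsub>rpoly_ring X\<^esub> Q = P - Q"
  by (simp add: a_minus_def rpoly_ring_a_inv)

lemma ideal_annihilator: "ideal (annihilator X P) (rpoly_ring X)"
proof (rule idealI)
  interpret cring "rpoly_ring X" by (rule cring_rpoly_ring)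
  show "ring (rpoly_ring X)" by (rule ring_axioms)
  show "subgroup (annihilator X P) (add_monoid (rpoly_ring X))"
  proof (rule group.subgroupI)
    show "group (add_monoid (rpoly_ring X))" by (rule a_group)
    have "0 \<in> annihilator X P" by (simp add: annihilator_def)
    then show "annihilator X P \<noteq> {}" by blast
    fix a assume a: "a \<in> annihilator X P"
    have "inv\<^bsub>add_monoid (rpoly_ring X)\<^esub> a = - a"
      using a rpoly_ring_a_inv[of a X] by (simp add: a_inv_def annihilator_def)
    then show "inv\<^bsub>add_monoid (rpoly_ring X)\<^esub> a \<in> annihilator X P"
      using a by (simp add: annihilator_def rpolys_uminus diff_op_uminus_left)
  qed (auto simp: annihilator_def rpolys_add diff_op_add_left)
  fix D E assume *: "D \<in> annihilator X P" "E \<in> carrier (rpoly_ring X)"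
  then have "diff_op (E * D) P = 0" "E * D \<in> rpolys X"
    by (simp_all add: annihilator_def diff_op_mult rpolys_mult)
  then show "E \<otimes>\<^bsub>rpoly_ring X\<^esub> D \<in> annihilator X P" "D \<otimes>\<^bsub>rpoly_ring X\<^esub> E \<in> annihilator X P"
    by (simp_all add: annihilator_def mult.commute)
qed

lemma residue_class_hom: "ring_hom_ring (rpoly_ring X) (dual_algebra X P) (residue_class X P)"
  using ideal.rcos_ring_hom_ring[OF ideal_annihilator[of X P]]
  by (simp add: dual_algebra_def residue_class_def[abs_def])

lemma residue_class_eq_iff:
  assumes "D \<in> rpolys X" "E \<in> rpolys X"
  shows "residue_class X P D = residue_class X P E \<longleftrightarrow> diff_op D P = diff_op E P"
proof -
  interpret cring "rpoly_ring X" by (rule cring_rpoly_ring)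
  have "D - E \<in> annihilator X P \<longleftrightarrow> residue_class X P D = residue_class X P E"
    using quotient_eq_iff_same_a_r_cos[OF ideal_annihilator, of D E P] assms
    by (simp add: residue_class_def rpoly_ring_a_minus)
  then show ?thesis using assms by (auto simp: annihilator_def rpolys_diff diff_op_diff_left)
qed

text \<open>The dimension in the quotient is taken over the image of the constants; that image is a
  subfield because the constants are one here and the quotient is nonzero.\<close>

lemma subfield_constants: "subfield (range rconst) (rpoly_ring X)"
proof -
  interpret R: cring "rpoly_ring X" by (rule cring_rpoly_ring)
  let ?K = "range rconst :: 'a rpoly set"
  have inj: "rconst r = rconst s \<longleftrightarrow> r = s" for r s :: real
    by (metis poly_eval_rconst)
  have "subring ?K (rpoly_ring X)"
  proof (rule R.subringI)
    fix h assume "h \<in> ?K"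
    then obtain r where h: "h = rconst r" by blast
    then have "\<ominus>\<^bsub>rpoly_ring X\<^esub> h = rconst (- r)"
      by (simp add: rpoly_ring_a_inv rconst_uminus)
    then show "\<ominus>\<^bsub>rpoly_ring X\<^esub> h \<in> ?K" by blast
  next
    have "\<one>\<^bsub>rpoly_ring X\<^esub> = rconst 1" by simp
    then show "\<one>\<^bsub>rpoly_ring X\<^esub> \<in> ?K" by blast
  next
    fix h1 h2 assume "h1 \<in> ?K" "h2 \<in> ?K"
    then obtain r s where "h1 = rconst r" "h2 = rconst s" by blast
    then have "h1 \<otimes>\<^bsub>rpoly_ring X\<^esub> h2 = rconst (r * s)" "h1 \<oplus>\<^bsub>rpoly_ring X\<^esub> h2 = rconst (r + s)"
      by (simp_all add: rconst_mult rconst_add)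
    then show "h1 \<otimes>\<^bsub>rpoly_ring X\<^esub> h2 \<in> ?K" "h1 \<oplus>\<^bsub>rpoly_ring X\<^esub> h2 \<in> ?K" by blast+
  qed auto
  then have "subcring ?K (rpoly_ring X)"
    by (rule R.subcringI') 
  then show ?thesis
  proof (rule R.subfieldI)
    have "x \<in> Units (rpoly_ring X \<lparr>carrier := ?K\<rparr>) \<longleftrightarrow> x \<in> ?K - {0}" for x
    proof
      assume "x \<in> Units (rpoly_ring X \<lparr>carrier := ?K\<rparr>)"
      then obtain y where "x \<in> ?K" "y * x = 1" by (auto simp: Units_def)
      then show "x \<in> ?K - {0}" by auto
    next
      assume "x \<in> ?K - {0}"
      then obtain r where r: "x = rconst r" "r \<noteq> 0" using rconst_0 by blast
      then have "rconst (1 / r) * x = 1" by (simp flip: rconst_mult)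
      then show "x \<in> Units (rpoly_ring X \<lparr>carrier := ?K\<rparr>)"
        using r by (auto simp: Units_def mult.commute intro!: bexI[of _ "rconst (1 / r)"])
    qed
    then show "Units (rpoly_ring X \<lparr>carrier := ?K\<rparr>) = ?K - {\<zero>\<^bsub>rpoly_ring X\<^esub>}" by auto
  qed
qed

text \<open>For d = 2k this is the space \<open>W\<^sub>k\<close> of the overview: the image of the
  operators of degree d under a map whose kernel is their part of the annihilator.\<close>

definition derivs :: "'v set \<Rightarrow> nat \<Rightarrow> 'v rpoly \<Rightarrow> 'v rpoly set" where
  "derivs X d P = (\<lambda>D. diff_op D P) ` {D \<in> rpolys X. homogeneous d D}"

lemma subspace_homogeneous: "rp.subspace {D \<in> rpolys X. homogeneous d D}"
proof (rule rp.subspaceI)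
  show "0 \<in> {D \<in> rpolys X. homogeneous d D}" by (simp add: homogeneous_def)
  fix D E assume "D \<in> {D \<in> rpolys X. homogeneous d D}" "E \<in> {D \<in> rpolys X. homogeneous d D}"
  then show "D + E \<in> {D \<in> rpolys X. homogeneous d D}"
    using keys_add[of D E] by (auto simp: rpolys_add homogeneous_def)
next
  fix r D assume *: "D \<in> {D \<in> rpolys X. homogeneous d D}"
  have "kys (pscale r D) \<subseteq> kys D" by (auto simp: in_keys_iff lookup_pscale)
  with * show "pscale r D \<in> {D \<in> rpolys X. homogeneous d D}"
    by (auto simp: rpolys_pscale homogeneous_def)
qed

lemma module_hom_diff_op: "module_hom pscale pscale (\<lambda>D. diff_op D P)"
  by standard (simp_all add: diff_op_add_left diff_op_pscale_left)

lemma subspace_derivs: "rp.subspace (derivs X d P)"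
  unfolding derivs_def
  by (rule module_hom.subspace_image[OF module_hom_diff_op subspace_homogeneous])

text \<open>Two operators have the same residue class iff they act equally on P, so the graded part
  and the space of derivatives are isomorphic. The two dimensions belong to different formalisms,
  one based on lists over a subfield and one on sets of vectors; a basis of the space of derivatives
  is therefore lifted to operators, whose residue classes form a basis of the graded part.\<close>

lemma graded_dim_eq_dim_derivs:
  assumes "P \<noteq> 0" and fin: "derivs X d P \<subseteq> rp.span S" "finite S"
  shows "graded_dim X P d = rp.dim (derivs X d P)"
proof -
  let ?H = "{D \<in> rpolys X. homogeneous d D}" and ?\<phi> = "\<lambda>D. diff_op D P"
  let ?q = "residue_class X P" and ?Q = "dual_algebra X P"
  let ?K = "?q ` range rconst"
  interpret R: cring "rpoly_ring X" by (rule cring_rpoly_ring)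
  interpret Q: ring ?Q using residue_class_hom by (rule ring_hom_ring.axioms(2))
  interpret h: ring_hom_ring "rpoly_ring X" ?Q ?q by (rule residue_class_hom)
  have q1: "?q 1 = \<one>\<^bsub>?Q\<^esub>" and q0: "?q 0 = \<zero>\<^bsub>?Q\<^esub>"
    using h.hom_one h.hom_zero by simp_all
  \<comment> \<open>The operator 1 does not annihilate P, so the quotient is nonzero and the
    constants map onto a subfield.\<close>
  have "\<one>\<^bsub>?Q\<^esub> \<noteq> \<zero>\<^bsub>?Q\<^esub>"
    using residue_class_eq_iff[of 1 X 0 P] diff_op_rconst[of 1 P] assms(1)
    by (simp add: pscale_def flip: q0 q1)
  then have K: "subfield ?K ?Q" using h.img_is_subfield(2)[OF subfield_constants] by blast
  have comb: "?q (rconst r) \<otimes>\<^bsub>?Q\<^esub> ?q D \<oplus>\<^bsub>?Q\<^esub> ?q E = ?q (pscale r D + E)"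
    if "D \<in> rpolys X" "E \<in> rpolys X" for r D E
    using that h.hom_mult[of "rconst r" D] h.hom_add[of "rconst r * D" E]
    by (simp add: rpolys_mult pscale_def)
  have span_sub: "rp.span (set Ds) \<subseteq> ?H" if "set Ds \<subseteq> ?H" for Ds
    using that subspace_homogeneous by (rule rp.span_minimal)
  \<comment> \<open>Spans of residue classes are computed upstairs: one more class adds the image of
    one more line.\<close>
  have Span: "Q.Span ?K (map ?q Ds) = ?q ` rp.span (set Ds)" if "set Ds \<subseteq> ?H" for Ds
    using that
  proof (induction Ds)
    case Nil
    then show ?case by (simp add: q0)
  next
    case (Cons D Ds)
    have sub: "rp.span (set Ds) \<subseteq> ?H" "D \<in> ?H" using Cons.prems span_sub[of Ds] by auto
    have "Q.Span ?K (map ?q (D # Ds)) = Q.line_extension ?K (?q D) (?q ` rp.span (set Ds))"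
      using Cons by simp
    also have "\<dots> = {?q (pscale r D + E) | r E. E \<in> rp.span (set Ds)}"
      using comb sub by (auto simp: Q.line_extension_mem_iff) (metis (mono_tags, lifting) CollectD comb imageI rangeI subsetD)+
    also have "\<dots> = ?q ` rp.span (set (D # Ds))"
    proof -
      have "rp.span (set (D # Ds)) = {pscale r D + E | r E. E \<in> rp.span (set Ds)}"
        by (auto simp: rp.span_insert) (metis add_diff_cancel_left' diff_add_cancel add.commute)+
      then show ?thesis by auto
    qed
    finally show ?case .
  qed
  have indep: "Q.independent ?K (map ?q Ds)"
    if "set Ds \<subseteq> ?H" "distinct (map ?\<phi> Ds)" "rp.independent (?\<phi> ` set Ds)" for Ds
    using that
  proof (induction Ds)
    case Nil
    then show ?case by simp
  next
    case (Cons D Ds)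
    have "?q D \<notin> Q.Span ?K (map ?q Ds)"
    proof
      assume "?q D \<in> Q.Span ?K (map ?q Ds)"
      then obtain E where E: "E \<in> rp.span (set Ds)" "?q D = ?q E"
        using Span[of Ds] Cons.prems by auto
      then have "?\<phi> D = ?\<phi> E"
        using residue_class_eq_iff[of D X E P] Cons.prems span_sub[of Ds] by auto
      also have "\<dots> \<in> rp.span (?\<phi> ` set Ds)"
        using E(1) by (simp add: module_hom.span_image[OF module_hom_diff_op])
      finally show False
        using Cons.prems by (auto simp: rp.independent_insert)
    qed
    moreover have "Q.independent ?K (map ?q Ds)"
      using Cons rp.independent_mono[of "?\<phi> ` set (D # Ds)" "?\<phi> ` set Ds"] by auto
    moreover have "?q D \<in> carrier ?Q" using Cons.prems h.hom_closed[of D] by auto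
    ultimately show ?case by (simp add: Q.li_Cons)
  qed
  obtain B where B: "B \<subseteq> derivs X d P" "rp.independent B" "derivs X d P \<subseteq> rp.span B"
      "card B = rp.dim (derivs X d P)"
    using rp.basis_exists by blast
  have "finite B"
    using rp.independent_span_bound[OF fin(2) B(2)] B(1) fin(1) by auto
  then obtain Bs where Bs: "set Bs = B" "distinct Bs" using finite_distinct_list by blast
  have "\<forall>b\<in>B. \<exists>D. D \<in> ?H \<and> ?\<phi> D = b" using B(1) by (auto simp: derivs_def)
  then obtain g where g: "\<And>b. b \<in> B \<Longrightarrow> g b \<in> ?H \<and> ?\<phi> (g b) = b" by metis
  \<comment> \<open>Operators whose action on P gives exactly the chosen basis of the space of
    derivatives.\<close>
  define Ds where "Ds = map g Bs"
  have map_Ds: "map ?\<phi> Ds = Bs" unfolding Ds_def using g Bs(1) by (auto intro: map_idI)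
  then have img: "?\<phi> ` set Ds = B" using Bs(1) by (metis set_map)
  have Ds: "set Ds \<subseteq> ?H" using g Bs(1) by (auto simp: Ds_def)
  have "?q ` ?H = Q.Span ?K (map ?q Ds)"
  proof
    show "?q ` ?H \<subseteq> Q.Span ?K (map ?q Ds)"
    proof
      fix x assume "x \<in> ?q ` ?H"
      then obtain D where D: "D \<in> ?H" "x = ?q D" by blast
      then have "?\<phi> D \<in> rp.span (?\<phi> ` set Ds)" using B(3) img by (auto simp: derivs_def)
      then obtain E where E: "E \<in> rp.span (set Ds)" "?\<phi> D = ?\<phi> E"
        by (auto simp: module_hom.span_image[OF module_hom_diff_op])
      then have "?q D = ?q E"
        using residue_class_eq_iff[of D X E P] D span_sub[OF Ds] by auto
      then show "x \<in> Q.Span ?K (map ?q Ds)" using Span[OF Ds] D E by auto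
    qed
    show "Q.Span ?K (map ?q Ds) \<subseteq> ?q ` ?H" using Span[OF Ds] span_sub[OF Ds] by auto
  qed
  moreover have "Q.dimension (length (map ?q Ds)) ?K (Q.Span ?K (map ?q Ds))"
    by (rule Q.dimension_independent) (use indep[OF Ds] map_Ds img Bs B in simp)
  moreover have "length (map ?q Ds) = card B"
    using distinct_card[OF Bs(2)] Bs(1) by (simp add: Ds_def)
  ultimately have "Q.dimension (card B) ?K (?q ` ?H)" by metis
  from Q.dimI[OF K this] B(4) show ?thesis
    by (simp add: graded_dim_def graded_part_def over_def)
qed

subsection \<open>Adding a power of a linear form to a sum of powers of linear forms\<close>

lemma mdeg_superset: "finite A \<Longrightarrow> kys m \<subseteq> A \<Longrightarrow> mdeg m = (\<Sum>i\<in>A. lkp m i)"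
  unfolding mdeg_def by (intro sum.mono_neutral_left) (auto simp: in_keys_iff)

lemma mdeg_add: "mdeg (m + m') = mdeg m + mdeg m'"
proof -
  let ?A = "kys m \<union> kys m'"
  have "mdeg (m + m') = (\<Sum>i\<in>?A. lkp (m + m') i)"
    by (rule mdeg_superset) (use keys_add[of m m'] in auto)
  then show ?thesis
    by (simp add: lookup_add sum.distrib mdeg_superset[of ?A])
qed

lemma homogeneous_mult:
  assumes "homogeneous (2 * j) P" "homogeneous (2 * k) Q"
  shows "homogeneous (2 * (j + k)) (P * Q)"
  unfolding homogeneous_iff
proof
  fix m assume "m \<in> kys (P * Q)"
  then obtain a b where "m = a + b" "a \<in> kys P" "b \<in> kys Q"
    using keys_mult[of P Q] by blast
  then show "mdeg m = j + k" using assms by (simp add: homogeneous_iff mdeg_add)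
qed

lemma homogeneous_1: "homogeneous (2 * 0) 1"
  by (simp add: homogeneous_def)

lemma homogeneous_rvar: "homogeneous (2 * 1) (rvar i)"
  unfolding homogeneous_iff by (simp add: rvar_def mdeg_def)

lemma homogeneous_power: "homogeneous (2 * j) P \<Longrightarrow> homogeneous (2 * (k * j)) (P ^ k)"
proof (induction k)
  case (Suc k)
  then show ?case using homogeneous_mult[of j P "k * j" "P ^ k"] by simp
qed (use homogeneous_1 in simp)

lemma homogeneous_prod_rvar: "finite T \<Longrightarrow> homogeneous (2 * card T) (\<Prod>s\<in>T. rvar s)"
proof (induction T rule: finite_induct)
  case (insert x T)
  then show ?case using homogeneous_mult[OF homogeneous_rvar[of x] insert.IH] by simp
qed (use homogeneous_1 in simp)

text \<open>
  If \<open>T\<close> is a missing face, such an operator \<open>D\<close> annihilates the volume polynomial, but not the powers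
  of a linear form whose coefficients on \<open>T\<close> are nonzero.
\<close>

lemma separating_monomial:
  assumes "finite T" "T \<noteq> {}" "T \<subseteq> Y" "card T \<le> k"
  obtains D where "D \<in> rpolys Y" "homogeneous (2 * k) D"
    "\<And>a. poly_eval a D = 0 \<longleftrightarrow> (\<exists>s\<in>T. a s = 0)"
proof -
  obtain t where t: "t \<in> T" using assms(2) by blast
  \<comment> \<open>The power of a single variable of T pads the degree to k without creating new
    zeros.\<close>
  let ?D = "(\<Prod>s\<in>T. rvar s) * rvar t ^ (k - card T)"
  show thesis
  proof (rule that)
    show "?D \<in> rpolys Y"
      using assms(3) t by (intro rpolys_mult rpolys_prod rpolys_power rpolys_rvar) auto
    show "homogeneous (2 * k) ?D"
      using homogeneous_mult[OF homogeneous_prod_rvar[OF assms(1)]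
        homogeneous_power[OF homogeneous_rvar, of "k - card T" t]] assms(4) by simp
    show "poly_eval a ?D = 0 \<longleftrightarrow> (\<exists>s\<in>T. a s = 0)" for a
      using assms(1) t by (auto simp: poly_eval_mult poly_eval_prod poly_eval_power)
  qed
qed

lemma diff_op_sum_powers:
  assumes "finite Y" "\<And>I. I \<in> F \<Longrightarrow> \<forall>i. i \<notin> Y \<longrightarrow> al I i = 0" "homogeneous (2 * k) D"
  shows "diff_op D (\<Sum>I\<in>F. pscale (c I) (lform Y (al I) ^ n)) =
    (\<Sum>I\<in>F. pscale (c I * (ffall n k * poly_eval (al I) D)) (lform Y (al I) ^ (n - k)))"
  using assms by (auto simp: diff_op_sum_right diff_op_pscale_right diff_op_lform_power intro!: sum.cong)

text \<open>Supplies a finite spanning set, which makes the dimensions meaningful.\<close>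

lemma derivs_sum_powers_subset_span:
  assumes "finite Y" "\<And>I. I \<in> F \<Longrightarrow> \<forall>i. i \<notin> Y \<longrightarrow> al I i = 0"
  shows "derivs X (2 * k) (\<Sum>I\<in>F. pscale (c I) (lform Y (al I) ^ n)) \<subseteq>
    rp.span ((\<lambda>I. lform Y (al I) ^ (n - k)) ` F)"
proof
  fix x assume "x \<in> derivs X (2 * k) (\<Sum>I\<in>F. pscale (c I) (lform Y (al I) ^ n))"
  then obtain D where "homogeneous (2 * k) D"
    "x = diff_op D (\<Sum>I\<in>F. pscale (c I) (lform Y (al I) ^ n))"
    by (auto simp: derivs_def)
  then have "x = (\<Sum>I\<in>F. pscale (c I * (ffall n k * poly_eval (al I) D)) (lform Y (al I) ^ (n - k)))"
    using diff_op_sum_powers[where k = k and D = D] assms by blast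
  then show "x \<in> rp.span ((\<lambda>I. lform Y (al I) ^ (n - k)) ` F)"
    by (simp only:) (rule rp.span_sum[OF rp.span_scale[OF rp.span_base]]; simp)
qed

text \<open>A separating operator of degree k kills all summands over F and leaves a multiple of the
  power of the remaining form. The factor is nonzero: r and the value at \<open>a\<close> are, and
  \<open>ffall n k\<close> is positive for k \<le> n.\<close>

lemma power_mem_derivs:
  assumes "finite Y" "\<And>I. I \<in> F \<Longrightarrow> \<forall>i. i \<notin> Y \<longrightarrow> al I i = 0" "\<forall>i. i \<notin> Y \<longrightarrow> a i = 0"
    and T: "finite T" "T \<noteq> {}" "T \<subseteq> Y" "\<And>I. I \<in> F \<Longrightarrow> \<exists>s\<in>T. al I s = 0" "\<And>s. s \<in> T \<Longrightarrow> a s \<noteq> 0"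
    and "r \<noteq> 0" "card T \<le> k" "k \<le> n"
  shows "lform Y a ^ (n - k) \<in>
    derivs Y (2 * k) ((\<Sum>I\<in>F. pscale (c I) (lform Y (al I) ^ n)) + pscale r (lform Y a ^ n))"
    (is "?L \<in> derivs Y _ ?V")
proof -
  obtain D where D: "D \<in> rpolys Y" "homogeneous (2 * k) D"
    "\<And>a. poly_eval a D = 0 \<longleftrightarrow> (\<exists>s\<in>T. a s = 0)"
    by (rule separating_monomial[OF T(1-3) \<open>card T \<le> k\<close>]) (rule that; assumption)
  let ?s = "r * (ffall n k * poly_eval a D)"
  have "poly_eval (al I) D = 0" if "I \<in> F" for I using D(3)[of "al I"] T(4)[OF that] by simp
  then have "(\<Sum>I\<in>F. pscale (c I * (ffall n k * poly_eval (al I) D)) (lform Y (al I) ^ (n - k))) = 0"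
    by (intro sum.neutral) simp
  moreover have "diff_op D (\<Sum>I\<in>F. pscale (c I) (lform Y (al I) ^ n)) =
      (\<Sum>I\<in>F. pscale (c I * (ffall n k * poly_eval (al I) D)) (lform Y (al I) ^ (n - k)))"
    by (rule diff_op_sum_powers; fact)
  moreover have "diff_op D (lform Y a ^ n) = pscale (ffall n k * poly_eval a D) ?L"
    by (rule diff_op_lform_power; fact)
  ultimately have "diff_op D ?V = pscale ?s ?L"
    by (simp only: diff_op_add_right diff_op_pscale_right) simp
  moreover have "poly_eval a D \<noteq> 0" using D(3)[of a] T(5) by (meson)
  then have "?s \<noteq> 0" using ffall_pos[OF \<open>k \<le> n\<close>] \<open>r \<noteq> 0\<close> by simp
  ultimately have "?L = pscale (1 / ?s) (diff_op D ?V)"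
    by (simp only: rp.scale_scale) simp
  moreover have "diff_op D ?V \<in> derivs Y (2 * k) ?V"
    unfolding derivs_def using D(1,2) by blast
  then have "pscale (1 / ?s) (diff_op D ?V) \<in> derivs Y (2 * k) ?V"
    by (rule rp.subspace_scale[OF subspace_derivs])
  ultimately show ?thesis by simp
qed

text \<open>If D produced the power, apply a separating operator E of the complementary degree n -
  k. Derivatives of the sum are still combinations of powers of the same forms, so E kills the
  result, whereas E sends \<ell>^(n-k) to a nonzero constant.\<close>

lemma power_notin_derivs:
  assumes "finite Y" "\<And>I. I \<in> F \<Longrightarrow> \<forall>i. i \<notin> Y \<longrightarrow> al I i = 0" "\<forall>i. i \<notin> Y \<longrightarrow> a i = 0"
    and T: "finite T" "T \<noteq> {}" "T \<subseteq> Y" "\<And>I. I \<in> F \<Longrightarrow> \<exists>s\<in>T. al I s = 0" "\<And>s. s \<in> T \<Longrightarrow> a s \<noteq> 0"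
    and "card T \<le> n - k"
  shows "lform Y a ^ (n - k) \<notin> derivs Y (2 * k) (\<Sum>I\<in>F. pscale (c I) (lform Y (al I) ^ n))"
proof
  assume "lform Y a ^ (n - k) \<in> derivs Y (2 * k) (\<Sum>I\<in>F. pscale (c I) (lform Y (al I) ^ n))"
  then obtain D where D: "homogeneous (2 * k) D"
    "lform Y a ^ (n - k) = diff_op D (\<Sum>I\<in>F. pscale (c I) (lform Y (al I) ^ n))"
    by (auto simp: derivs_def)
  obtain E where E: "E \<in> rpolys Y" "homogeneous (2 * (n - k)) E"
    "\<And>a. poly_eval a E = 0 \<longleftrightarrow> (\<exists>s\<in>T. a s = 0)"
    by (rule separating_monomial[OF T(1-3) \<open>card T \<le> n - k\<close>]) (rule that; assumption)
  have "poly_eval (al I) E = 0" if "I \<in> F" for I using E(3)[of "al I"] T(4)[OF that] by simp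
  then have "(\<Sum>I\<in>F. pscale (c I * (ffall n k * poly_eval (al I) D) *
      (ffall (n - k) (n - k) * poly_eval (al I) E)) 1) = 0"
    by (intro sum.neutral) simp
  moreover have "diff_op D (\<Sum>I\<in>F. pscale (c I) (lform Y (al I) ^ n)) =
      (\<Sum>I\<in>F. pscale (c I * (ffall n k * poly_eval (al I) D)) (lform Y (al I) ^ (n - k)))"
    by (rule diff_op_sum_powers; fact)
  moreover have "diff_op E (\<Sum>I\<in>F. pscale (c I * (ffall n k * poly_eval (al I) D)) (lform Y (al I) ^ (n - k))) =
      (\<Sum>I\<in>F. pscale (c I * (ffall n k * poly_eval (al I) D) *
        (ffall (n - k) (n - k) * poly_eval (al I) E)) (lform Y (al I) ^ (n - k - (n - k))))"
    by (rule diff_op_sum_powers; fact)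
  ultimately have "diff_op E (lform Y a ^ (n - k)) = 0" by (simp add: D(2))
  moreover have "diff_op E (lform Y a ^ (n - k)) =
      pscale (ffall (n - k) (n - k) * poly_eval a E) (lform Y a ^ (n - k - (n - k)))"
    by (rule diff_op_lform_power; fact)
  then have "diff_op E (lform Y a ^ (n - k)) = rconst (ffall (n - k) (n - k) * poly_eval a E)"
    by (simp add: pscale_def)
  ultimately have "ffall (n - k) (n - k) * poly_eval a E = 0"
    by (metis poly_eval_0 poly_eval_rconst)
  moreover have "poly_eval a E \<noteq> 0" using E(3)[of a] T(5) by (meson)
  ultimately show False using ffall_pos[of "n - k" "n - k"] by simp
qed

lemma dim_span_insert:
  assumes "rp.subspace W" "W \<subseteq> rp.span S" "finite S"
  shows "rp.dim (rp.span (insert x W)) = rp.dim W + (if x \<in> W then 0 else 1)"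
proof (cases "x \<in> W")
  case True
  then show ?thesis by (simp add: insert_absorb)
next
  case False
  obtain B where B: "B \<subseteq> W" "rp.independent B" "W \<subseteq> rp.span B" "card B = rp.dim W"
    using rp.basis_exists by blast
  have sp: "rp.span B = W" using B assms(1) by (simp add: rp.span_subspace)
  have "finite B" using rp.independent_span_bound[OF assms(3) B(2)] B(1) assms(2) by auto
  have "rp.independent (insert x B)" using B(2) sp False by (simp add: rp.independent_insertI)
  moreover have "rp.span (insert x W) = rp.span (insert x B)"
    by (simp only: rp.span_insert sp rp.span_eq_iff[THEN iffD2, OF assms(1)])
  moreover have "x \<notin> B" using B(1) False by blast
  ultimately show ?thesis
    using False \<open>finite B\<close> B(4) by (simp add: rp.dim_span_eq_card_independent del: rp.dim_span)
qed

text \<open>Adjoining \<ell>^(n-k) makes the two spaces of derivatives equal, so their dimensions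
  differ only by whether each already contains it. For k < card S one has card S' \<le> n - k, and
  symmetrically, so one of the two membership criteria applies to each space for every k.\<close>

theorem dim_derivs_add_power:
  assumes "finite Y" "finite F" "finite F'"
    and F: "\<And>I. I \<in> F \<Longrightarrow> \<forall>i. i \<notin> Y \<longrightarrow> al I i = 0"
    and F': "\<And>I. I \<in> F' \<Longrightarrow> \<forall>i. i \<notin> Y \<longrightarrow> al' I i = 0"
    and a: "\<forall>i. i \<notin> Y \<longrightarrow> a i = 0"
    and V: "V = (\<Sum>I\<in>F. pscale (c I) (lform Y (al I) ^ n))"
    and V': "V' = (\<Sum>I\<in>F'. pscale (c' I) (lform Y (al' I) ^ n))"
    and eq: "V' = V + pscale r (lform Y a ^ n)" "r \<noteq> 0"
    and S: "finite S" "S \<noteq> {}" "S \<subseteq> Y" "\<And>I. I \<in> F \<Longrightarrow> \<exists>s\<in>S. al I s = 0" "\<And>s. s \<in> S \<Longrightarrow> a s \<noteq> 0"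
    and S': "finite S'" "S' \<noteq> {}" "S' \<subseteq> Y" "\<And>I. I \<in> F' \<Longrightarrow> \<exists>s\<in>S'. al' I s = 0" "\<And>s. s \<in> S' \<Longrightarrow> a s \<noteq> 0"
    and n: "card S + card S' = n + 1" "k \<le> n"
  shows "rp.dim (derivs Y (2 * k) V') + (if k < card S then 1 else 0) =
    rp.dim (derivs Y (2 * k) V) + (if k < card S' then 1 else 0)"
proof -
  let ?L = "lform Y a ^ (n - k)" and ?W = "derivs Y (2 * k) V" and ?W' = "derivs Y (2 * k) V'"
  \<comment> \<open>The situation is symmetric in V and V', with r replaced by its negative.\<close>
  have eq': "V = V' + pscale (- r) (lform Y a ^ n)"
    by (simp add: eq)
  have mem: "?L \<in> ?W' \<longleftrightarrow> \<not> k < card S"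
  proof (cases "k < card S")
    case True
    then have card: "card S' \<le> n - k" using n by simp
    have "?L \<notin> ?W'" unfolding V'
      by (rule power_notin_derivs[where T = S', OF \<open>finite Y\<close>]; (fact | simp add: card))
    then show ?thesis using True by simp
  next
    case False
    then have card: "card S \<le> k" by simp
    have "?L \<in> ?W'" unfolding eq(1) V
      by (rule power_mem_derivs[where T = S, OF \<open>finite Y\<close>]; (fact | simp add: card))
    then show ?thesis using False by simp
  qed
  have mem': "?L \<in> ?W \<longleftrightarrow> \<not> k < card S'"
  proof (cases "k < card S'")
    case True
    then have card: "card S \<le> n - k" using n by simp
    have "?L \<notin> ?W" unfolding V
      by (rule power_notin_derivs[where T = S, OF \<open>finite Y\<close>]; (fact | simp add: card))
    then show ?thesis using True by simp
  next
    case False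
    then have card: "card S' \<le> k" by simp
    have "?L \<in> ?W" unfolding eq' V'
      by (rule power_mem_derivs[where T = S', OF \<open>finite Y\<close>]; (fact | simp add: card eq(2)))
    then show ?thesis using False by simp
  qed
  \<comment> \<open>An operator of degree k takes \<ell>^n to a multiple of \<ell>^(n-k), so modulo
    that power P and Q have the same derivatives.\<close>
  have step: "rp.span (insert ?L (derivs Y (2 * k) P)) \<subseteq> rp.span (insert ?L (derivs Y (2 * k) Q))"
    if "P = Q + pscale s (lform Y a ^ n)" for P Q s
  proof (rule rp.span_minimal)
    show "insert ?L (derivs Y (2 * k) P) \<subseteq> rp.span (insert ?L (derivs Y (2 * k) Q))"
    proof
      fix x assume "x \<in> insert ?L (derivs Y (2 * k) P)"
      then consider "x = ?L" | D where "D \<in> rpolys Y" "homogeneous (2 * k) D" "x = diff_op D P"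
        by (auto simp: derivs_def)
      then show "x \<in> rp.span (insert ?L (derivs Y (2 * k) Q))"
      proof cases
        case 2
        then have "x = diff_op D Q + pscale (s * (ffall n k * poly_eval a D)) ?L"
          using \<open>finite Y\<close> a
          by (simp add: that diff_op_add_right diff_op_pscale_right diff_op_lform_power[where k = k])
        moreover have "diff_op D Q \<in> derivs Y (2 * k) Q" using 2 by (auto simp: derivs_def)
        ultimately show ?thesis
          by (simp only:) (rule rp.span_add[OF rp.span_base rp.span_scale[OF rp.span_base]]; simp)
      qed (auto intro: rp.span_base)
    qed
  qed simp
  have "rp.span (insert ?L ?W) = rp.span (insert ?L ?W')"
    using step[OF eq(1)] step[OF eq'] by blast
  moreover have "rp.dim (rp.span (insert ?L ?W)) = rp.dim ?W + (if ?L \<in> ?W then 0 else 1)"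
    unfolding V by (rule dim_span_insert[OF subspace_derivs derivs_sum_powers_subset_span])
      (fact | simp add: \<open>finite F\<close>)+
  moreover have "rp.dim (rp.span (insert ?L ?W')) = rp.dim ?W' + (if ?L \<in> ?W' then 0 else 1)"
    unfolding V' by (rule dim_span_insert[OF subspace_derivs derivs_sum_powers_subset_span])
      (fact | simp add: \<open>finite F'\<close>)+
  ultimately have "rp.dim ?W + (if ?L \<in> ?W then 0 else 1) = rp.dim ?W' + (if ?L \<in> ?W' then 0 else 1)"
    by simp
  then show ?thesis using mem mem' by auto
qed

section \<open>Independence of the ambient set of variables\<close>

lemma lform_mono:
  assumes "finite Y" "X \<subseteq> Y" "\<forall>i. i \<notin> X \<longrightarrow> a i = 0"
  shows "lform Y a = lform X a"
  unfolding lform_def using assms by (intro sum.mono_neutral_right) auto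

text \<open>An operator acts on V only through its values at the vectors \<open>al I\<close>, and
  these vanish off X. Terms with further variables contribute nothing and may be dropped. The graded
  dimension uses the vertices of one complex, while a flip is studied over the vertices of
  both.\<close>

lemma derivs_sum_powers_mono:
  fixes c :: "'i \<Rightarrow> real" and n :: nat and al :: "'i \<Rightarrow> 'v \<Rightarrow> real"
  assumes "finite Y" "X \<subseteq> Y" and F: "\<And>I. I \<in> F \<Longrightarrow> \<forall>i. i \<notin> X \<longrightarrow> al I i = 0"
  defines "V \<equiv> \<Sum>I\<in>F. pscale (c I) (lform Y (al I) ^ n)"
  shows "derivs X (2 * k) V = derivs Y (2 * k) V"
proof
  show "derivs X (2 * k) V \<subseteq> derivs Y (2 * k) V"
    unfolding derivs_def
  proof (rule image_mono)
    show "{D \<in> rpolys X. homogeneous (2 * k) D} \<subseteq> {D \<in> rpolys Y. homogeneous (2 * k) D}"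
      using assms(2) by (auto simp: rpolys_alt)
  qed
  show "derivs Y (2 * k) V \<subseteq> derivs X (2 * k) V"
  proof
    fix x assume "x \<in> derivs Y (2 * k) V"
    then obtain D where D: "homogeneous (2 * k) D" "x = diff_op D V" by (auto simp: derivs_def)
    \<comment> \<open>The part of D that involves only variables from X.\<close>
    define E where "E = (\<Sum>m\<in>{m \<in> kys D. kys m \<subseteq> X}. sgl m (lkp D m))"
    have lkp_E: "lkp E m = (if kys m \<subseteq> X then lkp D m else 0)" for m
    proof -
      have "lkp E m = (\<Sum>m'\<in>{m \<in> kys D. kys m \<subseteq> X}. if m' = m then lkp D m' else 0)"
        by (simp add: E_def lookup_sum lookup_single when_def)
      also have "\<dots> = (if m \<in> {m \<in> kys D. kys m \<subseteq> X} then lkp D m else 0)"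
        by (subst sum.delta) auto
      finally show ?thesis using in_keys_iff[of m D] by auto
    qed
    have "kys E \<subseteq> {m \<in> kys D. kys m \<subseteq> X}"
    proof
      fix m assume "m \<in> kys E"
      then show "m \<in> {m \<in> kys D. kys m \<subseteq> X}"
        using lkp_E[of m] in_keys_iff[of m E] in_keys_iff[of m D] by (auto split: if_splits)
    qed
    then have E: "E \<in> rpolys X" "homogeneous (2 * k) E"
      using D(1) by (auto simp: rpolys_alt homogeneous_iff)
    have eval: "poly_eval a E = poly_eval a D" if "\<forall>i. i \<notin> X \<longrightarrow> a i = 0" for a
    proof -
      have "poly_eval a E = (\<Sum>m\<in>{m \<in> kys D. kys m \<subseteq> X}. lkp D m * mon_eval a m)"
        by (simp add: E_def poly_eval_sum poly_eval_single)
      also have "\<dots> = poly_eval a D"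
        unfolding poly_eval_alt
      proof (rule sum.mono_neutral_left)
        show "\<forall>m\<in>kys D - {m \<in> kys D. kys m \<subseteq> X}. lkp D m * mon_eval a m = 0"
        proof
          fix m assume "m \<in> kys D - {m \<in> kys D. kys m \<subseteq> X}"
          then obtain i where "i \<in> kys m" "i \<notin> X" by blast
          then have "a i ^ lkp m i = 0" using that by (simp add: in_keys_iff)
          then have "mon_eval a m = 0"
            using \<open>i \<in> kys m\<close> by (auto simp: mon_eval_def)
          then show "lkp D m * mon_eval a m = 0" by simp
        qed
      qed auto
      finally show ?thesis .
    qed
    have F': "\<forall>i. i \<notin> Y \<longrightarrow> al I i = 0" if "I \<in> F" for I
      using F[OF that] assms(2) by auto
    have "diff_op E V = diff_op D V"
    proof -
      have "diff_op G V =
          (\<Sum>I\<in>F. pscale (c I * (ffall n k * poly_eval (al I) G)) (lform Y (al I) ^ (n - k)))"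
        if "homogeneous (2 * k) G" for G
        unfolding V_def by (rule diff_op_sum_powers; fact)
      note formula = this
      have "poly_eval (al I) E = poly_eval (al I) D" if "I \<in> F" for I
        by (rule eval, rule F, rule that)
      then show ?thesis by (simp add: formula[OF E(2)] formula[OF D(1)] cong: sum.cong)
    qed
    then have "x = diff_op E V" using D by simp
    then show "x \<in> derivs X (2 * k) V" using E by (auto simp: derivs_def)
  qed
qed

text \<open>The separating operator of degree n for T kills every summand except that of J, which it
  turns into a nonzero constant.\<close>

lemma sum_powers_nonzero:
  assumes "finite Y" "finite F" "\<And>I. I \<in> F \<Longrightarrow> \<forall>i. i \<notin> Y \<longrightarrow> al I i = 0"
    and T: "finite T" "T \<noteq> {}" "T \<subseteq> Y" "card T \<le> n" "J \<in> F" "\<And>s. s \<in> T \<Longrightarrow> al J s \<noteq> 0"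
      "\<And>I. I \<in> F \<Longrightarrow> I \<noteq> J \<Longrightarrow> \<exists>s\<in>T. al I s = 0"
    and "c J \<noteq> 0"
  shows "(\<Sum>I\<in>F. pscale (c I) (lform Y (al I) ^ n)) \<noteq> 0"
proof
  assume eq: "(\<Sum>I\<in>F. pscale (c I) (lform Y (al I) ^ n)) = 0"
  obtain D where D: "D \<in> rpolys Y" "homogeneous (2 * n) D"
    "\<And>a. poly_eval a D = 0 \<longleftrightarrow> (\<exists>s\<in>T. a s = 0)"
    using separating_monomial[OF T(1-4)] by blast
  have zero: "poly_eval (al I) D = 0" if "I \<in> F" "I \<noteq> J" for I
    using D(3) T(7)[OF that] by blast
  have nonzero: "poly_eval (al J) D \<noteq> 0"
    using D(3) T(6) by blast
  have "diff_op D (\<Sum>I\<in>F. pscale (c I) (lform Y (al I) ^ n)) =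
      (\<Sum>I\<in>F. pscale (c I * (ffall n n * poly_eval (al I) D)) (lform Y (al I) ^ (n - n)))"
    by (rule diff_op_sum_powers; fact)
  also have "\<dots> = (\<Sum>I\<in>F. if I = J then pscale (c J * (ffall n n * poly_eval (al J) D)) 1 else 0)"
    using zero by (intro sum.cong) auto
  also have "\<dots> = rconst (c J * (ffall n n * poly_eval (al J) D))"
    using \<open>finite F\<close> \<open>J \<in> F\<close> by (simp add: pscale_def)
  finally have "c J * (ffall n n * poly_eval (al J) D) = 0"
    unfolding eq by (metis diff_op_0_right poly_eval_0 poly_eval_rconst)
  then show False using ffall_pos[of n n] nonzero \<open>c J \<noteq> 0\<close> by simp
qed

subsection \<open>Coning a basis\<close>

text \<open>The left side is a divided difference: g equals its Lagrange interpolation polynomial at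
  the n + 1 nodes, and the coefficients of degree n are compared.\<close>

lemma sum_divided_differences:
  fixes \<tau> :: "'i \<Rightarrow> real" and g :: "real poly"
  assumes "finite S" "inj_on \<tau> S" "card S = Suc n" "Polynomial.degree g \<le> n"
  shows "(\<Sum>s\<in>S. poly g (\<tau> s) / (\<Prod>i\<in>S - {s}. \<tau> s - \<tau> i)) = Polynomial.coeff g n"
proof -
  define c where "c s = poly g (\<tau> s) / (\<Prod>i\<in>S - {s}. \<tau> s - \<tau> i)" for s
  define L where "L s = (\<Prod>i\<in>S - {s}. [:- \<tau> i, 1:])" for s
  define h where "h = (\<Sum>s\<in>S. Polynomial.smult (c s) (L s))"
  have deg: "Polynomial.degree (L s) = n" and lead: "Polynomial.coeff (L s) n = 1" if "s \<in> S" for s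
  proof -
    have "Polynomial.lead_coeff (L s) = 1" by (simp add: L_def lead_coeff_prod)
    moreover show "Polynomial.degree (L s) = n" unfolding L_def
      using that assms by (subst degree_prod_eq_sum_degree) auto
    ultimately show "Polynomial.coeff (L s) n = 1" by simp
  qed
  have "g = h"
  proof (rule poly_eqI_degree[where A = "\<tau> ` S"])
    fix x assume "x \<in> \<tau> ` S"
    then obtain t where t: "t \<in> S" "x = \<tau> t" by blast
    have "poly (L s) (\<tau> t) = (if s = t then (\<Prod>i\<in>S - {t}. \<tau> t - \<tau> i) else 0)" if "s \<in> S" for s
      using t \<open>finite S\<close> that by (auto simp: L_def poly_prod)
    then have "poly h x = (\<Sum>s\<in>S. if s = t then c t * (\<Prod>i\<in>S - {t}. \<tau> t - \<tau> i) else 0)"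
      unfolding h_def poly_sum t by (intro sum.cong) auto
    also have "\<dots> = c t * (\<Prod>i\<in>S - {t}. \<tau> t - \<tau> i)"
      using t \<open>finite S\<close> by simp
    also have "(\<Prod>i\<in>S - {t}. \<tau> t - \<tau> i) \<noteq> 0"
      using t assms(1,2) by (auto simp: inj_on_eq_iff)
    then have "c t * (\<Prod>i\<in>S - {t}. \<tau> t - \<tau> i) = poly g x" by (simp add: c_def t)
    finally show "poly g x = poly h x" ..
  next
    have "Polynomial.degree h \<le> n" unfolding h_def
      using deg by (intro degree_sum_le) (auto intro: order_trans[OF degree_smult_le] \<open>finite S\<close>)
    then show "Polynomial.degree h < card (\<tau> ` S)" "Polynomial.degree g < card (\<tau> ` S)"
      using assms by (simp_all add: card_image)
  qed
  then have "Polynomial.coeff g n = (\<Sum>s\<in>S. c s * Polynomial.coeff (L s) n)"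
    by (simp add: h_def coeff_sum)
  also have "\<dots> = (\<Sum>s\<in>S. c s)" by (intro sum.cong) (simp_all add: lead)
  finally show ?thesis by (simp add: c_def)
qed

text \<open>Divided difference of the polynomial (t - l X)^n. The sign (-1)^n of its leading
  coefficient is absorbed by reversing the n differences in each denominator.\<close>

lemma sum_powers_over_differences:
  fixes \<tau> :: "'i \<Rightarrow> real"
  assumes "finite S" "inj_on \<tau> S" "card S = Suc n"
  shows "(\<Sum>s\<in>S. (t - \<tau> s * l) ^ n / (\<Prod>i\<in>S - {s}. \<tau> i - \<tau> s)) = l ^ n"
proof -
  let ?g = "[:t, - l:] ^ n"
  have d: "Polynomial.degree ?g \<le> n" using degree_power_le[of "[:t, - l:]" n] by (simp split: if_splits)
  have "Polynomial.coeff ?g n = (- l) ^ n" by (simp add: coeff_linear_poly_power)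
  moreover have "poly ?g (\<tau> s) = (t - \<tau> s * l) ^ n" for s by simp
  ultimately have "(\<Sum>s\<in>S. (t - \<tau> s * l) ^ n / (\<Prod>i\<in>S - {s}. \<tau> s - \<tau> i)) = (- l) ^ n"
    using sum_divided_differences[OF assms d] by simp
  then have "(- 1) ^ n * (\<Sum>s\<in>S. (t - \<tau> s * l) ^ n / (\<Prod>i\<in>S - {s}. \<tau> s - \<tau> i)) = l ^ n"
    by (simp only: power_mult_distrib[symmetric]) simp
  moreover have "(- 1) ^ n * ((t - \<tau> s * l) ^ n / (\<Prod>i\<in>S - {s}. \<tau> s - \<tau> i)) =
      (t - \<tau> s * l) ^ n / (\<Prod>i\<in>S - {s}. \<tau> i - \<tau> s)" if "s \<in> S" for s
  proof -
    have "(\<Prod>i\<in>S - {s}. \<tau> i - \<tau> s) = (\<Prod>i\<in>S - {s}. (- 1) * (\<tau> s - \<tau> i))"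
      by (intro prod.cong) auto
    also have "\<dots> = (- 1) ^ n * (\<Prod>i\<in>S - {s}. \<tau> s - \<tau> i)"
      using assms that by (subst prod.distrib) simp
    finally show ?thesis by (cases "even n") simp_all
  qed
  ultimately show ?thesis by (simp add: sum_distrib_left cong: sum.cong)
qed

text \<open>Here \<open>y\<close> and \<open>z\<close> are the coordinates of a point and of an apex
  in a basis of determinant d, while \<open>a\<close> and \<open>a'\<close> are values prescribed on
  the basis and at the apex. Replacing the j-th basis vector by the apex multiplies d by
  \<open>z j\<close> and changes the coordinates of the point as displayed. With nodes 0 and
  \<open>y k / z k\<close> all terms become those of an interpolation sum, up to the common factor d
  times the product of the \<open>z k\<close>. The result is free of \<open>y\<close>.\<close>

lemma cone_identity:
  fixes y z a :: "'n::finite \<Rightarrow> real" and d a' :: real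
  assumes z: "\<And>j. z j \<noteq> 0" and y: "\<And>j. y j \<noteq> 0"
    and yz: "\<And>j k. j \<noteq> k \<Longrightarrow> y k * z j \<noteq> y j * z k"
  shows "(\<Sum>k\<in>UNIV. a k * y k) ^ CARD('n) / (d * (\<Prod>k\<in>UNIV. y k)) -
    (\<Sum>j\<in>UNIV. (a' * (y j / z j) + (\<Sum>k\<in>UNIV - {j}. a k * (y k - y j * z k / z j))) ^ CARD('n) /
      (z j * d * (y j / z j * (\<Prod>k\<in>UNIV - {j}. y k - y j * z k / z j)))) =
    ((\<Sum>k\<in>UNIV. a k * z k) - a') ^ CARD('n) / (d * (\<Prod>k\<in>UNIV. z k))"
proof (cases "d = 0")
  case False
  let ?n = "CARD('n)"
  define \<tau> where "\<tau> k = y k / z k" for k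
  \<comment> \<open>\<open>None\<close> stands for the basis itself, with node 0, and
    \<open>Some j\<close> for the basis with its j-th vector replaced by the apex.\<close>
  define \<sigma> where "\<sigma> s = (case s of None \<Rightarrow> 0 | Some k \<Rightarrow> \<tau> k)" for s
  define t where "t = (\<Sum>k\<in>UNIV. a k * y k)"
  define l where "l = (\<Sum>k\<in>UNIV. a k * z k) - a'"
  define Z where "Z = (\<Prod>k\<in>UNIV. z k)"
  have Z: "Z \<noteq> 0" using z by (simp add: Z_def)
  have yk: "y k = z k * \<tau> k" for k using z by (simp add: \<tau>_def)
  have inj_\<tau>: "\<tau> j \<noteq> \<tau> k" if "j \<noteq> k" for j k
    using yz[OF that] z by (auto simp: \<tau>_def field_simps)
  have \<tau>0: "\<tau> k \<noteq> 0" for k using y z by (simp add: \<tau>_def)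
  have "inj \<sigma>"
  proof (rule injI)
    fix u v assume "\<sigma> u = \<sigma> v"
    moreover have "\<tau> j = \<tau> k \<longleftrightarrow> j = k" for j k using inj_\<tau> by blast
    ultimately show "u = v"
      by (cases u; cases v) (simp_all add: \<sigma>_def \<tau>0 \<tau>0[THEN not_sym])
  qed
  then have e0: "(\<Sum>s\<in>UNIV. (t - \<sigma> s * l) ^ ?n / (\<Prod>i\<in>UNIV - {s}. \<sigma> i - \<sigma> s)) = l ^ ?n"
    by (intro sum_powers_over_differences) auto
  have e1: "(\<Sum>s\<in>UNIV. (t - \<sigma> s * l) ^ ?n / (\<Prod>i\<in>UNIV - {s}. \<sigma> i - \<sigma> s)) =
      t ^ ?n / (\<Prod>k\<in>UNIV. \<tau> k) -
      (\<Sum>j\<in>UNIV. (t - \<tau> j * l) ^ ?n / (\<tau> j * (\<Prod>k\<in>UNIV - {j}. \<tau> k - \<tau> j)))"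
  proof -
    have U: "UNIV = insert None (range (Some :: 'n \<Rightarrow> _))" by (rule UNIV_option_conv)
    have N: "UNIV - {None} = range (Some :: 'n \<Rightarrow> _)" by (auto simp: UNIV_option_conv)
    have S: "UNIV - {Some j} = insert None (Some ` (UNIV - {j}))" for j :: 'n
      by (auto simp: UNIV_option_conv)
    have 1: "(\<Prod>i\<in>UNIV - {None}. \<sigma> i - \<sigma> None) = (\<Prod>k\<in>UNIV. \<tau> k)"
      unfolding N by (subst prod.reindex) (auto simp: \<sigma>_def)
    \<comment> \<open>The node 0 contributes the factor \<open>- \<tau> j\<close>, whence the minus
      sign between the basis and the replaced bases.\<close>
    have 2: "(\<Prod>i\<in>UNIV - {Some j}. \<sigma> i - \<sigma> (Some j)) =
        - (\<tau> j * (\<Prod>k\<in>UNIV - {j}. \<tau> k - \<tau> j))" for j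
      unfolding S by (subst prod.insert) (auto simp: \<sigma>_def prod.reindex)
    have "(\<Sum>s\<in>UNIV. (t - \<sigma> s * l) ^ ?n / (\<Prod>i\<in>UNIV - {s}. \<sigma> i - \<sigma> s)) =
        t ^ ?n / (\<Prod>k\<in>UNIV. \<tau> k) +
        (\<Sum>j\<in>UNIV. (t - \<tau> j * l) ^ ?n / (- (\<tau> j * (\<Prod>k\<in>UNIV - {j}. \<tau> k - \<tau> j))))"
    proof -
      have "(\<Sum>s\<in>UNIV. f s) = f None + (\<Sum>j\<in>UNIV. f (Some j))" for f :: "'n option \<Rightarrow> real"
        unfolding U by (subst sum.insert) (auto simp: sum.reindex)
      then show ?thesis unfolding 1 2 by (simp only: 1 2) (simp add: \<sigma>_def)
    qed
    then show ?thesis by (simp add: sum_negf)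
  qed
  have e2: "t ^ ?n / (\<Prod>k\<in>UNIV. \<tau> k) / (d * Z) = t ^ ?n / (d * (\<Prod>k\<in>UNIV. y k))"
    by (simp add: yk prod.distrib Z_def)
  have e3: "(t - \<tau> j * l) ^ ?n / (\<tau> j * (\<Prod>k\<in>UNIV - {j}. \<tau> k - \<tau> j)) / (d * Z) =
      (a' * (y j / z j) + (\<Sum>k\<in>UNIV - {j}. a k * (y k - y j * z k / z j))) ^ ?n /
      (z j * d * (y j / z j * (\<Prod>k\<in>UNIV - {j}. y k - y j * z k / z j)))" for j
  proof -
    have d1: "y k - y j * z k / z j = z k * (\<tau> k - \<tau> j)" for k
      using z[of j] z[of k] by (simp add: \<tau>_def field_simps)
    have "Z = z j * (\<Prod>k\<in>UNIV - {j}. z k)"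
      unfolding Z_def by (subst prod.remove[of _ j]) auto
    then have den: "z j * d * (y j / z j * (\<Prod>k\<in>UNIV - {j}. y k - y j * z k / z j)) =
        \<tau> j * (\<Prod>k\<in>UNIV - {j}. \<tau> k - \<tau> j) * (d * Z)"
      using z[of j] by (simp add: d1 prod.distrib \<tau>_def)
    have "(\<Sum>k\<in>UNIV - {j}. a k * (y k - y j * z k / z j)) = (\<Sum>k\<in>UNIV. a k * (y k - y j * z k / z j))"
      using z[of j] by (intro sum.mono_neutral_left) auto
    also have "\<dots> = t - \<tau> j * (\<Sum>k\<in>UNIV. a k * z k)"
      by (simp add: t_def \<tau>_def sum_subtractf right_diff_distrib sum_distrib_left sum_divide_distrib mult.assoc mult.left_commute)
    finally have "a' * (y j / z j) + (\<Sum>k\<in>UNIV - {j}. a k * (y k - y j * z k / z j)) = t - \<tau> j * l"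
      by (simp add: l_def \<tau>_def algebra_simps)
    then show ?thesis unfolding den by simp
  qed
  have "l ^ ?n / (d * Z) = t ^ ?n / (\<Prod>k\<in>UNIV. \<tau> k) / (d * Z) -
      (\<Sum>j\<in>UNIV. (t - \<tau> j * l) ^ ?n / (\<tau> j * (\<Prod>k\<in>UNIV - {j}. \<tau> k - \<tau> j)) / (d * Z))"
    unfolding e0[symmetric] e1 by (simp only: diff_divide_distrib sum_divide_distrib)
  then show ?thesis unfolding e2 e3 by (simp only: t_def l_def Z_def)
qed simp

subsection \<open>Determinants with respect to the frame\<close>

lemma frame_det_permute:
  assumes "\<pi> permutes UNIV"
  shows "frame_det e (b \<circ> \<pi>) = of_int (sign \<pi>) * frame_det e b"
  using det_permute_rows[OF assms, of "\<chi> i j. b i \<bullet> e j"] by (simp add: frame_det_def)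

text \<open>Cramer's rule; it also shows that a vanishing coordinate makes the exchanged family
  degenerate.\<close>

lemma frame_det_fun_upd:
  assumes "v = (\<Sum>k\<in>UNIV. c k *\<^sub>R b k)"
  shows "frame_det e (b(j := v)) = c j * frame_det e b"
proof -
  let ?A = "\<chi> i j. b i \<bullet> e j"
  have "(\<chi> i l. (b(j := v)) i \<bullet> e l) =
      (\<chi> i. if i = j then \<Sum>k\<in>UNIV. (\<chi> i. c i) $ k *s row k ?A else row i ?A)"
    by (simp add: vec_eq_iff row_def assms inner_sum_left)
  then show ?thesis
    using cramer_lemma_transpose[of j "\<chi> i. c i" ?A] by (simp add: frame_det_def)
qed

text \<open>A combination of the rows that vanishes gives a vector orthogonal to the whole frame,
  hence to itself.\<close>

lemma frame_det_nonzero: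
  assumes "orthonormal_frame e" "inj b" "independent (range b)"
  shows "frame_det e b \<noteq> 0"
proof -
  let ?A = "\<chi> i j. b i \<bullet> e j"
  have "c i = 0" if "(\<Sum>i\<in>UNIV. c i *s row i ?A) = 0" for c i
  proof -
    let ?v = "\<Sum>i\<in>UNIV. c i *\<^sub>R b i"
    have orth: "?v \<bullet> e j = 0" for j
      using that by (simp add: vec_eq_iff row_def inner_sum_left)
    have "?v \<bullet> x = 0" if "x \<in> span (range e)" for x
      using that by (induction rule: span_induct_alt) (auto simp: inner_add_right orth)
    then have "?v \<bullet> ?v = 0" using assms(1) unfolding orthonormal_frame_def by blast
    then have "?v = 0" by (simp only: inner_eq_zero_iff)
    moreover have "?v = (\<Sum>x\<in>range b. c (inv_into UNIV b x) *\<^sub>R x)"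
      using assms(2) by (simp add: sum.reindex)
    ultimately have "(\<Sum>x\<in>range b. c (inv_into UNIV b x) *\<^sub>R x) = 0" by simp
    from independentD[OF assms(3) _ subset_refl this, of "b i"]
    show ?thesis using assms(2) by simp
  qed
  then have "\<exists>B. ?A ** B = mat 1" by (simp only: matrix_right_invertible_independent_rows) blast
  then show ?thesis by (simp add: frame_det_def invertible_right_inverse flip: invertible_det_nz)
qed

text \<open>
  The summand of the integral attached to an ordered basis \<open>b\<close>, for a linear function taking the
  values \<open>a\<close> on \<open>b\<close>.  The coordinates of \<open>y\<close> are expressed through Cramer's rule, so that the
  summand only depends on \<open>b\<close>.
\<close>

definition basis_term :: "('n::finite \<Rightarrow> 'a::euclidean_space) \<Rightarrow> ('n \<Rightarrow> 'a) \<Rightarrow> ('n \<Rightarrow> real) \<Rightarrow> 'a \<Rightarrow> real"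
  where "basis_term e b a y =
    (\<Sum>k\<in>UNIV. a k * (frame_det e (b(k := y)) / frame_det e b)) ^ CARD('n) /
    (frame_det e b * (\<Prod>k\<in>UNIV. frame_det e (b(k := y)) / frame_det e b))"

lemma basis_term_eq:
  fixes a :: "'n::finite \<Rightarrow> real"
  assumes "y = (\<Sum>k\<in>UNIV. c k *\<^sub>R b k)" "frame_det e b \<noteq> 0"
  shows "basis_term e b a y =
    (\<Sum>k\<in>UNIV. a k * c k) ^ CARD('n) / (frame_det e b * (\<Prod>k\<in>UNIV. c k))"
  using assms(2) frame_det_fun_upd[OF assms(1), of e] by (simp add: basis_term_def)

text \<open>The summands on the left belong to the boundary of the simplex with vertices b and w.
  Their total does not involve the point v at which they are evaluated.\<close>

lemma basis_term_cone:
  fixes b :: "'n::finite \<Rightarrow> 'a::euclidean_space"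
  assumes det: "frame_det e b \<noteq> 0"
    and v: "v = (\<Sum>k\<in>UNIV. y k *\<^sub>R b k)" and w: "w = (\<Sum>k\<in>UNIV. z k *\<^sub>R b k)"
    and z: "\<And>j. z j \<noteq> 0" and y: "\<And>j. y j \<noteq> 0"
    and yz: "\<And>j k. j \<noteq> k \<Longrightarrow> y k * z j \<noteq> y j * z k"
  shows "basis_term e b a v - (\<Sum>j\<in>UNIV. basis_term e (b(j := w)) (a(j := a')) v) =
    ((\<Sum>k\<in>UNIV. a k * z k) - a') ^ CARD('n) / (frame_det e b * (\<Prod>k\<in>UNIV. z k))"
proof -
  have summand: "basis_term e (b(j := w)) (a(j := a')) v =
      (a' * (y j / z j) + (\<Sum>k\<in>UNIV - {j}. a k * (y k - y j * z k / z j))) ^ CARD('n) /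
      (z j * frame_det e b * (y j / z j * (\<Prod>k\<in>UNIV - {j}. y k - y j * z k / z j)))" for j
  proof -
    \<comment> \<open>Coordinates of v in the new basis, found by solving the expansion of w for
      \<open>b j\<close> and substituting.\<close>
    define c where "c k = (if k = j then y j / z j else y k - y j * z k / z j)" for k
    have det': "frame_det e (b(j := w)) = z j * frame_det e b"
      by (rule frame_det_fun_upd[OF w])
    have w': "w = z j *\<^sub>R b j + (\<Sum>k\<in>UNIV - {j}. z k *\<^sub>R b k)"
      unfolding w by (subst sum.remove[of _ j]) auto
    have "(\<Sum>k\<in>UNIV. c k *\<^sub>R (b(j := w)) k) =
        (y j / z j) *\<^sub>R w + (\<Sum>k\<in>UNIV - {j}. c k *\<^sub>R (b(j := w)) k)"
      by (subst sum.remove[of _ j]) (auto simp: c_def)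
    also have "(\<Sum>k\<in>UNIV - {j}. c k *\<^sub>R (b(j := w)) k) =
        (\<Sum>k\<in>UNIV - {j}. y k *\<^sub>R b k - (y j / z j) *\<^sub>R (z k *\<^sub>R b k))"
      by (intro sum.cong) (auto simp: c_def algebra_simps)
    also have "\<dots> = (\<Sum>k\<in>UNIV - {j}. y k *\<^sub>R b k) - (y j / z j) *\<^sub>R (\<Sum>k\<in>UNIV - {j}. z k *\<^sub>R b k)"
      by (simp add: sum_subtractf scaleR_sum_right)
    also have "(y j / z j) *\<^sub>R w + \<dots> = y j *\<^sub>R b j + (\<Sum>k\<in>UNIV - {j}. y k *\<^sub>R b k)"
      using z[of j] unfolding w' by (simp add: algebra_simps)
    also have "\<dots> = v" unfolding v by (subst (2) sum.remove[of _ j]) auto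
    finally have "basis_term e (b(j := w)) (a(j := a')) v =
        (\<Sum>k\<in>UNIV. (a(j := a')) k * c k) ^ CARD('n) /
        (z j * frame_det e b * (\<Prod>k\<in>UNIV. c k))"
      using basis_term_eq[of v c "b(j := w)" e "a(j := a')"] det z[of j] unfolding det'
      by (simp del: fun_upd_apply)
    also have "(\<Sum>k\<in>UNIV. (a(j := a')) k * c k) =
        a' * (y j / z j) + (\<Sum>k\<in>UNIV - {j}. a k * (y k - y j * z k / z j))"
      by (subst sum.remove[of _ j]) (auto simp: c_def intro!: sum.cong)
    also have "(\<Prod>k\<in>UNIV. c k) = y j / z j * (\<Prod>k\<in>UNIV - {j}. y k - y j * z k / z j)"
      by (subst prod.remove[of _ j]) (auto simp: c_def intro!: prod.cong)
    finally show ?thesis .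
  qed
  show ?thesis
    unfolding basis_term_eq[OF v det] summand by (rule cone_identity; fact)
qed

subsection \<open>Dual bases and orderings\<close>

text \<open>A finite union of hyperplanes is negligible. All genericity conditions below are stated
  as non-orthogonality to finitely many nonzero vectors.\<close>

lemma exists_nonorthogonal:
  fixes N :: "'a::euclidean_space set"
  assumes "finite N" "0 \<notin> N"
  shows "\<exists>y. \<forall>v\<in>N. v \<bullet> y \<noteq> 0"
proof -
  have "negligible (\<Union>v\<in>N. {x. v \<bullet> x = 0})"
  proof (rule negligible_Union)
    show "finite ((\<lambda>v. {x. v \<bullet> x = 0}) ` N)" using assms(1) by simp
    fix T assume "T \<in> (\<lambda>v. {x. v \<bullet> x = 0}) ` N"
    then obtain v where "v \<in> N" "T = {x. v \<bullet> x = 0}" by blast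
    moreover have "v \<noteq> 0" using assms(2) \<open>v \<in> N\<close> by metis
    ultimately show "negligible T" by (simp add: negligible_hyperplane)
  qed
  then have "(\<Union>v\<in>N. {x. v \<bullet> x = 0}) \<noteq> UNIV" using non_negligible_UNIV by metis
  then obtain y where "y \<notin> (\<Union>v\<in>N. {x. v \<bullet> x = 0})" by blast
  then show ?thesis by (intro exI[of _ y]) simp
qed

text \<open>Existence comes from the linear functional with the prescribed values, represented by
  its adjoint at 1; uniqueness holds because the \<open>lam j\<close> span.\<close>

lemma dual_vec_inner:
  assumes "basis_family lam I" "j \<in> I"
  shows "dual_vec lam I i \<bullet> lam j = (if j = i then 1 else 0)"
proof -
  let ?P = "\<lambda>u. \<forall>j\<in>I. u \<bullet> lam j = (if j = i then 1 else 0)"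
  have inj: "inj_on lam I" and ind: "independent (lam ` I)" and span: "span (lam ` I) = UNIV"
    using assms(1) by (simp_all add: basis_family_def lin_indep_family_def)
  obtain g :: "'b \<Rightarrow> real" where g: "linear g"
      "\<forall>x\<in>lam ` I. g x = (if inv_into I lam x = i then 1 else 0)"
    using linear_independent_extend[OF ind, of "\<lambda>x. if inv_into I lam x = i then 1 else (0::real)"]
    by blast
  have adj: "adjoint g 1 \<bullet> y = g y" for y
    using adjoint_works[OF g(1), of y 1] by (simp add: inner_commute)
  have ex: "?P (adjoint g 1)" using g(2) inj by (simp add: adj)
  have "v = adjoint g 1" if v: "?P v" for v
  proof -
    have 0: "(v - adjoint g 1) \<bullet> x = 0" if "x \<in> lam ` I" for x
      using that v ex by (auto simp: inner_diff_left)
    have "(v - adjoint g 1) \<bullet> x = 0" if "x \<in> span (lam ` I)" for x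
      using that by (induction rule: span_induct_alt) (simp_all add: inner_add_right 0)
    then have "(v - adjoint g 1) \<bullet> (v - adjoint g 1) = 0" unfolding span by (simp only: UNIV_I)
    then show ?thesis by (simp only: inner_eq_zero_iff right_minus_eq)
  qed
  then have "?P (dual_vec lam I i)" unfolding dual_vec_def
    using ex by (rule_tac theI[where P = ?P]) blast+
  then show ?thesis using assms(2) by blast
qed

lemma dual_vec_expansion:
  assumes "basis_family lam I" "finite I"
  shows "y = (\<Sum>i\<in>I. (dual_vec lam I i \<bullet> y) *\<^sub>R lam i)"
proof -
  have inj: "inj_on lam I" and span: "span (lam ` I) = UNIV"
    using assms(1) by (simp_all add: basis_family_def lin_indep_family_def)
  have "y \<in> span (lam ` I)" by (simp add: span)
  then obtain r where "y = (\<Sum>x\<in>lam ` I. r x *\<^sub>R x)"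
    using assms(2) by (auto simp: span_finite)
  then have y: "y = (\<Sum>j\<in>I. r (lam j) *\<^sub>R lam j)" by (simp add: sum.reindex[OF inj])
  have "dual_vec lam I i \<bullet> y = r (lam i)" if "i \<in> I" for i
  proof -
    have "dual_vec lam I i \<bullet> y = (\<Sum>j\<in>I. r (lam j) * (dual_vec lam I i \<bullet> lam j))"
      unfolding y by (simp add: inner_sum_right)
    also have "\<dots> = (\<Sum>j\<in>I. if j = i then r (lam i) else 0)"
      by (intro sum.cong) (auto simp: dual_vec_inner[OF assms(1)])
    finally show ?thesis using that assms(2) by simp
  qed
  then show ?thesis by (subst y) (simp cong: sum.cong)
qed

lemma dual_vec_nonzero: "basis_family lam I \<Longrightarrow> i \<in> I \<Longrightarrow> dual_vec lam I i \<noteq> 0"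
  using dual_vec_inner[of lam I i i] by auto

section \<open>Orderings of simplices\<close>

lemma ordering_iff: "ordering f I \<longleftrightarrow> inj f \<and> range f = I"
  by (simp add: ordering_def bij_betw_def)

text \<open>Sums over maximal simplices are replaced by sums over all of their orderings, each
  simplex counting n! times. Signs and boundaries then need no preferred order.\<close>

definition orderings :: "'v set set \<Rightarrow> ('n::finite \<Rightarrow> 'v) set" where
  "orderings F = {f. inj f \<and> range f \<in> F}"

lemma finite_orderings:
  assumes "finite F" "\<And>I. I \<in> F \<Longrightarrow> finite I"
  shows "finite (orderings F :: ('n::finite \<Rightarrow> 'v) set)"
proof (rule finite_subset)
  show "(orderings F :: ('n \<Rightarrow> 'v) set) \<subseteq> PiE UNIV (\<lambda>_. \<Union>F)"
    unfolding orderings_def by auto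
  show "finite (PiE (UNIV :: 'n set) (\<lambda>_. \<Union>F))"
    using assms by (intro finite_PiE) auto
qed

lemma ordering_exists:
  assumes "finite I" "card I = CARD('n::finite)"
  obtains f :: "'n::finite \<Rightarrow> 'v" where "inj f" "range f = I"
  using finite_same_card_bij[of "UNIV :: 'n set" I] assms by (auto simp: bij_betw_def)

lemma orderings_differ_by_permutation:
  fixes f g :: "'n::finite \<Rightarrow> 'v"
  assumes "inj f" "inj g" "range f = range g"
  obtains \<pi> where "\<pi> permutes UNIV" "g = f \<circ> \<pi>"
proof
  let ?\<pi> = "inv_into UNIV f \<circ> g"
  show "g = f \<circ> ?\<pi>" using assms by (auto simp: fun_eq_iff f_inv_into_f)
  have "inj ?\<pi>" using assms by (auto intro!: comp_inj_on inj_on_inv_into)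
  then have "bij ?\<pi>" by (intro bijI finite_UNIV_inj_surj) simp_all
  then show "?\<pi> permutes UNIV" by (intro bij_imp_permutes) simp_all
qed

lemma card_orderings:
  assumes "finite I" "card I = CARD('n::finite)"
  shows "card {f :: 'n \<Rightarrow> 'v. inj f \<and> range f = I} = fact CARD('n)"
proof -
  obtain f :: "'n \<Rightarrow> 'v" where f: "inj f" "range f = I" by (rule ordering_exists[OF assms])
  have "{f :: 'n \<Rightarrow> 'v. inj f \<and> range f = I} = (\<lambda>\<pi>. f \<circ> \<pi>) ` {\<pi>. \<pi> permutes UNIV}"
  proof
    show "{f :: 'n \<Rightarrow> 'v. inj f \<and> range f = I} \<subseteq> (\<lambda>\<pi>. f \<circ> \<pi>) ` {\<pi>. \<pi> permutes UNIV}"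
    proof
      fix g :: "'n \<Rightarrow> 'v" assume "g \<in> {f. inj f \<and> range f = I}"
      then obtain \<pi> where "\<pi> permutes UNIV" "g = f \<circ> \<pi>"
        using orderings_differ_by_permutation[of f g] f by auto
      then show "g \<in> (\<lambda>\<pi>. f \<circ> \<pi>) ` {\<pi>. \<pi> permutes UNIV}" by simp
    qed
    show "(\<lambda>\<pi>. f \<circ> \<pi>) ` {\<pi>. \<pi> permutes UNIV} \<subseteq> {f :: 'n \<Rightarrow> 'v. inj f \<and> range f = I}"
    proof
      fix g assume "g \<in> (\<lambda>\<pi>. f \<circ> \<pi>) ` {\<pi>. \<pi> permutes UNIV}"
      then obtain \<pi> where "\<pi> permutes UNIV" "g = f \<circ> \<pi>" by blast
      then have "bij \<pi>" "g = f \<circ> \<pi>" by (simp_all add: permutes_bij)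
      then have "inj g" "range g = range f"
        using f(1) by (auto simp: bij_def intro: inj_compose) (metis image_comp rangeI surjE)+
      then show "g \<in> {f :: 'n \<Rightarrow> 'v. inj f \<and> range f = I}" using f(2) by simp
    qed
  qed
  moreover have "inj_on (\<lambda>\<pi>. f \<circ> \<pi>) {\<pi>. \<pi> permutes UNIV}"
    using f(1) by (intro inj_onI) (auto simp: fun_eq_iff inj_eq)
  ultimately show ?thesis
    by (simp add: card_image card_permutations[OF refl])
qed

lemma sum_orderings:
  fixes G :: "('n::finite \<Rightarrow> 'v) \<Rightarrow> real"
  assumes "finite F" "\<And>I. I \<in> F \<Longrightarrow> finite I \<and> card I = CARD('n)"
    and "\<And>f. f \<in> orderings F \<Longrightarrow> G f = H (range f)"
  shows "(\<Sum>f\<in>orderings F. G f) = fact CARD('n) * (\<Sum>I\<in>F. H I)"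
proof -
  have "(\<Sum>f\<in>orderings F. G f) = (\<Sum>I\<in>F. \<Sum>f\<in>{f \<in> orderings F. range f = I}. G f)"
    using assms(1,2) by (intro sum.group[symmetric] finite_orderings) (auto simp: orderings_def)
  also have "\<dots> = (\<Sum>I\<in>F. fact CARD('n) * H I)"
  proof (rule sum.cong)
    fix I assume I: "I \<in> F"
    then have "{f \<in> orderings F. range f = I} = {f :: 'n \<Rightarrow> 'v. inj f \<and> range f = I}"
      by (auto simp: orderings_def)
    moreover have "(\<Sum>f\<in>{f \<in> orderings F. range f = I}. G f) =
        (\<Sum>f\<in>{f :: 'n \<Rightarrow> 'v. f \<in> orderings F \<and> range f = I}. H I)"
      using assms(3) by (intro sum.cong) auto
    ultimately show "(\<Sum>f\<in>{f \<in> orderings F. range f = I}. G f) = fact CARD('n) * H I"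
      using card_orderings[where 'n = 'n, of I] assms(2)[OF I] by simp
  qed simp
  finally show ?thesis by (simp add: sum_distrib_left)
qed

subsection \<open>The integral of a multi-fan\<close>

locale multi_fan =
  fixes e :: "'n::finite \<Rightarrow> 'a::euclidean_space" and K :: "'v set set"
    and \<epsilon> :: "('n \<Rightarrow> 'v) \<Rightarrow> int" and lam :: "'v \<Rightarrow> 'a"
  assumes frame: "orthonormal_frame e" and data: "multifan_data K \<epsilon> lam"
begin

abbreviation w :: "'v set \<Rightarrow> int" where "w \<equiv> weight e K \<epsilon> lam"
abbreviation crd :: "'v set \<Rightarrow> 'v \<Rightarrow> 'a \<Rightarrow> real" where
  "crd I i y \<equiv> dual_vec lam I i \<bullet> y"

lemma complex: "simplicial_complex K" "pure CARD('n) K" "orients_facets K \<epsilon>" "is_cycle K \<epsilon>"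
  using data by (simp_all add: multifan_data_def oriented_pseudomanifold_def pseudomanifold_def)

lemma finite_F: "finite (facets CARD('n) K)"
  using complex(1) by (simp add: simplicial_complex_def facets_def)

lemma finite_vertices: "finite (\<Union>K)"
  using complex(1) by (auto simp: simplicial_complex_def)

lemma facet: "I \<in> facets CARD('n) K \<Longrightarrow> finite I \<and> card I = CARD('n)"
  using complex(1) by (simp add: simplicial_complex_def facets_def)

lemma facet_subset_vertices: "I \<in> facets CARD('n) K \<Longrightarrow> I \<subseteq> \<Union>K"
  by (auto simp: facets_def)

lemma facet_basis: "I \<in> facets CARD('n) K \<Longrightarrow> basis_family lam I"
  using data by (simp add: multifan_data_def)

lemma facet_exists: obtains I where "I \<in> facets CARD('n) K"
proof -
  have "{} \<in> K" using complex(1) by (simp add: simplicial_complex_def)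
  then show thesis using complex(2) that unfolding pure_def by meson
qed

lemma face_subset: "\<tau> \<in> K \<Longrightarrow> \<sigma> \<subseteq> \<tau> \<Longrightarrow> \<sigma> \<in> K"
  using complex(1) by (simp add: simplicial_complex_def)

lemma finite_orderings_F: "finite (orderings (facets CARD('n) K) :: ('n \<Rightarrow> 'v) set)"
  using finite_F facet by (intro finite_orderings) auto

lemma sign_values:
  assumes "f \<in> orderings (facets CARD('n) K)"
  shows "\<epsilon> f \<in> {1, -1}" and "\<pi> permutes UNIV \<Longrightarrow> \<epsilon> (f \<circ> \<pi>) = sign \<pi> * \<epsilon> f"
proof -
  have "range f \<in> facets CARD('n) K" "ordering f (range f)" using assms by (simp_all add: orderings_def ordering_iff)
  then have *: "\<epsilon> f \<in> {1, -1} \<and> (\<forall>\<pi>. \<pi> permutes UNIV \<longrightarrow> \<epsilon> (f \<circ> \<pi>) = sign \<pi> * \<epsilon> f)"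
    using complex(3) unfolding orients_facets_def by blast
  show "\<epsilon> f \<in> {1, -1}" using * by (rule conjunct1)
  show "\<pi> permutes UNIV \<Longrightarrow> \<epsilon> (f \<circ> \<pi>) = sign \<pi> * \<epsilon> f" using * by simp
qed

lemma ordering_basis:
  assumes "f \<in> orderings (facets CARD('n) K)"
  shows "frame_det e (lam \<circ> f) \<noteq> 0"
    and "y = (\<Sum>k\<in>UNIV. crd (range f) (f k) y *\<^sub>R (lam \<circ> f) k)"
proof -
  have f: "inj f" "range f \<in> facets CARD('n) K" using assms by (simp_all add: orderings_def)
  have b: "basis_family lam (range f)" using f(2) by (rule facet_basis)
  then have "inj (lam \<circ> f)" "independent (range (lam \<circ> f))"
    using f(1) by (simp_all add: basis_family_def lin_indep_family_def comp_inj_on image_comp)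
  then show "frame_det e (lam \<circ> f) \<noteq> 0" by (rule frame_det_nonzero[OF frame])
  have "y = (\<Sum>i\<in>range f. crd (range f) i y *\<^sub>R lam i)"
    using f(2) facet by (intro dual_vec_expansion[OF b]) blast
  also have "\<dots> = (\<Sum>k\<in>UNIV. crd (range f) (f k) y *\<^sub>R (lam \<circ> f) k)"
    using f(1) by (simp add: sum.reindex)
  finally show "y = (\<Sum>k\<in>UNIV. crd (range f) (f k) y *\<^sub>R (lam \<circ> f) k)" .
qed

lemma abs_det_ordering:
  fixes f :: "'n \<Rightarrow> 'v"
  assumes "inj f" "range f = I"
  shows "abs_det e lam I = \<bar>frame_det e (lam \<circ> f)\<bar>"
  unfolding abs_det_def
proof (rule the_equality)
  show "\<forall>g. ordering (g :: 'n \<Rightarrow> 'v) I \<longrightarrow> \<bar>frame_det e (lam \<circ> f)\<bar> = \<bar>frame_det e (lam \<circ> g)\<bar>"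
  proof (intro allI impI)
    fix g assume "ordering (g :: 'n \<Rightarrow> 'v) I"
    then obtain \<pi> where \<pi>: "\<pi> permutes UNIV" "g = f \<circ> \<pi>"
      using orderings_differ_by_permutation[of f g] assms by (auto simp: ordering_iff)
    then have "frame_det e (lam \<circ> g) = of_int (sign \<pi>) * frame_det e (lam \<circ> f)"
      using frame_det_permute[OF \<pi>(1), of e "lam \<circ> f"] by (simp add: comp_assoc)
    then show "\<bar>frame_det e (lam \<circ> f)\<bar> = \<bar>frame_det e (lam \<circ> g)\<bar>"
      by (simp add: abs_mult sign_def)
  qed
next
  fix d assume "\<forall>g. ordering (g :: 'n \<Rightarrow> 'v) I \<longrightarrow> d = \<bar>frame_det e (lam \<circ> g)\<bar>"
  then show "d = \<bar>frame_det e (lam \<circ> f)\<bar>" using assms by (simp add: ordering_iff)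
qed

text \<open>A permutation changes the sign of the ordering and that of the determinant together, so
  one ordering decides the comparison for all of them.\<close>

lemma weight_facet:
  assumes "f \<in> orderings (facets CARD('n) K)"
  shows "w (range f) = \<epsilon> f * (if frame_det e (lam \<circ> f) > 0 then 1 else - 1)"
proof -
  have f: "inj f" "range f \<in> facets CARD('n) K" using assms by (simp_all add: orderings_def)
  let ?d = "frame_det e (lam \<circ> f)"
  have "(\<epsilon> g = 1 \<longleftrightarrow> positive_basis e (lam \<circ> g)) \<longleftrightarrow> (\<epsilon> f = 1 \<longleftrightarrow> ?d > 0)"
    if "ordering g (range f)" for g
  proof -
    have "inj g" "range f = range g" using that by (simp_all add: ordering_iff)
    from orderings_differ_by_permutation[OF f(1) this]
    obtain \<pi> where \<pi>: "\<pi> permutes UNIV" "g = f \<circ> \<pi>" .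
    have "frame_det e (lam \<circ> g) = of_int (sign \<pi>) * ?d" "\<epsilon> g = sign \<pi> * \<epsilon> f"
      using frame_det_permute[OF \<pi>(1), of e "lam \<circ> f"] sign_values(2)[OF assms \<pi>(1)] \<pi>(2)
      by (simp_all add: comp_assoc)
    then show ?thesis
      using ordering_basis(1)[OF assms] sign_values(1)[OF assms]
      by (cases "evenperm \<pi>") (auto simp: sign_def positive_basis_def)
  qed
  moreover have "ordering f (range f)" using f(1) by (simp add: ordering_iff)
  ultimately have "(\<forall>g. ordering g (range f) \<longrightarrow> (\<epsilon> g = 1 \<longleftrightarrow> positive_basis e (lam \<circ> g))) \<longleftrightarrow>
      (\<epsilon> f = 1 \<longleftrightarrow> ?d > 0)" by blast
  then have "w (range f) = (if \<epsilon> f = 1 \<longleftrightarrow> ?d > 0 then 1 else - 1)"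
    using f(2) by (simp add: weight_def)
  then show ?thesis using sign_values(1)[OF assms] by auto
qed

lemma weight_nonzero_iff: "w I \<noteq> 0 \<longleftrightarrow> I \<in> facets CARD('n) K"
  by (simp add: weight_def)

definition summand :: "('v \<Rightarrow> real) \<Rightarrow> 'a \<Rightarrow> 'v set \<Rightarrow> real" where
  "summand c y I = of_int (w I) * (\<Sum>i\<in>I. c i * crd I i y) ^ CARD('n) /
     (abs_det e lam I * (\<Prod>i\<in>I. crd I i y))"

text \<open>The sign of the determinant in the weight cancels against the absolute value in the
  denominator, leaving the signed determinant of \<open>basis_term\<close>.\<close>

lemma summand_ordering:
  assumes "f \<in> orderings (facets CARD('n) K)"
  shows "of_int (\<epsilon> f) * basis_term e (lam \<circ> f) (c \<circ> f) y = summand c y (range f)"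
proof -
  have f: "inj f" using assms by (simp add: orderings_def)
  let ?d = "frame_det e (lam \<circ> f)"
  have "basis_term e (lam \<circ> f) (c \<circ> f) y =
      (\<Sum>k\<in>UNIV. c (f k) * crd (range f) (f k) y) ^ CARD('n) /
      (?d * (\<Prod>k\<in>UNIV. crd (range f) (f k) y))"
    using basis_term_eq[OF ordering_basis(2)[OF assms] ordering_basis(1)[OF assms], where a = "c \<circ> f"]
    by simp
  also have "\<dots> = (\<Sum>i\<in>range f. c i * crd (range f) i y) ^ CARD('n) /
      (?d * (\<Prod>i\<in>range f. crd (range f) i y))"
    by (simp add: sum.reindex[OF f] prod.reindex[OF f])
  finally show ?thesis
    using ordering_basis(1)[OF assms]
    by (auto simp: summand_def weight_facet[OF assms] abs_det_ordering[OF f refl])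
qed

text \<open>At a generic point this is (n!)^2 times the value of the volume polynomial at c: one
  factorial counts the orderings, the other undoes the normalisation of the volume.\<close>

definition chain_sum :: "('v \<Rightarrow> real) \<Rightarrow> 'a \<Rightarrow> real" where
  "chain_sum c y = (\<Sum>f\<in>orderings (facets CARD('n) K). of_int (\<epsilon> f) * basis_term e (lam \<circ> f) (c \<circ> f) y)"

lemma chain_sum_eq: "chain_sum c y = fact CARD('n) * (\<Sum>I\<in>facets CARD('n) K. summand c y I)"
  unfolding chain_sum_def by (rule sum_orderings) (simp_all add: finite_F facet summand_ordering)

text \<open>Orderings are grouped by their entries away from j. On each group h is constant, and the
  signs add up to zero by the cycle condition at the corresponding ridge.\<close>

lemma cycle_sum:
  fixes h :: "('n \<Rightarrow> 'v) \<Rightarrow> real"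
  assumes "\<And>f v. h (f(j := v)) = h f"
  shows "(\<Sum>f\<in>orderings (facets CARD('n) K). of_int (\<epsilon> f) * h f) = 0"
proof -
  \<comment> \<open>Overwriting entry j with a fixed value forgets it; the value itself is
    irrelevant.\<close>
  let ?r = "\<lambda>f :: 'n \<Rightarrow> 'v. f(j := undefined)" and ?O = "orderings (facets CARD('n) K) :: ('n \<Rightarrow> 'v) set"
  have "(\<Sum>f\<in>?O. of_int (\<epsilon> f) * h f) =
      (\<Sum>g\<in>?r ` ?O. \<Sum>f\<in>{f \<in> ?O. ?r f = g}. of_int (\<epsilon> f) * h f)"
    by (rule sum.image_gen[OF finite_orderings_F])
  also have "\<dots> = 0"
  proof (rule sum.neutral, rule ballI)
    fix g assume "g \<in> ?r ` ?O"
    then obtain f0 where f0: "f0 \<in> ?O" "g = ?r f0" by blast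
    let ?A = "{v. \<exists>I\<in>facets CARD('n) K. ordering (f0(j := v)) I}"
    have A: "v \<in> ?A \<longleftrightarrow> f0(j := v) \<in> ?O" for v
      by (simp add: orderings_def ordering_iff)
    have fib: "{f \<in> ?O. ?r f = g} = (\<lambda>v. f0(j := v)) ` ?A"
    proof
      show "{f \<in> ?O. ?r f = g} \<subseteq> (\<lambda>v. f0(j := v)) ` ?A"
      proof
        fix f assume "f \<in> {f \<in> ?O. ?r f = g}"
        then have f: "f \<in> ?O" "?r f = ?r f0" using f0 by simp_all
        have "f = f0(j := f j)"
        proof
          fix k show "f k = (f0(j := f j)) k" using fun_cong[OF f(2), of k] by (cases "k = j") auto
        qed
        moreover have "f j \<in> ?A" unfolding A using f(1) calculation by simp
        ultimately show "f \<in> (\<lambda>v. f0(j := v)) ` ?A" by (rule image_eqI)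
      qed
      show "(\<lambda>v. f0(j := v)) ` ?A \<subseteq> {f \<in> ?O. ?r f = g}"
        using f0(2) A by auto
    qed
    have inj: "inj_on (\<lambda>v. f0(j := v)) ?A"
      by (rule inj_onI) (metis fun_upd_same)
    have "(\<Sum>f\<in>{f \<in> ?O. ?r f = g}. of_int (\<epsilon> f) * h f) = (\<Sum>v\<in>?A. of_int (\<epsilon> (f0(j := v))) * h f0)"
      unfolding fib by (simp add: sum.reindex[OF inj] assms del: fun_upd_apply)
    also have "\<dots> = of_int (\<Sum>v\<in>?A. \<epsilon> (f0(j := v))) * h f0"
      by (simp add: sum_distrib_right del: fun_upd_apply)
    also have "(\<Sum>v\<in>?A. \<epsilon> (f0(j := v))) = 0"
    proof -
      have "inj_on f0 (- {j})" using f0(1) by (auto simp: orderings_def intro: inj_on_subset)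
      moreover have "range f0 \<in> K" using f0(1) by (simp add: orderings_def facets_def)
      then have "f0 ` (- {j}) \<in> K" by (rule face_subset) (rule image_mono, simp)
      ultimately have "inj_on f0 (- {j}) \<and> f0 ` (- {j}) \<in> K" by (rule conjI)
      with complex(4)[unfolded is_cycle_def, THEN spec, THEN spec] show ?thesis by (rule mp)
    qed
    finally show "(\<Sum>f\<in>{f \<in> ?O. ?r f = g}. of_int (\<epsilon> f) * h f) = 0"
      by (simp del: fun_upd_apply)
  qed
  finally show ?thesis .
qed

section \<open>Generic points and the constancy of the integral\<close>

definition generic :: "'a \<Rightarrow> bool" where
  "generic y \<longleftrightarrow> (\<forall>I\<in>facets CARD('n) K. \<forall>i\<in>I. crd I i y \<noteq> 0)"

definition normals :: "'a set" where
  "normals = (\<Union>I\<in>facets CARD('n) K. dual_vec lam I ` I)"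

lemma normals: "finite normals" "0 \<notin> normals" "generic y \<longleftrightarrow> (\<forall>v\<in>normals. v \<bullet> y \<noteq> 0)"
proof -
  show "finite normals" unfolding normals_def using finite_F facet by blast
  show "0 \<notin> normals"
  proof
    assume "0 \<in> normals"
    then obtain I i where "I \<in> facets CARD('n) K" "i \<in> I" "0 = dual_vec lam I i"
      unfolding normals_def by blast
    then show False using dual_vec_nonzero[OF facet_basis] by metis
  qed
qed (auto simp: normals_def generic_def)

lemma generic_exists: obtains y where "generic y"
  using exists_nonorthogonal[OF normals(1,2)] normals(3) by metis

text \<open>
  Coning off the cycle \<open>K\<close> from a generic vector \<open>z\<close> expresses the integral over \<open>K\<close> by integrals
  over boundaries of simplices, which do not depend on \<open>y\<close>.
\<close>

lemma chain_sum_constant: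
  assumes "generic y1" "generic y2"
  shows "chain_sum c y1 = chain_sum c y2"
proof -
  \<comment> \<open>An apex z is not orthogonal to these vectors iff the ratios of the coordinates
    of y and z are pairwise distinct, as the cone identity demands.\<close>
  define N where "N y = (\<Union>I\<in>facets CARD('n) K. \<Union>i\<in>I. (\<lambda>k. crd I k y *\<^sub>R dual_vec lam I i - crd I i y *\<^sub>R dual_vec lam I k) ` (I - {i}))" for y
  have "finite (N y)" for y
    unfolding N_def by (intro finite_UN_I finite_F finite_imageI finite_Diff) (simp_all add: facet)
  moreover have "0 \<notin> N y" if "generic y" for y
  proof
    assume "0 \<in> N y"
    then obtain I i k where I: "I \<in> facets CARD('n) K" "i \<in> I" "k \<in> I - {i}"
      "0 = crd I k y *\<^sub>R dual_vec lam I i - crd I i y *\<^sub>R dual_vec lam I k"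
      unfolding N_def by blast
    from arg_cong[OF I(4), of "\<lambda>v. v \<bullet> lam i"]
    have "crd I k y * (dual_vec lam I i \<bullet> lam i) - crd I i y * (dual_vec lam I k \<bullet> lam i) = 0"
      by (simp add: inner_diff_left)
    moreover have "dual_vec lam I i \<bullet> lam i = 1" "dual_vec lam I k \<bullet> lam i = 0"
      using dual_vec_inner[OF facet_basis[OF I(1)] I(2), of i] I(3)
        dual_vec_inner[OF facet_basis[OF I(1)] I(2), of k] by auto
    ultimately have "crd I k y = 0" by simp
    then show False using that I(1,3) by (auto simp: generic_def)
  qed
  ultimately have "finite (normals \<union> N y1 \<union> N y2)" "0 \<notin> normals \<union> N y1 \<union> N y2"
    using normals(1,2) assms by auto
  \<comment> \<open>A single apex serves both points, so both sums are compared with the same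
    expression in z.\<close>
  from exists_nonorthogonal[OF this] obtain z where
    z: "\<forall>v\<in>normals \<union> N y1 \<union> N y2. v \<bullet> z \<noteq> 0" by blast
  then have z_gen: "generic z" using normals(3) by simp
  have cone: "chain_sum c y = (\<Sum>f\<in>orderings (facets CARD('n) K). of_int (\<epsilon> f) *
      ((\<Sum>k\<in>UNIV. c (f k) * crd (range f) (f k) z) ^ CARD('n) /
        (frame_det e (lam \<circ> f) * (\<Prod>k\<in>UNIV. crd (range f) (f k) z))))"
    if y: "generic y" "\<forall>v\<in>N y. v \<bullet> z \<noteq> 0" for y
  proof -
    \<comment> \<open>The value 0 of the linear function at the apex is an arbitrary choice, the
      same for all simplices.\<close>
    let ?h = "\<lambda>j f. basis_term e ((lam \<circ> f)(j := z)) ((c \<circ> f)(j := 0)) y"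
    have cone_f: "basis_term e (lam \<circ> f) (c \<circ> f) y - (\<Sum>j\<in>UNIV. ?h j f) =
        ((\<Sum>k\<in>UNIV. (c \<circ> f) k * crd (range f) (f k) z) - 0) ^ CARD('n) /
        (frame_det e (lam \<circ> f) * (\<Prod>k\<in>UNIV. crd (range f) (f k) z))"
      if f: "f \<in> orderings (facets CARD('n) K)" for f
    proof (rule basis_term_cone)
      show "frame_det e (lam \<circ> f) \<noteq> 0" by (rule ordering_basis(1)[OF f])
      show "y = (\<Sum>k\<in>UNIV. crd (range f) (f k) y *\<^sub>R (lam \<circ> f) k)"
        "z = (\<Sum>k\<in>UNIV. crd (range f) (f k) z *\<^sub>R (lam \<circ> f) k)"
        by (rule ordering_basis(2)[OF f])+
      have I: "range f \<in> facets CARD('n) K" "inj f" using f by (simp_all add: orderings_def)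
      show "crd (range f) (f j) y \<noteq> 0" "crd (range f) (f j) z \<noteq> 0" for j
        using I(1) y(1) z_gen by (simp_all add: generic_def)
      fix j k :: 'n assume "j \<noteq> k"
      then have "f k \<in> range f - {f j}" using I(2) by (auto simp: inj_eq)
      then have "crd (range f) (f k) y *\<^sub>R dual_vec lam (range f) (f j) -
          crd (range f) (f j) y *\<^sub>R dual_vec lam (range f) (f k) \<in> N y"
        unfolding N_def by (intro UN_I[OF I(1)] UN_I[of "f j"] imageI) simp_all
      note bspec[OF y(2) this]
      then show "crd (range f) (f k) y * crd (range f) (f j) z \<noteq>
          crd (range f) (f j) y * crd (range f) (f k) z"
        by (simp add: inner_diff_left)
    qed
    have split: "of_int (\<epsilon> f) * basis_term e (lam \<circ> f) (c \<circ> f) y = of_int (\<epsilon> f) *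
        ((\<Sum>k\<in>UNIV. c (f k) * crd (range f) (f k) z) ^ CARD('n) /
        (frame_det e (lam \<circ> f) * (\<Prod>k\<in>UNIV. crd (range f) (f k) z))) +
        of_int (\<epsilon> f) * (\<Sum>j\<in>UNIV. ?h j f)"
      if "f \<in> orderings (facets CARD('n) K)" for f
    proof -
      have "basis_term e (lam \<circ> f) (c \<circ> f) y =
          (\<Sum>k\<in>UNIV. c (f k) * crd (range f) (f k) z) ^ CARD('n) /
          (frame_det e (lam \<circ> f) * (\<Prod>k\<in>UNIV. crd (range f) (f k) z)) + (\<Sum>j\<in>UNIV. ?h j f)"
        using cone_f[OF that] by (simp only: comp_apply diff_0_right diff_eq_eq)
      then show ?thesis by (simp only: distrib_left)
    qed
    have "chain_sum c y = (\<Sum>f\<in>orderings (facets CARD('n) K). of_int (\<epsilon> f) *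
      ((\<Sum>k\<in>UNIV. c (f k) * crd (range f) (f k) z) ^ CARD('n) /
        (frame_det e (lam \<circ> f) * (\<Prod>k\<in>UNIV. crd (range f) (f k) z)))) +
      (\<Sum>f\<in>orderings (facets CARD('n) K). of_int (\<epsilon> f) * (\<Sum>j\<in>UNIV. ?h j f))"
      unfolding chain_sum_def sum.distrib[symmetric] by (rule sum.cong, rule refl, erule split)
    also have "(\<Sum>f\<in>orderings (facets CARD('n) K). of_int (\<epsilon> f) * (\<Sum>j\<in>UNIV. ?h j f)) =
        (\<Sum>j\<in>UNIV. \<Sum>f\<in>orderings (facets CARD('n) K). of_int (\<epsilon> f) * ?h j f)"
      unfolding sum_distrib_left by (rule sum.swap)
    also have "\<dots> = (\<Sum>j\<in>(UNIV :: 'n set). 0)"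
    proof (rule sum.cong)
      fix j :: 'n
      \<comment> \<open>Entry j is overwritten by the apex, so the term depends only on the ridge
        and cancels over the cycle.\<close>
      have inv: "?h j (f(j := v)) = ?h j f" for f v
        by (simp only: fun_upd_comp fun_upd_upd)
      show "(\<Sum>f\<in>orderings (facets CARD('n) K). of_int (\<epsilon> f) * ?h j f) = 0"
        by (rule cycle_sum[where j = j and h = "?h j"]) (rule inv)
    qed simp
    also have "\<dots> = 0" by simp
    finally show ?thesis by (simp only: add_0_right)
  qed
  have "\<forall>v\<in>N y1. v \<bullet> z \<noteq> 0" "\<forall>v\<in>N y2. v \<bullet> z \<noteq> 0" using z by blast+
  then show ?thesis by (simp only: cone[OF assms(1)] cone[OF assms(2)])
qed

lemma sum_summands_constant:
  assumes "generic y1" "generic y2"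
  shows "(\<Sum>I\<in>facets CARD('n) K. summand c y1 I) = (\<Sum>I\<in>facets CARD('n) K. summand c y2 I)"
  using chain_sum_constant[OF assms, of c] by (simp add: chain_sum_eq)

lemma iota_power:
  assumes "I \<in> facets CARD('n) K"
  shows "iota lam I ((\<Sum>i\<in>\<Union>K. rconst (c i) * rvar i) ^ CARD('n)) y =
    (\<Sum>i\<in>I. c i * crd I i y) ^ CARD('n)"
proof -
  have "(\<Sum>i\<in>\<Union>K. c i * (if i \<in> I then crd I i y else 0)) = (\<Sum>i\<in>I. c i * crd I i y)"
    using facet_subset_vertices[OF assms] finite_vertices
    by (intro sum.mono_neutral_cong_right) auto
  then show ?thesis
    by (simp add: iota_def poly_eval_power poly_eval_sum poly_eval_mult)
qed

lemma iota_rvar: "i \<in> I \<Longrightarrow> iota lam I (rvar i) y = crd I i y"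
  by (simp add: iota_def)

text \<open>The description in \<open>mf_integral\<close> has a solution by constancy, and the
  generic point makes it unique.\<close>

lemma mf_integral_power:
  assumes "generic y"
  shows "mf_integral e w lam ((\<Sum>i\<in>\<Union>K. rconst (c i) * rvar i) ^ CARD('n)) =
    (\<Sum>I\<in>facets CARD('n) K. summand c y I)"
proof -
  have gen: "(\<forall>I. w I \<noteq> 0 \<longrightarrow> (\<forall>i\<in>I. iota lam I (rvar i) y \<noteq> 0)) \<longleftrightarrow> generic y" for y
    by (simp add: weight_nonzero_iff generic_def iota_rvar Ball_def)
  have integrand: "(\<Sum>I | w I \<noteq> 0. of_int (w I) * iota lam I ((\<Sum>i\<in>\<Union>K. rconst (c i) * rvar i) ^ CARD('n)) y /
        (abs_det e lam I * (\<Prod>i\<in>I. iota lam I (rvar i) y))) = (\<Sum>I\<in>facets CARD('n) K. summand c y I)" for y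
    by (rule sum.cong) (simp_all add: weight_nonzero_iff iota_power iota_rvar summand_def)
  show ?thesis
    unfolding mf_integral_def gen
  proof (intro the_equality)
    show "\<forall>y'. generic y' \<longrightarrow> (\<Sum>I | w I \<noteq> 0. of_int (w I) *
        iota lam I ((\<Sum>i\<in>\<Union>K. rconst (c i) * rvar i) ^ CARD('n)) y' /
        (abs_det e lam I * (\<Prod>i\<in>I. iota lam I (rvar i) y'))) = (\<Sum>I\<in>facets CARD('n) K. summand c y I)"
      unfolding integrand using sum_summands_constant[OF _ assms] by blast
  next
    fix r assume "\<forall>y'. generic y' \<longrightarrow> (\<Sum>I | w I \<noteq> 0. of_int (w I) *
        iota lam I ((\<Sum>i\<in>\<Union>K. rconst (c i) * rvar i) ^ CARD('n)) y' /
        (abs_det e lam I * (\<Prod>i\<in>I. iota lam I (rvar i) y'))) = r"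
    then show "r = (\<Sum>I\<in>facets CARD('n) K. summand c y I)"
      using assms unfolding integrand by blast
  qed
qed

text \<open>Coefficients of the linear form attached to I at y. Their vanishing off I is what lets a
  missing face provide operators annihilating every summand.\<close>

definition lcoeff :: "'a \<Rightarrow> 'v set \<Rightarrow> 'v \<Rightarrow> real" where
  "lcoeff y I i = (if i \<in> I then crd I i y else 0)"

definition pcoeff :: "'a \<Rightarrow> 'v set \<Rightarrow> real" where
  "pcoeff y I = of_int (w I) / (fact CARD('n) * (abs_det e lam I * (\<Prod>i\<in>I. crd I i y)))"

lemma poly_eval_lform_facet:
  assumes "I \<in> facets CARD('n) K"
  shows "poly_eval c (lform (\<Union>K) (lcoeff y I)) = (\<Sum>i\<in>I. c i * crd I i y)"
  unfolding lform_def
  using facet_subset_vertices[OF assms] finite_vertices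
  by (auto simp: poly_eval_sum poly_eval_mult lcoeff_def mult.commute intro!: sum.mono_neutral_cong_right)

lemma volume_poly_eq:
  assumes "generic y"
  shows "volume_poly e (\<Union>K) w lam =
    (\<Sum>I\<in>facets CARD('n) K. pscale (pcoeff y I) (lform (\<Union>K) (lcoeff y I) ^ CARD('n)))" (is "_ = ?V")
    and "poly_eval c (volume_poly e (\<Union>K) w lam) = chain_sum c y / fact CARD('n) ^ 2"
proof -
  have eval: "poly_eval c ?V = 1 / fact CARD('n) *
      mf_integral e w lam ((\<Sum>i\<in>\<Union>K. rconst (c i) * rvar i) ^ CARD('n))" for c
  proof -
    have "poly_eval c ?V = (\<Sum>I\<in>facets CARD('n) K. 1 / fact CARD('n) * summand c y I)"
      unfolding poly_eval_sum
      by (rule sum.cong)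
        (simp_all add: poly_eval_pscale poly_eval_power poly_eval_lform_facet pcoeff_def summand_def)
    then show ?thesis by (simp only: mf_integral_power[OF assms] sum_distrib_left)
  qed
  have mem: "?V \<in> rpolys (\<Union>K)"
    by (intro rpolys_sum rpolys_pscale rpolys_power rpolys_lform) auto
  show V: "volume_poly e (\<Union>K) w lam = ?V"
    unfolding volume_poly_def
  proof (rule the_equality)
    show "?V \<in> rpolys (\<Union>K) \<and> (\<forall>c. poly_eval c ?V = 1 / fact CARD('n) *
      mf_integral e w lam ((\<Sum>i\<in>\<Union>K. rconst (c i) * rvar i) ^ CARD('n)))"
      using mem eval by blast
    fix P assume "P \<in> rpolys (\<Union>K) \<and> (\<forall>c. poly_eval c P = 1 / fact CARD('n) *
      mf_integral e w lam ((\<Sum>i\<in>\<Union>K. rconst (c i) * rvar i) ^ CARD('n)))"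
    then show "P = ?V" by (intro poly_eval_eq_imp) (simp only: eval)
  qed
  show "poly_eval c (volume_poly e (\<Union>K) w lam) = chain_sum c y / fact CARD('n) ^ 2"
    unfolding V eval by (simp add: mf_integral_power[OF assms] chain_sum_eq power2_eq_square)
qed

lemma pcoeff_nonzero:
  assumes "I \<in> facets CARD('n) K" "generic y"
  shows "pcoeff y I \<noteq> 0"
proof -
  obtain f :: "'n \<Rightarrow> 'v" where f: "inj f" "range f = I"
    using ordering_exists[where 'n = 'n, of I] facet[OF assms(1)] by metis
  then have "f \<in> orderings (facets CARD('n) K)" using assms(1) by (simp add: orderings_def)
  then have "abs_det e lam I \<noteq> 0" using abs_det_ordering[OF f] ordering_basis(1) by simp
  then show ?thesis
    using assms weight_nonzero_iff[of I] facet[OF assms(1)] by (auto simp: pcoeff_def generic_def)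
qed

lemma lcoeff_eq_0: "i \<notin> I \<Longrightarrow> lcoeff y I i = 0"
  by (simp add: lcoeff_def)

text \<open>The product of the variables of one maximal simplex J detects its summand: a different
  maximal simplex has the same size and so omits a vertex of J.\<close>

lemma volume_poly_nonzero: "volume_poly e (\<Union>K) w lam \<noteq> 0"
proof -
  obtain y where y: "generic y" by (rule generic_exists)
  obtain J where J: "J \<in> facets CARD('n) K" by (rule facet_exists)
  show ?thesis unfolding volume_poly_eq(1)[OF y]
  proof (rule sum_powers_nonzero[where T = J and J = J])
    show "\<exists>s\<in>J. lcoeff y I s = 0" if "I \<in> facets CARD('n) K" "I \<noteq> J" for I
    proof -
      have "\<not> J \<subseteq> I" using that J facet card_subset_eq[of I J] by metis
      then show ?thesis using lcoeff_eq_0 by blast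
    qed
    show "\<forall>i. i \<notin> \<Union>K \<longrightarrow> lcoeff y I i = 0" if "I \<in> facets CARD('n) K" for I
      using facet_subset_vertices[OF that] lcoeff_eq_0 by blast
    show "J \<noteq> {}" using facet[OF J] by auto
    show "lcoeff y J s \<noteq> 0" if "s \<in> J" for s using that y J by (simp add: lcoeff_def generic_def)
  qed (use J facet[OF J] finite_F finite_vertices facet_subset_vertices[OF J] pcoeff_nonzero[OF J y] in simp_all)
qed

end

subsection \<open>Flips\<close>

lemma range_fun_upd:
  assumes "inj f"
  shows "range (f(j := v)) = insert v (range f - {f j})"
  using assms by (auto simp: inj_eq)

text \<open>The cycle condition speaks only of ridges that are faces of K; any other ridge has no
  completion at all, and the sum is empty.\<close>

lemma (in multi_fan) ridge_sum:
  assumes "inj f"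
  shows "finite {v. f(j := v) \<in> orderings (facets CARD('n) K)}"
    and "(\<Sum>v | f(j := v) \<in> orderings (facets CARD('n) K). \<epsilon> (f(j := v))) = 0"
proof -
  let ?A = "{v. f(j := v) \<in> orderings (facets CARD('n) K)}"
  have A: "?A = {v. \<exists>I\<in>facets CARD('n) K. ordering (f(j := v)) I}"
    by (simp add: orderings_def ordering_iff)
  have "v \<in> \<Union>K" if "v \<in> ?A" for v
  proof -
    have "range (f(j := v)) \<in> facets CARD('n) K" using that by (simp add: orderings_def)
    then have "range (f(j := v)) \<subseteq> \<Union>K" by (rule facet_subset_vertices)
    moreover have "v \<in> range (f(j := v))" by (rule range_eqI[of _ _ j]) simp
    ultimately show ?thesis by blast
  qed
  then show "finite ?A" by (intro finite_subset[OF _ finite_vertices] subsetI)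
  show "(\<Sum>v\<in>?A. \<epsilon> (f(j := v))) = 0"
  proof (cases "f ` (- {j}) \<in> K")
    case True
    moreover have "inj_on f (- {j})" using assms by (rule inj_on_subset) simp
    ultimately have "inj_on f (- {j}) \<and> f ` (- {j}) \<in> K" by simp
    with complex(4)[unfolded is_cycle_def, THEN spec, THEN spec] show ?thesis
      unfolding A by (rule mp)
  next
    case False
    have "?A = {}"
    proof (rule equals0I)
      fix v assume "v \<in> ?A"
      then have "range (f(j := v)) \<in> K" by (simp add: orderings_def facets_def)
      then have "f ` (- {j}) \<in> K"
        by (rule face_subset) (auto simp: image_iff)
      then show False using False by simp
    qed
    then show ?thesis by (simp only: sum.empty)
  qed
qed

text \<open>A common form of the three kinds of flip: S1 is a missing face of K, S2 one of K', and C
  consists of the maximal simplices untouched by the flip. Every S - {s} is a maximal simplex of one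
  of the two complexes, which encodes the general position of the vectors on S.\<close>

locale flip = A: multi_fan e K \<epsilon> lam + B: multi_fan e K' \<epsilon>' lam'
  for e :: "'n::finite \<Rightarrow> 'a::euclidean_space" and K K' :: "'v set set"
    and \<epsilon> \<epsilon>' :: "('n \<Rightarrow> 'v) \<Rightarrow> int" and lam lam' :: "'v \<Rightarrow> 'a" +
  fixes S1 S2 :: "'v set" and C :: "'v set set"
  assumes finite_S: "finite S1" "finite S2" and nonempty: "S1 \<noteq> {}" "S2 \<noteq> {}"
    and disjoint: "S1 \<inter> S2 = {}" and card_S: "card S1 + card S2 = CARD('n) + 1"
    and facets_K: "facets CARD('n) K = C \<union> (\<lambda>s. S1 \<union> S2 - {s}) ` S1"
    and facets_K': "facets CARD('n) K' = C \<union> (\<lambda>s. S1 \<union> S2 - {s}) ` S2"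
    and disjoint_C: "C \<inter> (\<lambda>s. S1 \<union> S2 - {s}) ` (S1 \<union> S2) = {}"
    and missing: "\<And>I. I \<in> facets CARD('n) K \<Longrightarrow> \<not> S1 \<subseteq> I"
    and missing': "\<And>I. I \<in> facets CARD('n) K' \<Longrightarrow> \<not> S2 \<subseteq> I"
    and lam_eq: "\<And>v. v \<in> \<Union>K \<inter> \<Union>K' \<Longrightarrow> lam' v = lam v"
    and sign_eq: "\<And>f. f \<in> orderings C \<Longrightarrow> \<epsilon>' f = \<epsilon> f"
begin

definition "S = S1 \<union> S2"

text \<open>A common assignment for both fans: \<open>lam\<close> and \<open>lam'\<close> are
  meaningful only on their own vertices, and S may contain a vertex that belongs to just one of the
  complexes.\<close>

definition vec :: "'v \<Rightarrow> 'a" where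
  "vec v = (if v \<in> \<Union>K then lam v else lam' v)"

text \<open>Coefficients of the cycle of K' minus the cycle of K.\<close>

definition sgn_diff :: "('n \<Rightarrow> 'v) \<Rightarrow> int" where
  "sgn_diff f = (if f \<in> orderings (facets CARD('n) K') then \<epsilon>' f else 0) -
     (if f \<in> orderings (facets CARD('n) K) then \<epsilon> f else 0)"

definition fterm :: "('v \<Rightarrow> real) \<Rightarrow> 'a \<Rightarrow> ('n \<Rightarrow> 'v) \<Rightarrow> real" where
  "fterm c y f = basis_term e (vec \<circ> f) (c \<circ> f) y"

definition simplex_orderings :: "('n \<Rightarrow> 'v) set" where
  "simplex_orderings = orderings ((\<lambda>s. S - {s}) ` S)"

lemma finite_SS: "finite S" using finite_S by (simp add: S_def)

lemma card_SS: "card S = CARD('n) + 1"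
  using card_S card_Un_disjoint[OF finite_S disjoint] by (simp add: S_def)

lemma facets_alt:
  "facets CARD('n) K = C \<union> (\<lambda>s. S - {s}) ` S1" "facets CARD('n) K' = C \<union> (\<lambda>s. S - {s}) ` S2"
  using facets_K facets_K' by (simp_all add: S_def)

lemma vec_comp:
  "f \<in> orderings (facets CARD('n) K) \<Longrightarrow> vec \<circ> f = lam \<circ> f"
  "f \<in> orderings (facets CARD('n) K') \<Longrightarrow> vec \<circ> f = lam' \<circ> f"
proof -
  assume "f \<in> orderings (facets CARD('n) K)"
  then have "range f \<subseteq> \<Union>K" using A.facet_subset_vertices by (simp add: orderings_def)
  then have "vec (f k) = lam (f k)" for k by (auto simp: vec_def)
  then show "vec \<circ> f = lam \<circ> f" by (simp add: fun_eq_iff)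
next
  assume "f \<in> orderings (facets CARD('n) K')"
  then have "range f \<subseteq> \<Union>K'" using B.facet_subset_vertices by (simp add: orderings_def)
  then have "f k \<in> \<Union>K'" for k by blast
  then have "vec (f k) = lam' (f k)" for k using lam_eq[of "f k"] by (simp add: vec_def)
  then show "vec \<circ> f = lam' \<circ> f" by (simp add: fun_eq_iff)
qed

lemma simplex_orderings_iff:
  "f \<in> simplex_orderings \<longleftrightarrow> inj f \<and> (\<exists>s\<in>S. range f = S - {s})"
  by (auto simp: simplex_orderings_def orderings_def)

lemma simplex_orderings_subset:
  "simplex_orderings \<subseteq> orderings (facets CARD('n) K) \<union> orderings (facets CARD('n) K')"
  unfolding simplex_orderings_def facets_alt orderings_def S_def by auto

lemma sgn_diff_outside:
  assumes "f \<notin> simplex_orderings"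
  shows "sgn_diff f = 0"
proof -
  have "f \<in> orderings (facets CARD('n) K) \<longleftrightarrow> f \<in> orderings C"
    "f \<in> orderings (facets CARD('n) K') \<longleftrightarrow> f \<in> orderings C"
    using assms unfolding facets_alt simplex_orderings_def orderings_def S_def by auto
  then show ?thesis by (simp add: sgn_diff_def sign_eq)
qed

lemma chain_sum_diff:
  "B.chain_sum c y - A.chain_sum c y = (\<Sum>f\<in>simplex_orderings. of_int (sgn_diff f) * fterm c y f)"
proof -
  let ?OA = "orderings (facets CARD('n) K) :: ('n \<Rightarrow> 'v) set"
  let ?OB = "orderings (facets CARD('n) K') :: ('n \<Rightarrow> 'v) set"
  have fin: "finite (?OA \<union> ?OB)" using A.finite_orderings_F B.finite_orderings_F by simp
  have "A.chain_sum c y = (\<Sum>f\<in>?OA. of_int (\<epsilon> f) * fterm c y f)"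
    unfolding A.chain_sum_def fterm_def by (rule sum.cong) (simp_all only: vec_comp)
  also have "\<dots> = (\<Sum>f\<in>?OA \<union> ?OB. of_int (if f \<in> ?OA then \<epsilon> f else 0) * fterm c y f)"
    using fin by (intro sum.mono_neutral_cong_left) auto
  finally have a: "A.chain_sum c y = \<dots>" .
  have "B.chain_sum c y = (\<Sum>f\<in>?OB. of_int (\<epsilon>' f) * fterm c y f)"
    unfolding B.chain_sum_def fterm_def by (rule sum.cong) (simp_all only: vec_comp)
  also have "\<dots> = (\<Sum>f\<in>?OA \<union> ?OB. of_int (if f \<in> ?OB then \<epsilon>' f else 0) * fterm c y f)"
    using fin by (intro sum.mono_neutral_cong_left) auto
  finally have b: "B.chain_sum c y = \<dots>" .
  have "B.chain_sum c y - A.chain_sum c y =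
      (\<Sum>f\<in>?OA \<union> ?OB. of_int (sgn_diff f) * fterm c y f)"
    unfolding a b sum_subtractf[symmetric]
    by (rule sum.cong) (simp_all only: sgn_diff_def of_int_diff left_diff_distrib)
  also have "\<dots> = (\<Sum>f\<in>simplex_orderings. of_int (sgn_diff f) * fterm c y f)"
    using fin simplex_orderings_subset sgn_diff_outside by (intro sum.mono_neutral_right) auto
  finally show ?thesis .
qed

text \<open>
  The difference of the two cycles is a cycle supported on the boundary of the simplex on \<open>S\<close>,
  so it changes sign across every ridge.
\<close>

lemma sgn_diff_fun_upd:
  assumes f: "inj f" "range f = S - {s}" and s: "s \<in> S"
  shows "sgn_diff (f(j := s)) = - sgn_diff f"
proof -
  let ?A = "{v. f(j := v) \<in> orderings (facets CARD('n) K)}"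
  let ?B = "{v. f(j := v) \<in> orderings (facets CARD('n) K')}"
  let ?T = "?A \<union> ?B \<union> {f j, s}"
  have fin: "finite ?T" using A.ridge_sum(1)[OF f(1)] B.ridge_sum(1)[OF f(1)] by simp
  have ne: "f j \<noteq> s" using f(2) by blast
  have "(\<Sum>v\<in>?T. sgn_diff (f(j := v))) =
      (\<Sum>v\<in>?T. if v \<in> ?B then \<epsilon>' (f(j := v)) else 0) - (\<Sum>v\<in>?T. if v \<in> ?A then \<epsilon> (f(j := v)) else 0)"
    unfolding sum_subtractf[symmetric]
    by (rule sum.cong) (simp_all only: sgn_diff_def mem_Collect_eq)
  also have "(\<Sum>v\<in>?T. if v \<in> ?B then \<epsilon>' (f(j := v)) else 0) = (\<Sum>v\<in>?B. \<epsilon>' (f(j := v)))"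
    using fin by (intro sum.mono_neutral_cong_right) auto
  also have "\<dots> = 0" by (rule B.ridge_sum(2)[OF f(1)])
  also have "(\<Sum>v\<in>?T. if v \<in> ?A then \<epsilon> (f(j := v)) else 0) = (\<Sum>v\<in>?A. \<epsilon> (f(j := v)))"
    using fin by (intro sum.mono_neutral_cong_right) auto
  also have "\<dots> = 0" by (rule A.ridge_sum(2)[OF f(1)])
  finally have "(\<Sum>v\<in>?T. sgn_diff (f(j := v))) = 0" by (simp only: diff_self)
  \<comment> \<open>Within S the ridge can be completed only by the two vertices of S that it
    omits.\<close>
  moreover have "(\<Sum>v\<in>?T. sgn_diff (f(j := v))) = (\<Sum>v\<in>{f j, s}. sgn_diff (f(j := v)))"
  proof (rule sum.mono_neutral_right[OF fin])
    show "\<forall>v\<in>?T - {f j, s}. sgn_diff (f(j := v)) = 0"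
    proof
      fix v assume v: "v \<in> ?T - {f j, s}"
      have "f(j := v) \<notin> simplex_orderings"
      proof
        assume "f(j := v) \<in> simplex_orderings"
        then have g: "inj (f(j := v))" "range (f(j := v)) \<subseteq> S"
          by (auto simp only: simplex_orderings_iff)
        then have "v \<in> S" using rangeI[of "f(j := v)" j] by auto
        then have "v \<in> range f" using f(2) v by blast
        then obtain k where k: "v = f k" by blast
        then have "k \<noteq> j" using v by blast
        then have "(f(j := v)) k = (f(j := v)) j" using k by simp
        then show False using injD[OF g(1)] \<open>k \<noteq> j\<close> by blast
      qed
      then show "sgn_diff (f(j := v)) = 0" by (rule sgn_diff_outside)
    qed
  qed blast
  moreover have "(\<Sum>v\<in>{f j, s}. sgn_diff (f(j := v))) = sgn_diff f + sgn_diff (f(j := s))"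
    using ne by (simp del: fun_upd_apply)
  ultimately show ?thesis by simp
qed

text \<open>An ordering of a facet of the simplex that contains s arises in exactly one way from an
  ordering of the facet opposite to s by replacing one entry with s.\<close>

lemma simplex_orderings_split:
  fixes G :: "('n \<Rightarrow> 'v) \<Rightarrow> real"
  assumes s: "s \<in> S"
  shows "(\<Sum>g\<in>simplex_orderings. G g) =
    (\<Sum>f\<in>orderings {S - {s}}. G f + (\<Sum>j\<in>UNIV. G (f(j := s))))"
proof -
  let ?O = "orderings {S - {s}} :: ('n \<Rightarrow> 'v) set"
  let ?T = "{g \<in> simplex_orderings. s \<in> range g}"
  have O: "f \<in> ?O \<longleftrightarrow> inj f \<and> range f = S - {s}" for f by (simp add: orderings_def)
  have finO: "finite ?O" using finite_SS by (intro finite_orderings) auto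
  have finS: "finite simplex_orderings"
    unfolding simplex_orderings_def using finite_SS by (intro finite_orderings) auto
  have bij: "bij_betw (\<lambda>(f, j). f(j := s)) (?O \<times> UNIV) ?T"
    unfolding bij_betw_def
  proof
    show "inj_on (\<lambda>(f, j). f(j := s)) (?O \<times> UNIV)"
    proof (rule inj_onI, clarify)
      fix f f' :: "'n \<Rightarrow> 'v" and j j' assume *: "f \<in> ?O" "f' \<in> ?O" "f(j := s) = f'(j' := s)"
      have jj: "j = j'"
      proof (rule ccontr)
        assume "j \<noteq> j'"
        then have "f' j = s" using fun_cong[OF *(3), of j] by simp
        then have "s \<in> range f'" by blast
        then show False using *(2) O by blast
      qed
      have off: "f k = f' k" if "k \<noteq> j" for k using fun_cong[OF *(3), of k] that jj by simp
      have "f j \<in> range f'" using *(1,2) O by blast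
      then obtain k where k: "f j = f' k" by blast
      have "k = j"
      proof (rule ccontr)
        assume "k \<noteq> j"
        then have "f j = f k" using k off by simp
        then show False using *(1) O \<open>k \<noteq> j\<close> by (metis injD)
      qed
      then have "f = f'" using off k by (metis ext)
      then show "f = f' \<and> j = j'" using jj by simp
    qed
    show "(\<lambda>(f, j). f(j := s)) ` (?O \<times> UNIV) = ?T"
    proof
      show "(\<lambda>(f, j). f(j := s)) ` (?O \<times> UNIV) \<subseteq> ?T"
      proof
        fix g assume "g \<in> (\<lambda>(f, j). f(j := s)) ` (?O \<times> UNIV)"
        then obtain f j where g: "g = f(j := s)" "f \<in> ?O" by auto
        then have f: "inj f" "range f = S - {s}" using O by blast+
        have "range g = S - {f j}"
          unfolding g(1) range_fun_upd[OF f(1)] f(2) using s f(2) by blast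
        moreover have "inj g" unfolding g(1) by (rule inj_on_fun_updI[OF f(1)]) (simp add: f(2))
        moreover have "f j \<in> S" "s \<noteq> f j" using f(2) by blast+
        ultimately show "g \<in> ?T" using s by (auto simp: simplex_orderings_iff)
      qed
      show "?T \<subseteq> (\<lambda>(f, j). f(j := s)) ` (?O \<times> UNIV)"
      proof
        fix g assume "g \<in> ?T"
        then obtain t j where g: "inj g" "t \<in> S" "range g = S - {t}" "s = g j"
          by (auto simp: simplex_orderings_iff)
        \<comment> \<open>The inverse of the replacement puts the omitted vertex t where s
          stood.\<close>
        have "inj (g(j := t))" by (rule inj_on_fun_updI[OF g(1)]) (simp add: g(3))
        moreover have "range (g(j := t)) = S - {s}"
          unfolding range_fun_upd[OF g(1)] g(3) g(4)[symmetric] using g(2,3,4) by blast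
        ultimately have "g(j := t) \<in> ?O" using O by simp
        moreover have "g = (\<lambda>(f, j). f(j := s)) (g(j := t), j)" by (simp add: g(4))
        ultimately show "g \<in> (\<lambda>(f, j). f(j := s)) ` (?O \<times> UNIV)" by blast
      qed
    qed
  qed
  have "?O \<subseteq> simplex_orderings" 
    using s by (auto simp: O simplex_orderings_iff)
  moreover have "simplex_orderings - ?O = ?T"
  proof -
    have O_iff: "g \<in> ?O \<longleftrightarrow> s \<notin> range g" if g: "g \<in> simplex_orderings" for g
    proof -
      obtain t where t: "inj g" "t \<in> S" "range g = S - {t}"
        using g[unfolded simplex_orderings_iff] by blast
      have "g \<in> ?O \<longleftrightarrow> S - {t} = S - {s}" using t by (simp add: O)
      also have "\<dots> \<longleftrightarrow> s \<notin> S - {t}" using s t(2) by blast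
      finally show ?thesis using t(3) by simp
    qed
    show ?thesis
    proof (rule Set.set_eqI)
      fix g show "g \<in> simplex_orderings - ?O \<longleftrightarrow> g \<in> ?T"
        using O_iff[of g] by (cases "g \<in> simplex_orderings") simp_all
    qed
  qed
  ultimately have "(\<Sum>g\<in>simplex_orderings. G g) = (\<Sum>g\<in>?T. G g) + (\<Sum>f\<in>?O. G f)"
    using sum.subset_diff[of ?O simplex_orderings G, OF _ finS] by (simp only:)
  also have "(\<Sum>g\<in>?T. G g) = (\<Sum>x\<in>?O \<times> UNIV. G ((\<lambda>(f, j). f(j := s)) x))"
    by (rule sum.reindex_bij_betw[OF bij, symmetric])
  also have "\<dots> = (\<Sum>f\<in>?O. \<Sum>j\<in>UNIV. G (f(j := s)))"
    by (simp add: sum.cartesian_product case_prod_unfold)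
  finally show ?thesis by (simp add: sum.distrib)
qed

text \<open>Since signs alternate across ridges, the difference cycle is determined by the facet
  opposite to s, in the form to which the cone identity with apex s applies.\<close>

lemma simplex_cone:
  assumes s: "s \<in> S"
  shows "B.chain_sum c y - A.chain_sum c y =
    (\<Sum>f\<in>orderings {S - {s}}. of_int (sgn_diff f) * (fterm c y f - (\<Sum>j\<in>UNIV. fterm c y (f(j := s)))))"
  unfolding chain_sum_diff simplex_orderings_split[OF s]
proof (rule sum.cong)
  fix f :: "'n \<Rightarrow> 'v" assume "f \<in> orderings {S - {s}}"
  then have "inj f" "range f = S - {s}" by (simp_all add: orderings_def)
  then have "of_int (sgn_diff (f(j := s))) * fterm c y (f(j := s)) =
      - (of_int (sgn_diff f) * fterm c y (f(j := s)))" for j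
    by (simp only: sgn_diff_fun_upd[OF _ _ s] of_int_minus mult_minus_left)
  then show "of_int (sgn_diff f) * fterm c y f +
      (\<Sum>j\<in>UNIV. of_int (sgn_diff (f(j := s))) * fterm c y (f(j := s))) =
      of_int (sgn_diff f) * (fterm c y f - (\<Sum>j\<in>UNIV. fterm c y (f(j := s))))"
    by (simp only: sum_negf sum_distrib_left right_diff_distrib)

qed simp

lemma old_facet:
  assumes "s \<in> S1"
  shows "S - {s} \<in> facets CARD('n) K" "S - {s} \<notin> facets CARD('n) K'" "s \<in> S"
proof -
  show "S - {s} \<in> facets CARD('n) K" "s \<in> S" using assms by (simp_all add: facets_alt S_def)
  have "S - {s} \<noteq> S - {t}" if "t \<in> S2" for t
    using assms that disjoint unfolding S_def by blast
  moreover have "S - {s} \<notin> C" using disjoint_C assms unfolding S_def by blast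
  ultimately show "S - {s} \<notin> facets CARD('n) K'" unfolding facets_alt by blast
qed

text \<open>By Cramer's rule a zero coordinate would make the family on S - {i} degenerate; but S -
  {i} is a maximal simplex of K or K' and carries a basis.\<close>

lemma coordinate_nonzero:
  assumes s: "s \<in> S1" and i: "i \<in> S - {s}"
  shows "A.crd (S - {s}) i (vec s) \<noteq> 0"
proof
  assume 0: "A.crd (S - {s}) i (vec s) = 0"
  obtain f :: "'n \<Rightarrow> 'v" where f: "inj f" "range f = S - {s}"
    using ordering_exists[where 'n = 'n, of "S - {s}"] A.facet[OF old_facet(1)[OF s]] by metis
  then have fO: "f \<in> orderings (facets CARD('n) K)"
    using old_facet(1)[OF s] by (simp add: orderings_def)
  obtain j where j: "i = f j" using f(2) i by blast
  have "vec s = (\<Sum>k\<in>UNIV. A.crd (S - {s}) (f k) (vec s) *\<^sub>R (vec \<circ> f) k)"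
    using A.ordering_basis(2)[OF fO, of "vec s"] unfolding vec_comp(1)[OF fO] f(2) .
  from frame_det_fun_upd[OF this, of e j] have "frame_det e (vec \<circ> f(j := s)) = 0"
    using 0 j by (simp only: fun_upd_comp mult_zero_left)
  moreover have "f(j := s) \<in> simplex_orderings"
  proof -
    have "range (f(j := s)) = S - {f j}"
      unfolding range_fun_upd[OF f(1)] f(2) using old_facet(3)[OF s] i j by blast
    moreover have "inj (f(j := s))" by (rule inj_on_fun_updI[OF f(1)]) (simp add: f(2))
    ultimately show ?thesis using i j unfolding simplex_orderings_iff by blast
  qed
  then have "f(j := s) \<in> orderings (facets CARD('n) K) \<union> orderings (facets CARD('n) K')"
    by (rule subsetD[OF simplex_orderings_subset])
  then have "frame_det e (vec \<circ> f(j := s)) \<noteq> 0"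
  proof
    assume g: "f(j := s) \<in> orderings (facets CARD('n) K)"
    show ?thesis unfolding vec_comp(1)[OF g] by (rule A.ordering_basis(1)[OF g])
  next
    assume g: "f(j := s) \<in> orderings (facets CARD('n) K')"
    show ?thesis unfolding vec_comp(2)[OF g] by (rule B.ordering_basis(1)[OF g])
  qed
  ultimately show False by contradiction
qed

text \<open>Now the apex \<open>vec s\<close> is given and the point is chosen, the reverse of the
  situation in \<open>chain_sum_constant\<close>. The vectors to be avoided as normals are nonzero
  because the coordinates of the apex are.\<close>

lemma simplex_generic_exists:
  assumes s: "s \<in> S1"
  obtains y where "A.generic y" "B.generic y"
    "\<forall>i\<in>S - {s}. \<forall>k\<in>S - {s}. i \<noteq> k \<longrightarrow>
      A.crd (S - {s}) k y * A.crd (S - {s}) i (vec s) \<noteq> A.crd (S - {s}) i y * A.crd (S - {s}) k (vec s)"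
proof -
  let ?I = "S - {s}"
  let ?n = "\<lambda>i k. A.crd ?I i (vec s) *\<^sub>R dual_vec lam ?I k - A.crd ?I k (vec s) *\<^sub>R dual_vec lam ?I i"
  let ?N = "\<Union>i\<in>?I. (\<lambda>k. ?n i k) ` (?I - {i})"
  have basis: "basis_family lam ?I" by (rule A.facet_basis[OF old_facet(1)[OF s]])
  have n0: "?n i k \<noteq> 0" if "i \<in> ?I" "k \<in> ?I - {i}" for i k
  proof
    assume "?n i k = 0"
    from arg_cong[OF this, of "\<lambda>v. v \<bullet> lam k"]
    have "A.crd ?I i (vec s) * (dual_vec lam ?I k \<bullet> lam k) - A.crd ?I k (vec s) * (dual_vec lam ?I i \<bullet> lam k) = 0"
      by (simp add: inner_diff_left)
    moreover have "dual_vec lam ?I k \<bullet> lam k = 1" "dual_vec lam ?I i \<bullet> lam k = 0"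
      using dual_vec_inner[OF basis, of k k] dual_vec_inner[OF basis, of k i] that by auto
    ultimately have "A.crd ?I i (vec s) = 0" by simp
    then show False using coordinate_nonzero[OF s that(1)] by simp
  qed
  have "0 \<notin> ?N"
  proof
    assume "0 \<in> ?N"
    then obtain i k where "i \<in> ?I" "k \<in> ?I - {i}" "0 = ?n i k" by blast
    then show False using n0 by metis
  qed
  moreover have "finite ?N" using finite_SS by simp
  ultimately have "finite (A.normals \<union> B.normals \<union> ?N)" "0 \<notin> A.normals \<union> B.normals \<union> ?N"
    using A.normals(1,2) B.normals(1,2) by simp_all
  from exists_nonorthogonal[OF this] obtain y where
    y: "\<forall>v\<in>A.normals \<union> B.normals \<union> ?N. v \<bullet> y \<noteq> 0" by blast
  show thesis
  proof
    show "A.generic y" "B.generic y" using y by (simp_all add: A.normals(3) B.normals(3))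
    show "\<forall>i\<in>?I. \<forall>k\<in>?I. i \<noteq> k \<longrightarrow> A.crd ?I k y * A.crd ?I i (vec s) \<noteq> A.crd ?I i y * A.crd ?I k (vec s)"
    proof (intro ballI impI)
      fix i k assume ik: "i \<in> ?I" "k \<in> ?I" "i \<noteq> k"
      then have "?n i k \<in> A.normals \<union> B.normals \<union> ?N"
        by (intro UnI2 UN_I[OF ik(1)] imageI) simp
      from bspec[OF y this]
      show "A.crd ?I k y * A.crd ?I i (vec s) \<noteq> A.crd ?I i y * A.crd ?I k (vec s)"
        by (simp add: inner_diff_left mult.commute)
    qed
  qed
qed

text \<open>All n! orderings of the facet opposite to s give the same cone term. Here the apex is a
  genuine vertex and carries its own value \<open>c s\<close>, which completes the linear form of
  the relation on S.\<close>

lemma chain_sum_flip: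
  assumes s: "s \<in> S1"
  obtains y r where "A.generic y" "B.generic y" "r \<noteq> 0"
    "\<forall>c. B.chain_sum c y - A.chain_sum c y =
      r * ((\<Sum>i\<in>S - {s}. c i * A.crd (S - {s}) i (vec s)) - c s) ^ CARD('n)"
proof -
  let ?I = "S - {s}"
  define \<zeta> where "\<zeta> i = A.crd ?I i (vec s)" for i
  define Z where "Z = (\<Prod>i\<in>?I. \<zeta> i)"
  define d where "d = abs_det e lam ?I"
  obtain y where y: "A.generic y" "B.generic y"
    "\<forall>i\<in>?I. \<forall>k\<in>?I. i \<noteq> k \<longrightarrow>
      A.crd ?I k y * A.crd ?I i (vec s) \<noteq> A.crd ?I i y * A.crd ?I k (vec s)"
    by (rule simplex_generic_exists[OF s]) (rule that; assumption)
  have \<zeta>: "\<zeta> i \<noteq> 0" if "i \<in> ?I" for i using coordinate_nonzero[OF s that] by (simp add: \<zeta>_def)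
  have summand_eq: "of_int (sgn_diff f) * (fterm c y f - (\<Sum>j\<in>UNIV. fterm c y (f(j := s)))) =
      - of_int (A.w ?I) / (d * Z) * ((\<Sum>i\<in>?I. c i * \<zeta> i) - c s) ^ CARD('n)"
    and d0: "d \<noteq> 0" if "f \<in> orderings {?I}" for c and f :: "'n \<Rightarrow> 'v"
  proof -
    have f: "inj f" "range f = ?I" using that by (simp_all add: orderings_def)
    have fO: "f \<in> orderings (facets CARD('n) K)" "f \<notin> orderings (facets CARD('n) K')"
      using f old_facet[OF s] by (simp_all add: orderings_def)
    have fk: "f k \<in> ?I" for k using f(2) by blast
    \<comment> \<open>The facet opposite to a vertex of S1 belongs to K only, so it enters the
      difference with a minus sign.\<close>
    have sd: "sgn_diff f = - \<epsilon> f" using fO by (simp add: sgn_diff_def)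
    have coords: "x = (\<Sum>k\<in>UNIV. A.crd ?I (f k) x *\<^sub>R (vec \<circ> f) k)" for x
      using A.ordering_basis(2)[OF fO(1), of x] unfolding vec_comp(1)[OF fO(1)] f(2) .
    have det: "frame_det e (vec \<circ> f) \<noteq> 0"
      using A.ordering_basis(1)[OF fO(1)] by (simp only: vec_comp(1)[OF fO(1)] not_False_eq_True)
    have cone: "basis_term e (vec \<circ> f) (c \<circ> f) y -
        (\<Sum>j\<in>UNIV. basis_term e ((vec \<circ> f)(j := vec s)) ((c \<circ> f)(j := c s)) y) =
        ((\<Sum>k\<in>UNIV. (c \<circ> f) k * \<zeta> (f k)) - c s) ^ CARD('n) /
        (frame_det e (vec \<circ> f) * (\<Prod>k\<in>UNIV. \<zeta> (f k)))"
    proof (rule basis_term_cone[OF det])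
      show "y = (\<Sum>k\<in>UNIV. A.crd ?I (f k) y *\<^sub>R (vec \<circ> f) k)" by (rule coords)
      show "vec s = (\<Sum>k\<in>UNIV. \<zeta> (f k) *\<^sub>R (vec \<circ> f) k)" unfolding \<zeta>_def by (rule coords)
      show "\<zeta> (f j) \<noteq> 0" for j by (rule \<zeta>[OF fk])
      show "A.crd ?I (f j) y \<noteq> 0" for j
        using y(1) old_facet(1)[OF s] fk[of j] unfolding A.generic_def by blast
      fix j k :: 'n assume "j \<noteq> k"
      then have "f j \<noteq> f k" using f(1) by (simp add: inj_eq)
      then show "A.crd ?I (f k) y * \<zeta> (f j) \<noteq> A.crd ?I (f j) y * \<zeta> (f k)"
        unfolding \<zeta>_def by (rule y(3)[THEN bspec, OF fk, THEN bspec, OF fk, THEN mp])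
    qed
    have sums: "(\<Sum>k\<in>UNIV. (c \<circ> f) k * \<zeta> (f k)) = (\<Sum>i\<in>?I. c i * \<zeta> i)"
      "(\<Prod>k\<in>UNIV. \<zeta> (f k)) = Z"
      unfolding Z_def f(2)[symmetric] by (simp_all add: sum.reindex[OF f(1)] prod.reindex[OF f(1)])
    have w: "A.w ?I = \<epsilon> f * (if frame_det e (lam \<circ> f) > 0 then 1 else - 1)"
      using A.weight_facet[OF fO(1)] f(2) by simp
    have d: "d = \<bar>frame_det e (lam \<circ> f)\<bar>" unfolding d_def by (rule A.abs_det_ordering[OF f])
    show "d \<noteq> 0" using d A.ordering_basis(1)[OF fO(1)] by simp
    have "fterm c y f - (\<Sum>j\<in>UNIV. fterm c y (f(j := s))) =
        ((\<Sum>i\<in>?I. c i * \<zeta> i) - c s) ^ CARD('n) / (frame_det e (lam \<circ> f) * Z)"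
      unfolding fterm_def fun_upd_comp unfolding cone sums unfolding vec_comp(1)[OF fO(1)] ..
    moreover have "of_int (- \<epsilon> f) * (x / (frame_det e (lam \<circ> f) * Z)) = - of_int (A.w ?I) / (d * Z) * x" for x :: real
      unfolding w d by (cases "frame_det e (lam \<circ> f) > 0") auto
    ultimately show "of_int (sgn_diff f) * (fterm c y f - (\<Sum>j\<in>UNIV. fterm c y (f(j := s)))) =
      - of_int (A.w ?I) / (d * Z) * ((\<Sum>i\<in>?I. c i * \<zeta> i) - c s) ^ CARD('n)"
      unfolding sd by simp
  qed
  have card_I: "finite ?I" "card ?I = CARD('n)"
    using A.facet[OF old_facet(1)[OF s]] by simp_all
  obtain f :: "'n \<Rightarrow> 'v" where "inj f" "range f = ?I"
    using ordering_exists[where 'n = 'n, OF card_I] by metis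
  then have "d \<noteq> 0" by (intro d0) (simp add: orderings_def)
  moreover have "Z \<noteq> 0" unfolding Z_def using \<zeta> card_I(1) by simp
  moreover have "A.w ?I \<noteq> 0" using A.weight_nonzero_iff old_facet(1)[OF s] by simp
  ultimately have "fact CARD('n) * (- of_int (A.w ?I) / (d * Z)) \<noteq> (0 :: real)" by simp
  moreover have "B.chain_sum c y - A.chain_sum c y = fact CARD('n) * (- of_int (A.w ?I) / (d * Z)) *
      ((\<Sum>i\<in>?I. c i * A.crd ?I i (vec s)) - c s) ^ CARD('n)" for c
  proof -
    have "B.chain_sum c y - A.chain_sum c y = fact CARD('n) *
        (\<Sum>I\<in>{?I}. - of_int (A.w ?I) / (d * Z) * ((\<Sum>i\<in>?I. c i * \<zeta> i) - c s) ^ CARD('n))"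
      unfolding simplex_cone[OF old_facet(3)[OF s]]
    proof (rule sum_orderings)
      show "finite I \<and> card I = CARD('n)" if "I \<in> {?I}" for I using that card_I by simp
    qed (simp, rule summand_eq)
    then show ?thesis by (simp add: \<zeta>_def)
  qed
  ultimately show thesis by (intro that[OF y(1,2), of "fact CARD('n) * (- of_int (A.w ?I) / (d * Z))"] allI)
qed

lemma S_subset_vertices: "S \<subseteq> \<Union>K \<union> \<Union>K'"
proof
  fix i assume i: "i \<in> S"
  have "S \<noteq> {i}" using card_SS by auto
  then obtain t where t: "t \<in> S" "t \<noteq> i" using i by blast
  then have "S - {t} \<in> facets CARD('n) K \<union> facets CARD('n) K'"
    unfolding facets_alt S_def by blast
  then have "S - {t} \<subseteq> \<Union>K \<union> \<Union>K'"
    using A.facet_subset_vertices[of "S - {t}"] B.facet_subset_vertices[of "S - {t}"] by blast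
  then show "i \<in> \<Union>K \<union> \<Union>K'" using t i by blast
qed

lemma volume_poly_flip:
  obtains a r where "\<forall>i. i \<notin> \<Union>K \<union> \<Union>K' \<longrightarrow> a i = 0" "\<forall>s\<in>S. a s \<noteq> 0" "r \<noteq> 0"
    "volume_poly e (\<Union>K') B.w lam' =
      volume_poly e (\<Union>K) A.w lam + pscale r (lform (\<Union>K \<union> \<Union>K') a ^ CARD('n))"
proof -
  obtain s where s: "s \<in> S1" using nonempty by blast
  let ?I = "S - {s}" and ?Y = "\<Union>K \<union> \<Union>K'"
  obtain y r where y: "A.generic y" "B.generic y" and r: "r \<noteq> 0" and
    diff: "\<forall>c. B.chain_sum c y - A.chain_sum c y =
      r * ((\<Sum>i\<in>?I. c i * A.crd ?I i (vec s)) - c s) ^ CARD('n)"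
    by (rule chain_sum_flip[OF s]) (rule that; assumption)
  \<comment> \<open>Coefficients of the linear relation on S, normalised to -1 at s.\<close>
  define a where "a i = (if i \<in> ?I then A.crd ?I i (vec s) else if i = s then - 1 else 0)" for i
  note SY = S_subset_vertices
  have fin: "finite ?Y" using A.finite_vertices B.finite_vertices by simp
  have a0: "a i = 0" if "i \<notin> S" for i using that old_facet(3)[OF s] by (auto simp: a_def)
  have supp: "\<forall>i. i \<notin> ?Y \<longrightarrow> a i = 0"
  proof (intro allI impI)
    fix i assume "i \<notin> ?Y"
    then have "i \<notin> S" using SY by blast
    then show "a i = 0" by (rule a0)
  qed
  have nz: "\<forall>i\<in>S. a i \<noteq> 0"
    using coordinate_nonzero[OF s] by (simp add: a_def)
  have rnz: "r / fact CARD('n) ^ 2 \<noteq> 0" using r by simp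
  have "volume_poly e (\<Union>K') B.w lam' =
      volume_poly e (\<Union>K) A.w lam + pscale (r / fact CARD('n) ^ 2) (lform ?Y a ^ CARD('n))"
  proof (rule poly_eval_eq_imp)
    fix c
    have "poly_eval c (lform ?Y a) = (\<Sum>i\<in>?Y. a i * c i)"
      by (simp add: lform_def poly_eval_sum poly_eval_mult)
    also have "\<dots> = (\<Sum>i\<in>S. a i * c i)"
      using SY fin a0 by (intro sum.mono_neutral_right) auto
    also have "\<dots> = a s * c s + (\<Sum>i\<in>?I. a i * c i)"
      by (rule sum.remove[OF finite_SS old_facet(3)[OF s]])
    also have "\<dots> = (\<Sum>i\<in>?I. c i * A.crd ?I i (vec s)) - c s"
      by (simp add: a_def mult.commute)
    finally have lf: "poly_eval c (lform ?Y a) = \<dots>" .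
    have "B.chain_sum c y = A.chain_sum c y + r * poly_eval c (lform ?Y a) ^ CARD('n)"
      unfolding lf using spec[OF diff, of c] by linarith
    then show "poly_eval c (volume_poly e (\<Union>K') B.w lam') =
        poly_eval c (volume_poly e (\<Union>K) A.w lam + pscale (r / fact CARD('n) ^ 2) (lform ?Y a ^ CARD('n)))"
      by (simp only: A.volume_poly_eq(2)[OF y(1)] B.volume_poly_eq(2)[OF y(2)] poly_eval_add
          poly_eval_pscale poly_eval_power add_divide_distrib times_divide_eq_left)
  qed
  with supp nz rnz show thesis by (rule that)
qed

end

section \<open>Both fans over a common set of variables\<close>

context multi_fan
begin

lemma volume_poly_sum_powers:
  assumes "generic y" "finite Y" "\<Union>K \<subseteq> Y"
  shows "volume_poly e (\<Union>K) w lam =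
    (\<Sum>I\<in>facets CARD('n) K. pscale (pcoeff y I) (lform Y (lcoeff y I) ^ CARD('n)))"
  unfolding volume_poly_eq(1)[OF assms(1)]
proof (rule sum.cong)
  fix I assume "I \<in> facets CARD('n) K"
  then have "\<forall>i. i \<notin> \<Union>K \<longrightarrow> lcoeff y I i = 0"
    using facet_subset_vertices[of I] lcoeff_eq_0[of _ I y] by auto
  from lform_mono[OF assms(2,3) this]
  show "pscale (pcoeff y I) (lform (\<Union>K) (lcoeff y I) ^ CARD('n)) =
      pscale (pcoeff y I) (lform Y (lcoeff y I) ^ CARD('n))" by (simp only:)
qed simp

lemma lcoeff_support:
  assumes "I \<in> facets CARD('n) K" "\<Union>K \<subseteq> Y"
  shows "\<forall>i. i \<notin> Y \<longrightarrow> lcoeff y I i = 0"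
proof (intro allI impI)
  fix i assume "i \<notin> Y"
  then have "i \<notin> I" using facet_subset_vertices[OF assms(1)] assms(2) by blast
  then show "lcoeff y I i = 0" by (rule lcoeff_eq_0)
qed

lemma graded_dim_eq:
  assumes "finite Y" "\<Union>K \<subseteq> Y"
  shows "graded_dim (\<Union>K) (volume_poly e (\<Union>K) w lam) (2 * k) =
    rp.dim (derivs Y (2 * k) (volume_poly e (\<Union>K) w lam))"
proof -
  obtain y where y: "generic y" by (rule generic_exists)
  let ?V = "volume_poly e (\<Union>K) w lam"
  note V = volume_poly_sum_powers[OF y assms]
  have sub: "derivs (\<Union>K) (2 * k) ?V \<subseteq>
      rp.span ((\<lambda>I. lform Y (lcoeff y I) ^ (CARD('n) - k)) ` facets CARD('n) K)"
    unfolding V by (rule derivs_sum_powers_subset_span[OF assms(1)]) (rule lcoeff_support[OF _ assms(2)])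
  have "graded_dim (\<Union>K) ?V (2 * k) = rp.dim (derivs (\<Union>K) (2 * k) ?V)"
    by (rule graded_dim_eq_dim_derivs[OF volume_poly_nonzero sub]) (simp add: finite_F)
  also have "derivs (\<Union>K) (2 * k) ?V = derivs Y (2 * k) ?V"
    unfolding V by (rule derivs_sum_powers_mono[OF assms]) (rule lcoeff_support[OF _ subset_refl])
  finally show ?thesis .
qed

end

context flip
begin

lemma graded_dim_flip:
  assumes "k \<le> CARD('n)"
  shows "graded_dim (\<Union>K') (volume_poly e (\<Union>K') B.w lam') (2 * k) + (if k < card S1 then 1 else 0) =
    graded_dim (\<Union>K) (volume_poly e (\<Union>K) A.w lam) (2 * k) + (if k < card S2 then 1 else 0)"
proof -
  let ?Y = "\<Union>K \<union> \<Union>K'"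
  have Y: "finite ?Y" "\<Union>K \<subseteq> ?Y" "\<Union>K' \<subseteq> ?Y" using A.finite_vertices B.finite_vertices by auto
  obtain a r where a: "\<forall>i. i \<notin> ?Y \<longrightarrow> a i = 0" "\<forall>s\<in>S. a s \<noteq> 0" "r \<noteq> 0"
    "volume_poly e (\<Union>K') B.w lam' =
      volume_poly e (\<Union>K) A.w lam + pscale r (lform ?Y a ^ CARD('n))"
    using volume_poly_flip .
  \<comment> \<open>The two presentations as sums of powers may use different points, since the
    volume polynomials do not depend on them.\<close>
  obtain y where y: "A.generic y" by (rule A.generic_exists)
  obtain y' where y': "B.generic y'" by (rule B.generic_exists)
  have S: "S1 \<subseteq> ?Y" "S2 \<subseteq> ?Y" "\<And>s. s \<in> S1 \<Longrightarrow> a s \<noteq> 0" "\<And>s. s \<in> S2 \<Longrightarrow> a s \<noteq> 0"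
    using S_subset_vertices a(2) unfolding S_def by auto
  have kill: "\<exists>s\<in>S1. A.lcoeff y I s = 0" if I: "I \<in> facets CARD('n) K" for I
  proof -
    obtain s where "s \<in> S1" "s \<notin> I" using missing[OF I] by blast
    then show ?thesis using A.lcoeff_eq_0[of s I y] by (intro bexI[of _ s])
  qed
  have kill': "\<exists>s\<in>S2. B.lcoeff y' I s = 0" if I: "I \<in> facets CARD('n) K'" for I
  proof -
    obtain s where "s \<in> S2" "s \<notin> I" using missing'[OF I] by blast
    then show ?thesis using B.lcoeff_eq_0[of s I y'] by (intro bexI[of _ s])
  qed
  show ?thesis unfolding A.graded_dim_eq[OF Y(1,2)] B.graded_dim_eq[OF Y(1,3)]
  proof (rule dim_derivs_add_power[where F = "facets CARD('n) K" and F' = "facets CARD('n) K'"])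
    show "volume_poly e (\<Union>K) A.w lam =
        (\<Sum>I\<in>facets CARD('n) K. pscale (A.pcoeff y I) (lform ?Y (A.lcoeff y I) ^ CARD('n)))"
      by (rule A.volume_poly_sum_powers[OF y Y(1,2)])
    show "volume_poly e (\<Union>K') B.w lam' =
        (\<Sum>I\<in>facets CARD('n) K'. pscale (B.pcoeff y' I) (lform ?Y (B.lcoeff y' I) ^ CARD('n)))"
      by (rule B.volume_poly_sum_powers[OF y' Y(1,3)])
    show "\<forall>i. i \<notin> ?Y \<longrightarrow> A.lcoeff y I i = 0" if "I \<in> facets CARD('n) K" for I
      by (rule A.lcoeff_support[OF that Y(2)])
    show "\<forall>i. i \<notin> ?Y \<longrightarrow> B.lcoeff y' I i = 0" if "I \<in> facets CARD('n) K'" for I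
      by (rule B.lcoeff_support[OF that Y(3)])
  qed (fact Y(1) A.finite_F B.finite_F a(1) a(3,4) finite_S nonempty S kill kill' card_S assms)+
qed

end

section \<open>Faces before and after a flip\<close>

lemma card_minus_one:
  assumes "finite S" "card S = Suc n" "I \<subseteq> S" "card I = n"
  obtains s where "s \<in> S" "I = S - {s}"
proof -
  have "card (S - I) = 1" using assms by (simp add: card_Diff_subset finite_subset)
  then obtain s where "S - I = {s}" by (auto simp: card_1_singleton_iff)
  then show thesis using assms(3) by (intro that[of s]) auto
qed

text \<open>Each of the two joins consists of the subsets of S that do not contain a given part, S1
  or S2; the replacement then becomes a comparison of such conditions.\<close>

lemma bistellar_facets:
  assumes sc: "simplicial_complex K" "simplicial_complex K'"
    and S: "finite S1" "finite S2" "S1 \<inter> S2 = {}" "S1 \<noteq> {}" "S2 \<noteq> {}" "card S1 + card S2 = n + 1"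
    and ind: "induced K (S1 \<union> S2) = join (simplex_boundary S1) (Pow S2)"
    and K': "K' = (K - join (simplex_boundary S1) (Pow S2)) \<union> join (Pow S1) (simplex_boundary S2)"
  obtains C where "facets n K = C \<union> (\<lambda>s. S1 \<union> S2 - {s}) ` S1"
    "facets n K' = C \<union> (\<lambda>s. S1 \<union> S2 - {s}) ` S2"
    "C \<inter> (\<lambda>s. S1 \<union> S2 - {s}) ` (S1 \<union> S2) = {}"
    "\<forall>I\<in>facets n K. \<not> S1 \<subseteq> I" "\<forall>I\<in>facets n K'. \<not> S2 \<subseteq> I"
proof -
  let ?S = "S1 \<union> S2"
  let ?J1 = "join (simplex_boundary S1) (Pow S2)" and ?J2 = "join (Pow S1) (simplex_boundary S2)"
  have J1: "\<sigma> \<in> ?J1 \<longleftrightarrow> \<sigma> \<subseteq> ?S \<and> \<not> S1 \<subseteq> \<sigma>" for \<sigma>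
  proof
    assume "\<sigma> \<in> ?J1"
    then obtain a b where "\<sigma> = a \<union> b" "a \<subset> S1" "b \<subseteq> S2"
      by (auto simp: join_def simplex_boundary_def)
    then show "\<sigma> \<subseteq> ?S \<and> \<not> S1 \<subseteq> \<sigma>" using S(3) by blast
  next
    assume "\<sigma> \<subseteq> ?S \<and> \<not> S1 \<subseteq> \<sigma>"
    then have "\<sigma> = (\<sigma> \<inter> S1) \<union> (\<sigma> \<inter> S2)" "\<sigma> \<inter> S1 \<in> simplex_boundary S1" "\<sigma> \<inter> S2 \<in> Pow S2"
      by (auto simp: simplex_boundary_def)
    then show "\<sigma> \<in> ?J1" unfolding join_def by blast
  qed
  have J2: "\<sigma> \<in> ?J2 \<longleftrightarrow> \<sigma> \<subseteq> ?S \<and> \<not> S2 \<subseteq> \<sigma>" for \<sigma>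
  proof
    assume "\<sigma> \<in> ?J2"
    then obtain a b where "\<sigma> = a \<union> b" "a \<subseteq> S1" "b \<subset> S2"
      by (auto simp: join_def simplex_boundary_def)
    then show "\<sigma> \<subseteq> ?S \<and> \<not> S2 \<subseteq> \<sigma>" using S(3) by blast
  next
    assume "\<sigma> \<subseteq> ?S \<and> \<not> S2 \<subseteq> \<sigma>"
    then have "\<sigma> = (\<sigma> \<inter> S1) \<union> (\<sigma> \<inter> S2)" "\<sigma> \<inter> S2 \<in> simplex_boundary S2" "\<sigma> \<inter> S1 \<in> Pow S1"
      by (auto simp: simplex_boundary_def)
    then show "\<sigma> \<in> ?J2" unfolding join_def by blast
  qed
  have K_iff: "\<sigma> \<in> K \<and> \<sigma> \<subseteq> ?S \<longleftrightarrow> \<sigma> \<subseteq> ?S \<and> \<not> S1 \<subseteq> \<sigma>" for \<sigma>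
    using ind J1[of \<sigma>] by (auto simp: induced_def)
  have K'_iff: "\<sigma> \<in> K' \<longleftrightarrow> \<sigma> \<in> K \<and> \<not> \<sigma> \<subseteq> ?S \<or> \<sigma> \<subseteq> ?S \<and> \<not> S2 \<subseteq> \<sigma>" for \<sigma>
    unfolding K' using J1[of \<sigma>] J2[of \<sigma>] K_iff[of \<sigma>] by blast
  have finS: "finite ?S" and cardS: "card ?S = Suc n"
    using S card_Un_disjoint[OF S(1,2,3)] by simp_all
  have T: "I \<subseteq> ?S \<and> card I = n \<longleftrightarrow> (\<exists>s\<in>?S. I = ?S - {s})" for I
  proof
    assume "I \<subseteq> ?S \<and> card I = n"
    then have "I \<subseteq> ?S" "card I = n" by simp_all
    then show "\<exists>s\<in>?S. I = ?S - {s}" by (rule card_minus_one[OF finS cardS]) blast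
  next
    assume "\<exists>s\<in>?S. I = ?S - {s}"
    then obtain s where "s \<in> ?S" "I = ?S - {s}" by blast
    then show "I \<subseteq> ?S \<and> card I = n" using cardS finS by (simp add: card_Diff_singleton)
  qed
  define C where "C = {I \<in> K. card I = n \<and> \<not> I \<subseteq> ?S}"
  have inside: "I \<in> (\<lambda>s. ?S - {s}) ` S1 \<longleftrightarrow> (I \<subseteq> ?S \<and> card I = n) \<and> \<not> S1 \<subseteq> I"
    "I \<in> (\<lambda>s. ?S - {s}) ` S2 \<longleftrightarrow> (I \<subseteq> ?S \<and> card I = n) \<and> \<not> S2 \<subseteq> I" for I
    unfolding T using S(3) by blast+
  have "facets n K = C \<union> (\<lambda>s. ?S - {s}) ` S1"
  proof (rule Set.set_eqI)
    fix I show "I \<in> facets n K \<longleftrightarrow> I \<in> C \<union> (\<lambda>s. ?S - {s}) ` S1"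
      unfolding Un_iff inside using K_iff[of I] by (auto simp: facets_def C_def)
  qed
  moreover have "facets n K' = C \<union> (\<lambda>s. ?S - {s}) ` S2"
  proof (rule Set.set_eqI)
    fix I show "I \<in> facets n K' \<longleftrightarrow> I \<in> C \<union> (\<lambda>s. ?S - {s}) ` S2"
      unfolding Un_iff inside using K'_iff[of I] by (auto simp: facets_def C_def)
  qed
  moreover have "C \<inter> (\<lambda>s. ?S - {s}) ` ?S = {}" by (auto simp: C_def)
  moreover have "\<forall>I\<in>facets n K. \<not> S1 \<subseteq> I"
  proof (intro ballI notI)
    fix I assume "I \<in> facets n K" "S1 \<subseteq> I"
    then have "S1 \<in> K" using sc(1) unfolding facets_def simplicial_complex_def by blast
    then show False using K_iff[of S1] by blast
  qed
  moreover have "\<forall>I\<in>facets n K'. \<not> S2 \<subseteq> I"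
  proof (intro ballI notI)
    fix I assume "I \<in> facets n K'" "S2 \<subseteq> I"
    \<comment> \<open>Here it matters that K' is closed under faces: the flip removes S2 itself, so
      no maximal simplex may contain it.\<close>
    then have "S2 \<in> K'" using sc(2) unfolding facets_def simplicial_complex_def by blast
    then show False using K'_iff[of S2] by blast
  qed
  ultimately show thesis by (rule that)
qed

text \<open>The case S1 = {i}, S2 = I. The boundary of a point is the complex with only the empty
  face, so the removed join consists of all faces of I; the proper ones return with the
  cone.\<close>

lemma stellar_is_bistellar:
  assumes sc: "simplicial_complex K" and I: "I \<in> facets n K" "i \<notin> \<Union>K"
    and K': "K' = (K - {I}) \<union> join (Pow {i}) (simplex_boundary I)"
  shows "induced K ({i} \<union> I) = join (simplex_boundary {i}) (Pow I)"
    and "K' = (K - join (simplex_boundary {i}) (Pow I)) \<union> join (Pow {i}) (simplex_boundary I)"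
proof -
  have IK: "I \<in> K" using I(1) by (simp add: facets_def)
  have faces: "\<sigma> \<in> K" if "\<sigma> \<subseteq> I" for \<sigma>
    using sc IK that unfolding simplicial_complex_def by blast
  have "simplex_boundary {i} = {{}}" by (auto simp: simplex_boundary_def)
  then have J: "join (simplex_boundary {i}) (Pow I) = Pow I" by (simp add: join_def Pow_def)
  show "induced K ({i} \<union> I) = join (simplex_boundary {i}) (Pow I)"
    unfolding J induced_def using faces I(2) by blast
  have "simplex_boundary I \<subseteq> join (Pow {i}) (simplex_boundary I)"
    unfolding join_def by blast
  then have "Pow I - {I} \<subseteq> join (Pow {i}) (simplex_boundary I)" by (simp add: simplex_boundary_def)
  then show "K' = (K - join (simplex_boundary {i}) (Pow I)) \<union> join (Pow {i}) (simplex_boundary I)"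
    unfolding J K' by blast
qed

lemma dm_flip:
  fixes e :: "'n::finite \<Rightarrow> 'a::euclidean_space" and lam lam' :: "'v \<Rightarrow> 'a"
  assumes frame: "orthonormal_frame e"
    and data: "multifan_data K \<epsilon> lam" "multifan_data K' \<epsilon>' lam'"
    and S: "finite S1" "finite S2" "S1 \<inter> S2 = {}" "S1 \<noteq> {}" "S2 \<noteq> {}" "card S1 + card S2 = CARD('n) + 1"
    and ind: "induced K (S1 \<union> S2) = join (simplex_boundary S1) (Pow S2)"
    and K': "K' = (K - join (simplex_boundary S1) (Pow S2)) \<union> join (Pow S1) (simplex_boundary S2)"
    and lam: "\<forall>v\<in>\<Union>K \<inter> \<Union>K'. lam' v = lam v"
    and sgn: "\<forall>I\<in>facets CARD('n) K \<inter> facets CARD('n) K'. \<forall>f. ordering f I \<longrightarrow> \<epsilon>' f = \<epsilon> f"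
    and k: "k \<le> CARD('n)"
  shows "dm e K' \<epsilon>' lam' ! k - dm e K \<epsilon> lam ! k =
    (if k < card S2 then 1 else 0) - (if k < card S1 then 1 else 0)"
proof -
  have sc: "simplicial_complex K" "simplicial_complex K'"
    using data by (simp_all add: multifan_data_def oriented_pseudomanifold_def pseudomanifold_def)
  obtain C where C: "facets CARD('n) K = C \<union> (\<lambda>s. S1 \<union> S2 - {s}) ` S1"
    "facets CARD('n) K' = C \<union> (\<lambda>s. S1 \<union> S2 - {s}) ` S2"
    "C \<inter> (\<lambda>s. S1 \<union> S2 - {s}) ` (S1 \<union> S2) = {}"
    "\<forall>I\<in>facets CARD('n) K. \<not> S1 \<subseteq> I" "\<forall>I\<in>facets CARD('n) K'. \<not> S2 \<subseteq> I"
    using bistellar_facets[OF sc S ind K'] .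
  interpret flip e K K' \<epsilon> \<epsilon>' lam lam' S1 S2 C
  proof unfold_locales
    show "lam' v = lam v" if "v \<in> \<Union>K \<inter> \<Union>K'" for v using bspec[OF lam that] .
    show "\<epsilon>' f = \<epsilon> f" if "f \<in> orderings C" for f
    proof -
      have "range f \<in> facets CARD('n) K \<inter> facets CARD('n) K'" "ordering f (range f)"
        using that unfolding C(1,2) by (simp_all add: orderings_def ordering_iff)
      then show ?thesis using sgn by blast
    qed
    show "\<not> S1 \<subseteq> I" if "I \<in> facets CARD('n) K" for I using bspec[OF C(4) that] .
    show "\<not> S2 \<subseteq> I" if "I \<in> facets CARD('n) K'" for I using bspec[OF C(5) that] .
  qed (fact frame data S C)+
  have nth: "dm e K0 \<epsilon>0 lam0 ! k =
      int (graded_dim (\<Union>K0) (volume_poly e (\<Union>K0) (weight e K0 \<epsilon>0 lam0) lam0) (2 * k))"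
    for K0 and \<epsilon>0 :: "('n \<Rightarrow> 'v) \<Rightarrow> int" and lam0 :: "'v \<Rightarrow> 'a"
    using k unfolding dm_def by (subst nth_map) (simp_all del: upt_Suc)
  show ?thesis
    unfolding nth using graded_dim_flip[OF k] by (simp split: if_splits)
qed

lemma map2_diff_nth_eqI:
  assumes "length xs = m" "length ys = m" "p \<le> m" "q \<le> m"
    and "\<And>k. k < m \<Longrightarrow> xs ! k - ys ! k = (if k < q then 1 else 0) - (if k < p then 1 else (0::int))"
  shows "map2 (-) xs ys =
    map2 (-) (replicate q 1 @ replicate (m - q) 0) (replicate p 1 @ replicate (m - p) 0)"
  using assms by (intro nth_equalityI) (simp_all add: nth_append)

theorem theorem11p5:
  fixes e :: "'n::finite \<Rightarrow> 'a::euclidean_space"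
    and K K' :: "'v set set"
    and \<epsilon> \<epsilon>' :: "('n \<Rightarrow> 'v) \<Rightarrow> int"
    and lam lam' :: "'v \<Rightarrow> 'a"
    and p q n :: nat
  assumes "orthonormal_frame e"
    and "n = CARD('n)"
    and "p \<ge> 1" and "q \<ge> 1" and "p + q = n + 1"
    and "multifan_data K \<epsilon> lam"
    and "multifan_data K' \<epsilon>' lam'"
    and "is_flip p q K \<epsilon> lam K' \<epsilon>' lam'"
  shows "map2 (-) (dm e K' \<epsilon>' lam') (dm e K \<epsilon> lam) =
         map2 (-) (replicate q 1 @ replicate (n + 1 - q) 0)
                  (replicate p 1 @ replicate (n + 1 - p) 0)"
proof -
  have data: "multifan_data K \<epsilon> lam" "multifan_data K' \<epsilon>' lam'" by fact+
  have sc: "simplicial_complex K" "simplicial_complex K'"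
    using data by (simp_all add: multifan_data_def oriented_pseudomanifold_def pseudomanifold_def)
  note flip_conds = assms(8)[unfolded is_flip_def]
  have flip: "p \<ge> 2 \<and> q \<ge> 2 \<and> bistellar_flip p q K lam K' \<or>
      p = 1 \<and> q = CARD('n) \<and> stellar_flip CARD('n) K K' lam' \<or>
      p = CARD('n) \<and> q = 1 \<and> stellar_flip CARD('n) K' K lam"
    by (rule conjunct1[OF flip_conds])
  have lam: "\<forall>v\<in>\<Union>K \<inter> \<Union>K'. lam' v = lam v"
    by (rule conjunct1[OF conjunct2[OF flip_conds]])
  have sgn: "\<forall>I\<in>facets CARD('n) K \<inter> facets CARD('n) K'. \<forall>f. ordering f I \<longrightarrow> \<epsilon>' f = \<epsilon> f"
    by (rule conjunct2[OF conjunct2[OF flip_conds]])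
  have pq: "p \<le> n + 1" "q \<le> n + 1" and n: "n = CARD('n)" by (use assms in auto)
  have main: "dm e K' \<epsilon>' lam' ! k - dm e K \<epsilon> lam ! k = (if k < q then 1 else 0) - (if k < p then 1 else 0)"
    if k: "k < n + 1" for k
    using flip
  proof (elim disjE conjE)
    assume "bistellar_flip p q K lam K'"
    then obtain S1 S2 where S: "finite S1" "finite S2" "S1 \<inter> S2 = {}" "card S1 = p" "card S2 = q"
      "induced K (S1 \<union> S2) = join (simplex_boundary S1) (Pow S2)"
      "K' = (K - join (simplex_boundary S1) (Pow S2)) \<union> join (Pow S1) (simplex_boundary S2)"
      unfolding bistellar_flip_def by blast
    have "S1 \<noteq> {}" "S2 \<noteq> {}" "card S1 + card S2 = CARD('n) + 1" "k \<le> CARD('n)"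
      using S assms(2-5) k by auto
    from dm_flip[OF assms(1) data S(1-3) this(1-3) S(6,7) lam sgn this(4)]
    show ?thesis unfolding S(4,5) .
  next
    assume p: "p = 1" and q: "q = CARD('n)" and "stellar_flip CARD('n) K K' lam'"
    then obtain I i where I: "I \<in> facets CARD('n) K" "i \<notin> \<Union>K"
      "K' = (K - {I}) \<union> join (Pow {i}) (simplex_boundary I)"
      unfolding stellar_flip_def by blast
    have "I \<in> K" "card I = CARD('n)" using I(1) by (simp_all add: facets_def)
    then have "finite {i}" "finite I" "{i} \<inter> I = {}" "{i} \<noteq> {}" "I \<noteq> {}"
      "card {i} + card I = CARD('n) + 1" "k \<le> CARD('n)"
      using I(2) sc(1) k n by (auto simp: simplicial_complex_def)
    from dm_flip[OF assms(1) data this(1-6) stellar_is_bistellar[OF sc(1) I] lam sgn this(7)]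
    show ?thesis using \<open>card I = CARD('n)\<close> p q by simp
  next
    assume p: "p = CARD('n)" and q: "q = 1" and "stellar_flip CARD('n) K' K lam"
    then obtain I i where I: "I \<in> facets CARD('n) K'" "i \<notin> \<Union>K'"
      "K = (K' - {I}) \<union> join (Pow {i}) (simplex_boundary I)"
      unfolding stellar_flip_def by blast
    have "I \<in> K'" "card I = CARD('n)" using I(1) by (simp_all add: facets_def)
    then have "finite {i}" "finite I" "{i} \<inter> I = {}" "{i} \<noteq> {}" "I \<noteq> {}"
      "card {i} + card I = CARD('n) + 1" "k \<le> CARD('n)"
      using I(2) sc(2) k n by (auto simp: simplicial_complex_def)
    moreover have "\<forall>v\<in>\<Union>K' \<inter> \<Union>K. lam v = lam' v"
      using lam by (simp add: Int_commute)
    moreover have "\<forall>I\<in>facets CARD('n) K' \<inter> facets CARD('n) K. \<forall>f. ordering f I \<longrightarrow> \<epsilon> f = \<epsilon>' f"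
      using sgn by (simp add: Int_commute)
    \<comment> \<open>The flip is read backwards, from K' to K, and the resulting difference is
      negated.\<close>
    ultimately have "dm e K \<epsilon> lam ! k - dm e K' \<epsilon>' lam' ! k =
        (if k < card I then 1 else 0) - (if k < card {i} then 1 else 0)"
      by (intro dm_flip[OF assms(1) data(2,1) _ _ _ _ _ _ stellar_is_bistellar[OF sc(2) I]])
    then show ?thesis using \<open>card I = CARD('n)\<close> p q by simp
  qed
  have "length (dm e K' \<epsilon>' lam') = n + 1" "length (dm e K \<epsilon> lam) = n + 1"
    by (simp_all add: dm_def n)
  from map2_diff_nth_eqI[OF this pq main] show ?thesis .
qed

end
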